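(* Let $M$ be a non-orientable surface equipped with a complete euclidean or hyperbolic structure, and let $\gamma:S^1\to M$ be an orientation reversing generic regular closed curve. Then $$W(\gamma)=\sum_{d\in D(\gamma)}\operatorname{sgn}(\gamma,d)+2\mathbb Z=\sum_{d\in D_\pm(\gamma)}\operatorname{sgn}(\gamma,d)+2\mathbb Z\in\mathbb Z/2\mathbb Z,$$ where $W(\gamma)\in\mathbb Z/2\mathbb Z$ is the winding number of $\gamma$, $D(\gamma)$ is the set of double points of $\gamma$, and $D_\pm(\gamma)\subset D(\gamma)$ and $\operatorname{sgn}(\gamma,d)\in\{-1,0,+1\}$ (whose class mod $2$ is well defined) are as defined in the context.
   Context: A regular closed curve is a $C^1$ immersion $\gamma:S^1\to M$; it is generic if all its self-intersection points are transversal double points. Let $p_M:\widetilde M\to M$ be the universal covering, where $\widetilde M$ is the euclidean plane $\mathbb E^2$ or the hyperbolic plane $\mathbb H^2$ with its standard orientation, and let $p_{S^1}:\mathbb R\to S^1$, $p_{S^1}(t)=(\cos 2\pi t,\sin 2\pi t)$. A cover of $\gamma$ is a lift $\widetilde\gamma:\mathbb R\to\widetilde M$ of $\gamma\circ p_{S^1}$ to $\widetilde M$. Let $T_0$ be the deck transformation with $T_0\circ\widetilde\gamma(t)=\widetilde\gamma(t+1)$. "$\gamma$ is orientation reversing" means that $T_0$ reverses orientation; such a $\gamma$ is automatically non-null-homotopic. Double points. $D(\gamma)$ is the set of double points of $\gamma$. At $d\in D(\gamma)$ the curve splits into two loops based at $d$; $D_\pm(\gamma)$ is the set of those $d$ for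 which one of these two loops is null-homotopic, equivalently for which some (equivalently every) cover $\widetilde\gamma$ has a double point $\widetilde d$ with $p_M(\widetilde d)=d$. Put $D_0(\gamma)=D(\gamma)\setminus D_\pm(\gamma)$. Signs. For a double point $\widetilde d=\widetilde\gamma(t_1)=\widetilde\gamma(t_2)$, $t_1<t_2$, of a cover $\widetilde\gamma$, and small $\delta>0$, $\operatorname{sgn}(\widetilde\gamma,\widetilde d)=+1$ (resp. $-1$) if the arc $\widetilde\gamma((t_2-\delta,t_2+\delta))$ crosses the arc $\widetilde\gamma((t_1-\delta,t_1+\delta))$ from left to right (resp. from right to left). For $d\in D_0(\gamma)$ set $\operatorname{sgn}(\gamma,d)=0$. For $d\in D_\pm(\gamma)$ set $\operatorname{sgn}(\gamma,d)=\operatorname{sgn}(\widetilde\gamma,\widetilde d)$ for some choice of cover $\widetilde\gamma$ and double point $\widetilde d$ of $\widetilde\gamma$ over $d$; the value depends on the choices, but its class mod $2$ does not. Winding number. $T_0$ is a glide reflection (along an axis, with nonzero translation length) of $\widetilde M$. Let $X$ be the nowhere vanishing, $T_0$-invariant vector field on $\widetilde M$ generating the one-parameter group of translations along the axis of $T_0$ in the direction in which $T_0$ translates. Let $\theta:\mathbb R\to\mathbb R$ be a continuous choice of the oriented angle from $X(\widetilde\gamma(t))$ to $\widetilde\gamma'(t)$. Since $T_0$ reverses orientation, $\theta(0)+\theta(1)\in 2\pi\mathbb Z$, and $W(\gamma)$ is the class of $\frac{1}{2\pi}(\theta(0)+\theta(1))$ in $\mathbb Z/2\mathbb Z$, which is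 independent of the choices. *)

theory Defs
  imports "HOL-Analysis.Analysis"
begin

section \<open>The two model planes\<close>

datatype geometry = Euclidean | Hyperbolic

text \<open>The hyperbolic plane is the upper half-plane. Both models sit in the complex plane
  conformally, with the orientation of the complex plane as standard orientation; hence oriented
  angles and left and right can be read off from complex numbers.\<close>

fun model_plane :: "geometry \<Rightarrow> complex set" where
  "model_plane Euclidean = UNIV"
| "model_plane Hyperbolic = {z. Im z > 0}"

fun model_dist :: "geometry \<Rightarrow> complex \<Rightarrow> complex \<Rightarrow> real" where
  "model_dist Euclidean z w = dist z w"
| "model_dist Hyperbolic z w = arcosh (1 + (cmod (z - w))\<^sup>2 / (2 * Im z * Im w))"

text \<open>Cross product of two plane vectors: positive iff \<open>w\<close> points to the left of \<open>v\<close>.\<close>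

definition cross2 :: "complex \<Rightarrow> complex \<Rightarrow> real" where
  "cross2 v w = Im (cnj v * w)"

text \<open>\<open>cross2 (D 1) (D \<i>)\<close> is the Jacobian determinant of a real linear \<open>D\<close>.\<close>

definition orientation_preserving_on :: "complex set \<Rightarrow> (complex \<Rightarrow> complex) \<Rightarrow> bool" where
  "orientation_preserving_on S f \<longleftrightarrow>
     (\<forall>z\<in>S. \<exists>D. (f has_derivative D) (at z) \<and> cross2 (D 1) (D \<i>) > 0)"

definition orientation_reversing_on :: "complex set \<Rightarrow> (complex \<Rightarrow> complex) \<Rightarrow> bool" where
  "orientation_reversing_on S f \<longleftrightarrow>
     (\<forall>z\<in>S. \<exists>D. (f has_derivative D) (at z) \<and> cross2 (D 1) (D \<i>) < 0)"

definition model_isometry :: "geometry \<Rightarrow> (complex \<Rightarrow> complex) \<Rightarrow> bool" where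
  "model_isometry g f \<longleftrightarrow>
     bij_betw f (model_plane g) (model_plane g) \<and>
     (\<forall>z\<in>model_plane g. \<forall>w\<in>model_plane g. model_dist g (f z) (f w) = model_dist g z w)"


section \<open>Complete euclidean and hyperbolic surfaces\<close>

definition isometric_chart ::
    "geometry \<Rightarrow> 'a::metric_space set \<Rightarrow> 'a set \<Rightarrow> ('a \<Rightarrow> complex) \<Rightarrow> bool" where
  "isometric_chart g M U f \<longleftrightarrow>
     openin (top_of_set M) U \<and> open (f ` U) \<and> f ` U \<subseteq> model_plane g \<and>
     (\<forall>x\<in>U. \<forall>y\<in>U. model_dist g (f x) (f y) = dist x y)"

text \<open>The metric of \<open>M\<close> need only induce the geometric structure locally. If it is complete,
  so is the path metric of the structure, which is at least as large and defines the same topology;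
  conversely the path metric of a complete structure satisfies this definition.\<close>

definition complete_geometric_surface :: "geometry \<Rightarrow> 'a::metric_space set \<Rightarrow> bool" where
  "complete_geometric_surface g M \<longleftrightarrow>
     M \<noteq> {} \<and> connected M \<and> complete M \<and>
     (\<forall>x\<in>M. \<exists>U f. x \<in> U \<and> isometric_chart g M U f)"

definition orientable_surface :: "geometry \<Rightarrow> 'a::metric_space set \<Rightarrow> bool" where
  "orientable_surface g M \<longleftrightarrow>
     (\<exists>A. (\<forall>(U, f)\<in>A. isometric_chart g M U f) \<and>
          M \<subseteq> (\<Union>(U, f)\<in>A. U) \<and>
          (\<forall>(U, f)\<in>A. \<forall>(V, h)\<in>A.
             orientation_preserving_on (f ` (U \<inter> V)) (h \<circ> inv_into U f)))"

text \<open>The covering is universal since the model planes are simply connected.\<close>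

definition universal_covering ::
    "geometry \<Rightarrow> 'a::metric_space set \<Rightarrow> (complex \<Rightarrow> 'a) \<Rightarrow> bool" where
  "universal_covering g M p \<longleftrightarrow>
     covering_space (model_plane g) p M \<and>
     (\<forall>z\<in>model_plane g. \<exists>V. open V \<and> z \<in> V \<and> V \<subseteq> model_plane g \<and>
        (\<forall>x\<in>V. \<forall>y\<in>V. dist (p x) (p y) = model_dist g x y))"

definition deck_transformation ::
    "geometry \<Rightarrow> (complex \<Rightarrow> 'a) \<Rightarrow> (complex \<Rightarrow> complex) \<Rightarrow> bool" where
  "deck_transformation g p T \<longleftrightarrow>
     (\<exists>T'. homeomorphism (model_plane g) (model_plane g) T T') \<and>
     (\<forall>z\<in>model_plane g. p (T z) = p z)"


section \<open>Generic regular closed curves\<close>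

definition circle_cover :: "real \<Rightarrow> complex" where
  "circle_cover t = cis (2 * pi * t)"

definition regular_closed_curve ::
    "geometry \<Rightarrow> 'a::metric_space set \<Rightarrow> (complex \<Rightarrow> 'a) \<Rightarrow> bool" where
  "regular_closed_curve g M \<gamma> \<longleftrightarrow>
     continuous_on (sphere 0 1) \<gamma> \<and> \<gamma> ` sphere 0 1 \<subseteq> M \<and>
     (\<forall>U f. isometric_chart g M U f \<longrightarrow>
        (f \<circ> \<gamma> \<circ> circle_cover) C1_differentiable_on {t. \<gamma> (circle_cover t) \<in> U} \<and>
        (\<forall>t. \<gamma> (circle_cover t) \<in> U \<longrightarrow>
             vector_derivative (f \<circ> \<gamma> \<circ> circle_cover) (at t) \<noteq> 0))"

definition double_points :: "(complex \<Rightarrow> 'a) \<Rightarrow> 'a set" where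
  "double_points \<gamma> = {d. \<exists>x\<in>sphere 0 1. \<exists>y\<in>sphere 0 1. x \<noteq> y \<and> \<gamma> x = d \<and> \<gamma> y = d}"

definition generic_curve ::
    "geometry \<Rightarrow> 'a::metric_space set \<Rightarrow> (complex \<Rightarrow> 'a) \<Rightarrow> bool" where
  "generic_curve g M \<gamma> \<longleftrightarrow>
     (\<forall>d\<in>double_points \<gamma>. card {x \<in> sphere 0 1. \<gamma> x = d} = 2) \<and>
     (\<forall>s t U f. circle_cover s \<noteq> circle_cover t \<longrightarrow>
        \<gamma> (circle_cover s) = \<gamma> (circle_cover t) \<longrightarrow>
        isometric_chart g M U f \<longrightarrow> \<gamma> (circle_cover s) \<in> U \<longrightarrow>
        cross2 (vector_derivative (f \<circ> \<gamma> \<circ> circle_cover) (at s))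
               (vector_derivative (f \<circ> \<gamma> \<circ> circle_cover) (at t)) \<noteq> 0)"

definition cover_of_curve ::
    "geometry \<Rightarrow> (complex \<Rightarrow> 'a) \<Rightarrow> (complex \<Rightarrow> 'a) \<Rightarrow> (real \<Rightarrow> complex) \<Rightarrow> bool" where
  "cover_of_curve g p \<gamma> c \<longleftrightarrow>
     continuous_on UNIV c \<and> range c \<subseteq> model_plane g \<and> (\<forall>t. p (c t) = \<gamma> (circle_cover t))"

definition period_deck ::
    "geometry \<Rightarrow> (complex \<Rightarrow> 'a) \<Rightarrow> (real \<Rightarrow> complex) \<Rightarrow> (complex \<Rightarrow> complex) \<Rightarrow> bool" where
  "period_deck g p c T \<longleftrightarrow> deck_transformation g p T \<and> (\<forall>t. T (c t) = c (t + 1))"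

definition orientation_reversing_curve ::
    "geometry \<Rightarrow> (complex \<Rightarrow> 'a) \<Rightarrow> (complex \<Rightarrow> 'a) \<Rightarrow> bool" where
  "orientation_reversing_curve g p \<gamma> \<longleftrightarrow>
     (\<exists>c T. cover_of_curve g p \<gamma> c \<and> period_deck g p c T \<and>
            orientation_reversing_on (model_plane g) T)"


section \<open>Signs of double points\<close>

definition curve_arc :: "(complex \<Rightarrow> 'a) \<Rightarrow> real \<Rightarrow> real \<Rightarrow> real \<Rightarrow> 'a" where
  "curve_arc \<gamma> s t = (\<lambda>u. \<gamma> (circle_cover (s + u * (t - s))))"

definition null_homotopic_loop :: "'a::topological_space set \<Rightarrow> (real \<Rightarrow> 'a) \<Rightarrow> bool" where
  "null_homotopic_loop M q \<longleftrightarrow> homotopic_paths M q (\<lambda>_. pathstart q)"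

definition double_points_pm :: "'a::topological_space set \<Rightarrow> (complex \<Rightarrow> 'a) \<Rightarrow> 'a set" where
  "double_points_pm M \<gamma> =
     {d \<in> double_points \<gamma>. \<exists>s t. 0 \<le> s \<and> s < t \<and> t < 1 \<and>
        \<gamma> (circle_cover s) = d \<and> \<gamma> (circle_cover t) = d \<and>
        (null_homotopic_loop M (curve_arc \<gamma> s t) \<or>
         null_homotopic_loop M (curve_arc \<gamma> t (s + 1)))}"

text \<open>The second branch crosses the first one from left to right iff its velocity points to the
  right of the velocity of the first.\<close>

definition cover_sgn :: "(real \<Rightarrow> complex) \<Rightarrow> real \<Rightarrow> real \<Rightarrow> int" where
  "cover_sgn c t1 t2 =
     (let x = cross2 (vector_derivative c (at t1)) (vector_derivative c (at t2))
      in if x < 0 then 1 else if x > 0 then - 1 else 0)"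

definition curve_sgn ::
    "geometry \<Rightarrow> 'a::topological_space set \<Rightarrow> (complex \<Rightarrow> 'a) \<Rightarrow> (complex \<Rightarrow> 'a) \<Rightarrow> 'a \<Rightarrow> int" where
  "curve_sgn g M p \<gamma> d =
     (if d \<in> double_points_pm M \<gamma>
      then SOME e. \<exists>c t1 t2. cover_of_curve g p \<gamma> c \<and> t1 < t2 \<and> c t1 = c t2 \<and> p (c t1) = d \<and>
                            e = cover_sgn c t1 t2
      else 0)"


section \<open>The winding number\<close>

text \<open>\<open>a\<close> parametrises by arc length the axis of the glide reflection \<open>T\<close>, in the direction in
  which \<open>T\<close> translates.\<close>

definition directed_axis :: "geometry \<Rightarrow> (complex \<Rightarrow> complex) \<Rightarrow> (real \<Rightarrow> complex) \<Rightarrow> bool" where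
  "directed_axis g T a \<longleftrightarrow>
     range a \<subseteq> model_plane g \<and> (\<forall>s t. model_dist g (a s) (a t) = \<bar>s - t\<bar>) \<and>
     (\<exists>l>0. \<forall>s. T (a s) = a (s + l))"

definition translation_group ::
    "geometry \<Rightarrow> (real \<Rightarrow> complex) \<Rightarrow> (real \<Rightarrow> complex \<Rightarrow> complex) \<Rightarrow> bool" where
  "translation_group g a \<phi> \<longleftrightarrow>
     (\<forall>s. model_isometry g (\<phi> s) \<and> orientation_preserving_on (model_plane g) (\<phi> s) \<and>
          (\<forall>t. \<phi> s (a t) = a (s + t))) \<and>
     (\<forall>s t. \<forall>z\<in>model_plane g. \<phi> (s + t) z = \<phi> s (\<phi> t z))"

definition generating_field ::
    "geometry \<Rightarrow> (complex \<Rightarrow> complex) \<Rightarrow> (complex \<Rightarrow> complex) \<Rightarrow> bool" where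
  "generating_field g T X \<longleftrightarrow>
     (\<exists>a \<phi>. directed_axis g T a \<and> translation_group g a \<phi> \<and>
        (\<forall>z\<in>model_plane g. ((\<lambda>s. \<phi> s z) has_vector_derivative X z) (at 0)))"

definition angle_function ::
    "(complex \<Rightarrow> complex) \<Rightarrow> (real \<Rightarrow> complex) \<Rightarrow> (real \<Rightarrow> real) \<Rightarrow> bool" where
  "angle_function X c \<theta> \<longleftrightarrow>
     continuous_on UNIV \<theta> \<and>
     (\<forall>t. \<exists>r>0. vector_derivative c (at t) = of_real r * cis (\<theta> t) * X (c t))"

text \<open>Elements of \<open>\<int>/2\<int>\<close> are cosets, i.e. sets of integers. The winding number is formed over all
  choices at once, so it is a single coset only if it exists and does not depend on them.\<close>

definition mod2_class :: "int \<Rightarrow> int set" where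
  "mod2_class m = range (\<lambda>k. m + 2 * k)"

definition winding_number_class ::
    "geometry \<Rightarrow> (complex \<Rightarrow> 'a) \<Rightarrow> (complex \<Rightarrow> 'a) \<Rightarrow> int set" where
  "winding_number_class g p \<gamma> =
     \<Union>{mod2_class m | m. \<exists>c T X \<theta>. cover_of_curve g p \<gamma> c \<and> period_deck g p c T \<and>
          generating_field g T X \<and> angle_function X c \<theta> \<and>
          (\<theta> 0 + \<theta> 1) / (2 * pi) = of_int m}"

end

theory Submission
  imports Defs "HOL-Complex_Analysis.Complex_Analysis"
begin

text \<open>The period transformation \<open>T\<close> of a cover is an orientation reversing isometry without fixed
  points. In a suitable conformal coordinate of the model plane it becomes \<open>w \<mapsto> cnj w + l\<close> with
  \<open>l > 0\<close>, and the field \<open>X\<close> becomes the constant \<open>1\<close>; so the angle \<open>\<theta>\<close> is the argument of the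
  velocity of the cover \<open>c\<close> in this coordinate.

  As in Hopf's proof of the Umlaufsatz, follow for fixed \<open>s\<close> the argument of the chord from \<open>c s\<close> to
  \<open>c t\<close> as \<open>t\<close> runs from \<open>s\<close>, where it is \<open>\<theta> s\<close>, to \<open>s + 1\<close>, where the chord
  \<open>l - 2 * \<i> * Im (c s)\<close> lies in the right half-plane. The number \<open>J s\<close> of full turns by which the
  final argument differs from the principal one is constant until \<open>c s = c t\<close> for some \<open>t\<close> strictly
  between \<open>s\<close> and \<open>s + 1\<close>, where it jumps by one because the crossing is transversal. Since \<open>T\<close>
  reflects the chords, \<open>J (s + 1) = m - J s\<close>, where \<open>\<theta> 0 + \<theta> 1 = 2 * pi * m\<close>. Hence \<open>m\<close> has the
  parity of the number of jumps in a period, and these correspond to the double points at which one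
  of the two loops is null-homotopic: a loop is null-homotopic iff its lift to the model plane is
  closed.\<close>

section \<open>Lifting arguments along paths of nonzero complex numbers\<close>

text \<open>Hopf's argument for a closed plane curve starts at an extreme point. A cover of
  \<open>\<gamma>\<close> is not closed, so the base point \<open>s\<close> runs through a whole
  period instead, and the symmetry under \<open>T\<close> compares the two ends of the period. This
  symmetry also reverses the sense of every jump one period later, which is why only a parity
  survives. A crossing is met exactly once per period: if \<open>c s = c t\<close> with
  \<open>s < t < s + 1\<close>, then \<open>c t = c (s + 1)\<close> is impossible.

  The geometric obstacle is that \<open>X\<close> is given through an arbitrary directed axis and an
  arbitrary translation group. Both are pinned down by distances alone: in the coordinate every
  admissible axis is the real line, and every admissible translation is a shift. Since the winding
  number is a union over all choices, some choice must also be exhibited, and every cover, not only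
  the one provided by the hypothesis, must have an orientation reversing period transformation. The
  sign of a double point is an unspecified choice as well; it is enough that every possible choice
  is odd.\<close>

definition angle_lift :: "(real \<Rightarrow> complex) \<Rightarrow> real \<Rightarrow> real \<Rightarrow> real \<Rightarrow> real \<Rightarrow> bool" where
  "angle_lift h a b x y \<longleftrightarrow>
     (\<exists>f. continuous_on {a..b} f \<and> f a = x \<and> f b = y \<and>
          (\<forall>u\<in>{a..b}. h u = of_real (cmod (h u)) * cis (f u)))"

lemma cis_cong_polar:
  assumes "z = of_real (cmod z) * cis x" "z = of_real (cmod z) * cis y" "z \<noteq> 0"
  obtains n :: int where "x = y + 2 * pi * of_int n"
proof -
  have "cis x = cis y" using assms by (metis mult_cancel_left norm_eq_zero of_real_eq_0_iff)
  then have "sin x = sin y \<and> cos x = cos y" by (simp add: complex_eq_iff)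
  then show ?thesis using that sin_cos_eq_iff by blast
qed

lemma polar_Arg: "z \<noteq> 0 \<Longrightarrow> z = of_real (cmod z) * cis (Arg z)"
  by (metis Arg_eq cis_conv_exp)

lemma cis_add_2pi_int: "cis (x + 2 * pi * of_int n) = cis x"
proof -
  have "sin (x + 2 * pi * of_int n) = sin x \<and> cos (x + 2 * pi * of_int n) = cos x"
    by (subst sin_cos_eq_iff) blast
  then show ?thesis by (simp add: complex_eq_iff)
qed

text \<open>Different multiples of \<open>2 * pi\<close> are at least \<open>2 * pi\<close> apart,
  so a continuous function with such values cannot vary on a connected set.\<close>

lemma continuous_int_multiple_constant:
  fixes f :: "'a::topological_space \<Rightarrow> real"
  assumes "connected S" "continuous_on S f" "\<And>x. x \<in> S \<Longrightarrow> \<exists>n::int. f x = 2 * pi * of_int n"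
  obtains n :: int where "\<And>x. x \<in> S \<Longrightarrow> f x = 2 * pi * of_int n"
proof -
  have "f constant_on S"
  proof (rule continuous_discrete_range_constant[OF assms(1,2)])
    fix x assume "x \<in> S"
    then obtain n :: int where n: "f x = 2 * pi * of_int n" using assms(3) by blast
    have "2 * pi \<le> norm (f y - f x)" if y: "y \<in> S" "f y \<noteq> f x" for y
    proof -
      obtain k :: int where k: "f y = 2 * pi * of_int k" using assms(3) y by blast
      have "\<bar>k - n\<bar> \<ge> 1" using y k n by (cases "k = n") auto
      then have "\<bar>of_int k - of_int n :: real\<bar> \<ge> 1" by linarith
      moreover have "norm (f y - f x) = 2 * pi * \<bar>of_int k - of_int n\<bar>"
        unfolding k n right_diff_distrib[symmetric] by (simp add: abs_mult)
      ultimately show ?thesis by (simp add: mult_le_cancel_left1)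
    qed
    then show "\<exists>e>0. \<forall>y. y \<in> S \<and> f y \<noteq> f x \<longrightarrow> e \<le> norm (f y - f x)"
      by (intro exI[of _ "2 * pi"]) auto
  qed
  then obtain v where v: "\<And>x. x \<in> S \<Longrightarrow> f x = v" by (auto simp: constant_on_def)
  show ?thesis
  proof (cases "S = {}")
    case False
    then obtain x where "x \<in> S" by blast
    then show ?thesis using assms(3)[of x] v that by metis
  qed (use that in auto)
qed

lemma angle_lift_join:
  assumes "angle_lift h a b x y" "angle_lift h b c y z" "a \<le> b" "b \<le> c"
  shows "angle_lift h a c x z"
proof -
  obtain f where f: "continuous_on {a..b} f" "f a = x" "f b = y"
      "\<forall>u\<in>{a..b}. h u = of_real (cmod (h u)) * cis (f u)"
    using assms(1) unfolding angle_lift_def by blast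
  obtain k where k: "continuous_on {b..c} k" "k b = y" "k c = z"
      "\<forall>u\<in>{b..c}. h u = of_real (cmod (h u)) * cis (k u)"
    using assms(2) unfolding angle_lift_def by blast
  let ?f = "\<lambda>u. if u \<le> b then f u else k u"
  have "continuous_on ({a..b} \<union> {b..c}) ?f"
    by (rule continuous_on_If) (use f k in auto)
  moreover have "{a..b} \<union> {b..c} = {a..c}" using assms(3,4) by auto
  ultimately have "continuous_on {a..c} ?f" by simp
  moreover have "?f a = x" "?f c = z" using f k assms(3,4) by (auto simp: not_le)
  moreover have "\<forall>u\<in>{a..c}. h u = of_real (cmod (h u)) * cis (?f u)"
    using f(4) k(4) by auto
  ultimately show ?thesis unfolding angle_lift_def by (intro exI[of _ ?f]) blast
qed

lemma angle_lift_shift: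
  assumes "angle_lift h a b x y"
  shows "angle_lift h a b (x + 2 * pi * of_int n) (y + 2 * pi * of_int n)"
proof -
  obtain f where f: "continuous_on {a..b} f" "f a = x" "f b = y"
      "\<forall>u\<in>{a..b}. h u = of_real (cmod (h u)) * cis (f u)"
    using assms(1) unfolding angle_lift_def by blast
  show ?thesis unfolding angle_lift_def
    by (intro exI[of _ "\<lambda>u. f u + 2 * pi * of_int n"])
       (use f in \<open>auto intro!: continuous_intros simp only: cis_add_2pi_int\<close>)
qed

lemma angle_lift_cnj:
  assumes "angle_lift h a b x y"
  shows "angle_lift (\<lambda>u. cnj (h u)) a b (- x) (- y)"
proof -
  obtain f where f: "continuous_on {a..b} f" "f a = x" "f b = y"
      "\<forall>u\<in>{a..b}. h u = of_real (cmod (h u)) * cis (f u)"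
    using assms(1) unfolding angle_lift_def by blast
  have *: "cnj (h u) = of_real (cmod (cnj (h u))) * cis (- f u)" if "u \<in> {a..b}" for u
  proof -
    have "cnj (h u) = cnj (of_real (cmod (h u)) * cis (f u))" using f(4) that by simp
    also have "\<dots> = of_real (cmod (cnj (h u))) * cis (- f u)" by (simp add: cis_cnj)
    finally show ?thesis .
  qed
  show ?thesis unfolding angle_lift_def
    by (intro exI[of _ "\<lambda>u. - f u"] conjI ballI continuous_on_minus *) (use f in simp_all)
qed

text \<open>The polar equation in \<open>angle_lift\<close> holds trivially at a zero of
  \<open>h\<close>, so uniqueness needs a path without zeros; two lifts then differ by a constant
  multiple of \<open>2 * pi\<close>.\<close>

lemma angle_lift_unique:
  assumes "angle_lift h a b x y" "angle_lift h a b x z" "a \<le> b" "\<And>u. u \<in> {a..b} \<Longrightarrow> h u \<noteq> 0"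
  shows "y = z"
proof -
  obtain f where f: "continuous_on {a..b} f" "f a = x" "f b = y"
      "\<forall>u\<in>{a..b}. h u = of_real (cmod (h u)) * cis (f u)"
    using assms(1) unfolding angle_lift_def by blast
  obtain k where k: "continuous_on {a..b} k" "k a = x" "k b = z"
      "\<forall>u\<in>{a..b}. h u = of_real (cmod (h u)) * cis (k u)"
    using assms(2) unfolding angle_lift_def by blast
  have *: "\<exists>n::int. f u - k u = 2 * pi * of_int n" if "u \<in> {a..b}" for u
    using cis_cong_polar[of "h u" "f u" "k u"] f(4) k(4) assms(4) that
    by (metis add_diff_cancel_left')
  obtain n :: int where n: "\<And>u. u \<in> {a..b} \<Longrightarrow> f u - k u = 2 * pi * of_int n"
    by (rule continuous_int_multiple_constant[of "{a..b}" "\<lambda>u. f u - k u"])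
       (use f k * in \<open>auto intro!: continuous_intros\<close>)
  show ?thesis using n[of a] n[of b] f k assms(3) by auto
qed

text \<open>After rotation by \<open>- w\<close> the path avoids the cut of \<open>Arg\<close>, so
  \<open>Arg\<close> itself provides the lift. Its end values are known exactly and not only modulo
  \<open>2 * pi\<close>, which is what measures a jump.\<close>

lemma angle_lift_slit:
  assumes "continuous_on {a..b} h" "a \<le> b"
    and "\<And>u. u \<in> {a..b} \<Longrightarrow> h u * cis (- w) \<notin> \<real>\<^sub>\<le>\<^sub>0"
  shows "angle_lift h a b (w + Arg (h a * cis (- w))) (w + Arg (h b * cis (- w)))"
proof -
  have "continuous_on {a..b} (\<lambda>u. w + Arg (h u * cis (- w)))"
    using assms by (intro continuous_intros) auto
  moreover have "h u = of_real (cmod (h u)) * cis (w + Arg (h u * cis (- w)))" if "u \<in> {a..b}" for u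
  proof -
    have "h u * cis (- w) \<noteq> 0" using assms(3)[OF that] by auto
    from polar_Arg[OF this] have "h u * cis (- w) = of_real (cmod (h u)) * cis (Arg (h u * cis (- w)))"
      by (simp add: norm_mult)
    then have "h u * (cis (- w) * cis w) = of_real (cmod (h u)) * (cis w * cis (Arg (h u * cis (- w))))"
      by (metis mult.assoc mult.commute)
    then show ?thesis by (simp add: cis_mult)
  qed
  ultimately show ?thesis unfolding angle_lift_def by blast
qed

text \<open>A logarithm on the convex, hence contractible, set \<open>S \<times> {a..b}\<close>
  gives one argument that is continuous in both variables. At either end it differs from the
  prescribed argument by a continuous multiple of \<open>2 * pi\<close>, so a single integer
  \<open>k\<close> serves for all \<open>s\<close>.\<close>

lemma angle_lift_family:
  fixes G :: "real \<Rightarrow> real \<Rightarrow> complex"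
  assumes cont: "continuous_on (S \<times> {a..b}) (\<lambda>(s, u). G s u)" and "convex S" "a \<le> b"
    and nz: "\<And>s u. s \<in> S \<Longrightarrow> u \<in> {a..b} \<Longrightarrow> G s u \<noteq> 0"
    and x: "continuous_on S x" "\<And>s. s \<in> S \<Longrightarrow> G s a = of_real (cmod (G s a)) * cis (x s)"
    and y: "continuous_on S y" "\<And>s. s \<in> S \<Longrightarrow> G s b = of_real (cmod (G s b)) * cis (y s)"
  shows "\<exists>k::int. \<forall>s\<in>S. angle_lift (G s) a b (x s) (y s + 2 * pi * of_int k)"
proof -
  have conv: "convex (S \<times> {a..b})" using \<open>convex S\<close> by (intro convex_Times) auto
  obtain L where L: "continuous_on (S \<times> {a..b}) L"
      and Le: "\<And>q. q \<in> S \<times> {a..b} \<Longrightarrow> (\<lambda>(s, u). G s u) q = exp (L q)"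
    by (rule continuous_logarithm_on_contractible[OF cont convex_imp_contractible[OF conv]])
       (use nz in auto)
  define A where "A s u = Im (L (s, u))" for s u
  have A: "G s u = of_real (cmod (G s u)) * cis (A s u)" if "s \<in> S" "u \<in> {a..b}" for s u
  proof -
    have "G s u = exp (L (s, u))" using Le[of "(s, u)"] that by simp
    then show ?thesis by (metis A_def exp_eq_polar norm_exp_eq_Re)
  qed
  have Aline: "continuous_on S (\<lambda>s. A s u)" if "u \<in> {a..b}" for u
    unfolding A_def by (intro continuous_intros continuous_on_compose2[OF L]) (use that in auto)
  have Acol: "continuous_on {a..b} (\<lambda>u. A s u)" if "s \<in> S" for s
    unfolding A_def by (intro continuous_intros continuous_on_compose2[OF L]) (use that in auto)
  have cS: "connected S" using \<open>convex S\<close> convex_connected by blast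
  have ab: "a \<in> {a..b}" "b \<in> {a..b}" using \<open>a \<le> b\<close> by auto
  obtain n1 :: int where n1: "\<And>s. s \<in> S \<Longrightarrow> x s - A s a = 2 * pi * of_int n1"
  proof (rule continuous_int_multiple_constant[OF cS, of "\<lambda>s. x s - A s a"])
    show "\<exists>n::int. x s - A s a = 2 * pi * of_int n" if "s \<in> S" for s
      using cis_cong_polar[OF x(2)[OF that] A[OF that ab(1)] nz[OF that ab(1)]]
      by (metis add_diff_cancel_left')
  qed (use x Aline ab in \<open>auto intro!: continuous_intros\<close>)
  obtain n2 :: int where n2: "\<And>s. s \<in> S \<Longrightarrow> y s - A s b = 2 * pi * of_int n2"
  proof (rule continuous_int_multiple_constant[OF cS, of "\<lambda>s. y s - A s b"])
    show "\<exists>n::int. y s - A s b = 2 * pi * of_int n" if "s \<in> S" for s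
      using cis_cong_polar[OF y(2)[OF that] A[OF that ab(2)] nz[OF that ab(2)]]
      by (metis add_diff_cancel_left')
  qed (use y Aline ab in \<open>auto intro!: continuous_intros\<close>)
  show ?thesis
  proof (intro exI ballI)
    fix s assume s: "s \<in> S"
    have "angle_lift (G s) a b (A s a) (A s b)"
      unfolding angle_lift_def using Acol[OF s] A[OF s] by (intro exI[of _ "A s"]) auto
    from angle_lift_shift[OF this, of n1]
    have "angle_lift (G s) a b (x s) (A s b + 2 * pi * of_int n1)" using n1[OF s] by (simp add: algebra_simps)
    moreover have "A s b + 2 * pi * of_int n1 = y s + 2 * pi * of_int (n1 - n2)"
      using n2[OF s] by (simp add: algebra_simps)
    ultimately show "angle_lift (G s) a b (x s) (y s + 2 * pi * of_int (n1 - n2))" by simp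
  qed
qed

section \<open>Parity of the number of jumps\<close>

lemma eventually_const_imp_const:
  fixes e :: "real \<Rightarrow> bool"
  assumes "a \<le> b" "\<And>s. s \<in> {a..b} \<Longrightarrow> eventually (\<lambda>t. e t = e s) (at s)"
  shows "e a = e b"
proof -
  define f :: "real \<Rightarrow> real" where "f s = (if e s then 1 else 0)" for s
  have "continuous_on {a..b} f"
  proof (intro continuous_at_imp_continuous_on ballI)
    fix s assume "s \<in> {a..b}"
    then have "eventually (\<lambda>t. e t = e s) (at s)" by (rule assms(2))
    then have "eventually (\<lambda>t. f t = f s) (at s)" by eventually_elim (auto simp: f_def)
    then show "isCont f s" unfolding isCont_def using tendsto_eventually by blast
  qed
  then have "f constant_on {a..b}"
    by (intro continuous_finite_range_constant)
       (auto simp: f_def intro: finite_subset[of _ "{0, 1}"])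
  then have "f a = f b" using \<open>a \<le> b\<close> by (auto simp: constant_on_def)
  then show ?thesis by (auto simp: f_def split: if_splits)
qed

text \<open>Negating \<open>e\<close> to the right of one jump \<open>r\<close> removes this jump
  and changes the value at \<open>b\<close> but not at \<open>a\<close>.\<close>

lemma parity_of_jumps:
  fixes e :: "real \<Rightarrow> bool"
  assumes "finite B" "a \<le> b" "B \<subseteq> {a<..<b}"
    and "\<And>s. s \<in> {a..b} - B \<Longrightarrow> eventually (\<lambda>t. e t = e s) (at s)"
    and "\<And>s. s \<in> B \<Longrightarrow> \<exists>v. eventually (\<lambda>t. e t = v) (at_left s) \<and>
                            eventually (\<lambda>t. e t = (\<not> v)) (at_right s)"
  shows "(e a = e b) \<longleftrightarrow> even (card B)"
  using assms
proof (induction B arbitrary: e)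
  case empty
  then show ?case using eventually_const_imp_const[of a b e] by auto
next
  case (insert r B)
  obtain v where v: "eventually (\<lambda>t. e t = v) (at_left r)"
      "eventually (\<lambda>t. e t = (\<not> v)) (at_right r)"
    using insert.prems(4)[of r] by auto
  \<comment> \<open>Nothing is known about \<open>e r\<close> itself, so it is replaced by the value
    on the left of \<open>r\<close>.\<close>
  define e' where "e' t = (if t = r then v else if t > r then \<not> e t else e t)" for t
  have r: "a < r" "r < b" using insert.prems(2) by auto
  have left: "eventually (\<lambda>t. e' t = e t) (at s)" if "s < r" for s
  proof -
    have "eventually (\<lambda>t. t < r) (at s)" using that by (rule order_tendstoD(2)[OF tendsto_ident_at])
    then show ?thesis by eventually_elim (auto simp: e'_def)
  qed
  have right: "eventually (\<lambda>t. e' t = (\<not> e t)) (at s)" if "s > r" for s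
  proof -
    have "eventually (\<lambda>t. t > r) (at s)" using that by (rule order_tendstoD(1)[OF tendsto_ident_at])
    then show ?thesis by eventually_elim (auto simp: e'_def)
  qed
  have "(e' a = e' b) \<longleftrightarrow> even (card B)"
  proof (rule insert.IH)
    show "a \<le> b" "B \<subseteq> {a<..<b}" using insert.prems by auto
    show "eventually (\<lambda>t. e' t = e' s) (at s)" if s: "s \<in> {a..b} - B" for s
    proof (cases s r rule: linorder_cases)
      case less
      then have "eventually (\<lambda>t. e t = e s) (at s)" using s insert.prems(3) by auto
      with left[OF less] show ?thesis by eventually_elim (use less in \<open>auto simp: e'_def\<close>)
    next
      case greater
      then have "eventually (\<lambda>t. e t = e s) (at s)" using s insert.prems(3) by auto
      with right[OF greater] show ?thesis by eventually_elim (use greater in \<open>auto simp: e'_def\<close>)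
    next
      case equal
      have "eventually (\<lambda>t. e' t = v) (at_left r)" using eventually_at_left_real[of "r - 1" r, simplified] v(1)
        by eventually_elim (auto simp: e'_def)
      moreover have "eventually (\<lambda>t. e' t = v) (at_right r)" using eventually_at_right_less[of r] v(2)
        by eventually_elim (auto simp: e'_def)
      ultimately show ?thesis using equal by (simp add: eventually_at_split e'_def)
    qed
    show "\<exists>v. eventually (\<lambda>t. e' t = v) (at_left s) \<and> eventually (\<lambda>t. e' t = (\<not> v)) (at_right s)"
      if s: "s \<in> B" for s
    proof -
      obtain w where w: "eventually (\<lambda>t. e t = w) (at_left s)"
        "eventually (\<lambda>t. e t = (\<not> w)) (at_right s)"
        using insert.prems(4)[of s] s by auto
      have "s \<noteq> r" using s insert.hyps by auto
      then consider "s < r" | "s > r" by linarith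
      then show ?thesis
      proof cases
        case 1
        have "eventually (\<lambda>t. e' t = w) (at_left s)" "eventually (\<lambda>t. e' t = (\<not> w)) (at_right s)"
          using w left[OF 1] unfolding eventually_at_split by (auto elim: eventually_elim2)
        then show ?thesis by blast
      next
        case 2
        have "eventually (\<lambda>t. e' t = (\<not> w)) (at_left s)" "eventually (\<lambda>t. e' t = (\<not> \<not> w)) (at_right s)"
          using w right[OF 2] unfolding eventually_at_split by (auto elim: eventually_elim2)
        then show ?thesis by blast
      qed
    qed
  qed
  moreover have "e' a = e a" "e' b = (\<not> e b)" using r by (auto simp: e'_def)
  ultimately show ?case using insert.hyps by auto
qed

section \<open>Differentiable plane curves\<close>

text \<open>Mean value inequality for \<open>f\<close> minus its linear part at \<open>s0\<close>.
  Both points may move, whereas the derivative at \<open>s0\<close> alone controls only chords with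
  one end at \<open>s0\<close>.\<close>

lemma C1_strictly_differentiable:
  fixes f :: "real \<Rightarrow> complex"
  assumes "open S" "s0 \<in> S" "\<And>s. s \<in> S \<Longrightarrow> (f has_vector_derivative f' s) (at s)"
    "isCont f' s0" "\<eta> > 0"
  shows "\<exists>\<delta>>0. \<forall>x y. \<bar>x - s0\<bar> < \<delta> \<longrightarrow> \<bar>y - s0\<bar> < \<delta> \<longrightarrow>
       cmod (f y - f x - of_real (y - x) * f' s0) \<le> \<eta> * \<bar>y - x\<bar>"
proof -
  obtain d1 where d1: "d1 > 0" "ball s0 d1 \<subseteq> S" using assms(1,2) openE by blast
  obtain d2 where d2: "d2 > 0" "\<And>s. dist s s0 < d2 \<Longrightarrow> dist (f' s) (f' s0) < \<eta>"
    using assms(4,5) unfolding continuous_at_eps_delta by blast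
  define d where "d = min d1 d2"
  have d: "d > 0" "ball s0 d \<subseteq> S" using d1 d2 by (auto simp: d_def)
  show ?thesis
  proof (intro exI[of _ d] conjI allI impI d(1))
    fix x y assume xy: "\<bar>x - s0\<bar> < d" "\<bar>y - s0\<bar> < d"
    have "norm (f y - f x - (y - x) *\<^sub>R f' s0) \<le> norm (y - x) * \<eta>"
    proof (rule differentiable_bound_linearization[where S = "ball s0 d" and f' = "\<lambda>s h. h *\<^sub>R f' s"])
      show "x + t *\<^sub>R (y - x) \<in> ball s0 d" if "t \<in> {0..1}" for t
      proof -
        have "x \<in> ball s0 d" "y \<in> ball s0 d" using xy by (auto simp: dist_real_def)
        then have "(1 - t) *\<^sub>R x + t *\<^sub>R y \<in> ball s0 d"
          using that by (intro convexD convex_ball) auto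
        then show ?thesis by (simp add: algebra_simps)
      qed
      show "(f has_derivative (\<lambda>h. h *\<^sub>R f' s)) (at s within ball s0 d)" if "s \<in> ball s0 d" for s
      proof -
        have "s \<in> S" using d that by blast
        from assms(3)[OF this] show ?thesis
          unfolding has_vector_derivative_def by (rule has_derivative_at_withinI)
      qed
      show "onorm ((\<lambda>h. h *\<^sub>R f' s) - (\<lambda>h. h *\<^sub>R f' s0)) \<le> \<eta>" if "s \<in> ball s0 d" for s
      proof (rule onorm_bound)
        show "norm (((\<lambda>h. h *\<^sub>R f' s) - (\<lambda>h. h *\<^sub>R f' s0)) h) \<le> \<eta> * norm h" for h
        proof -
          have "norm (f' s - f' s0) \<le> \<eta>"
            using d2(2)[of s] that by (auto simp: d_def dist_commute dist_norm norm_minus_commute)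
          then have "\<bar>h\<bar> * norm (f' s - f' s0) \<le> \<bar>h\<bar> * \<eta>" by (intro mult_left_mono) auto
          then show ?thesis by (simp add: mult.commute flip: scaleR_right_diff_distrib)
        qed
      qed (use assms(5) in auto)
    qed (use d in auto)
    then show "cmod (f y - f x - of_real (y - x) * f' s0) \<le> \<eta> * \<bar>y - x\<bar>"
      by (simp add: scaleR_conv_of_real mult.commute)
  qed
qed

lemma immersion_locally_injective:
  fixes f :: "real \<Rightarrow> complex"
  assumes "open S" "s0 \<in> S" "\<And>s. s \<in> S \<Longrightarrow> (f has_vector_derivative f' s) (at s)"
    "isCont f' s0" "f' s0 \<noteq> 0"
  obtains \<delta> where "\<delta> > 0"
    "\<And>x y. \<bar>x - s0\<bar> < \<delta> \<Longrightarrow> \<bar>y - s0\<bar> < \<delta> \<Longrightarrow> f x = f y \<Longrightarrow> x = y"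
proof -
  \<comment> \<open>An error of at most half the speed cannot cancel the linear term of a
    chord.\<close>
  have "cmod (f' s0) / 2 > 0" using assms(5) by simp
  then obtain \<delta> where \<delta>: "\<delta> > 0" "\<And>x y. \<bar>x - s0\<bar> < \<delta> \<Longrightarrow> \<bar>y - s0\<bar> < \<delta> \<Longrightarrow>
       cmod (f y - f x - of_real (y - x) * f' s0) \<le> cmod (f' s0) / 2 * \<bar>y - x\<bar>"
    using C1_strictly_differentiable[OF assms(1-4)] by blast
  show ?thesis
  proof (rule that[OF \<delta>(1)])
    fix x y assume "\<bar>x - s0\<bar> < \<delta>" "\<bar>y - s0\<bar> < \<delta>" "f x = f y"
    with \<delta>(2)[of x y] have "cmod (of_real (y - x) * f' s0) \<le> cmod (f' s0) / 2 * \<bar>y - x\<bar>"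
      by (simp del: of_real_diff)
    then have "\<bar>y - x\<bar> * cmod (f' s0) \<le> cmod (f' s0) / 2 * \<bar>y - x\<bar>"
      by (simp only: norm_mult norm_of_real)
    then have "\<bar>y - x\<bar> * cmod (f' s0) \<le> 0" by (simp add: field_simps)
    then show "x = y" using assms(5) by (simp add: mult_le_0_iff)
  qed
qed

lemma abs_cross2_le: "\<bar>cross2 v w\<bar> \<le> cmod v * cmod w"
  unfolding cross2_def by (metis abs_Im_le_cmod complex_mod_cnj norm_mult)

text \<open>If \<open>f s = h t\<close>, the combination \<open>a * u - b * v\<close> of the
  displacements is small, while its cross products with \<open>u\<close> and \<open>v\<close>
  recover \<open>|b|\<close> and \<open>|a|\<close> times \<open>|cross2 u v|\<close>.\<close>

lemma transversal_intersection_isolated: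
  fixes f h :: "real \<Rightarrow> complex"
  assumes "open S" "s0 \<in> S" "\<And>s. s \<in> S \<Longrightarrow> (f has_vector_derivative f' s) (at s)" "isCont f' s0"
    and "open T" "t0 \<in> T" "\<And>t. t \<in> T \<Longrightarrow> (h has_vector_derivative h' t) (at t)" "isCont h' t0"
    and eq: "f s0 = h t0" and cr: "cross2 (f' s0) (h' t0) \<noteq> 0"
  obtains \<delta> where "\<delta> > 0"
    "\<And>s t. \<bar>s - s0\<bar> < \<delta> \<Longrightarrow> \<bar>t - t0\<bar> < \<delta> \<Longrightarrow> f s = h t \<Longrightarrow> s = s0 \<and> t = t0"
proof -
  define u v where "u = f' s0" and "v = h' t0"
  define X where "X = \<bar>cross2 u v\<bar>"
  have X: "X > 0" using cr by (simp add: X_def u_def v_def)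
  \<comment> \<open>Chosen so that the final bound is half of \<open>X * (|a| + |b|)\<close>, which
    only zero displacements can satisfy.\<close>
  define \<eta> where "\<eta> = X / (2 * (cmod u + cmod v + 1))"
  have P: "cmod u + cmod v + 1 > 0" by (smt (verit) norm_ge_zero)
  have \<eta>: "\<eta> > 0" using X P by (simp add: \<eta>_def)
  obtain d1 where d1: "d1 > 0" "\<And>x y. \<bar>x - s0\<bar> < d1 \<Longrightarrow> \<bar>y - s0\<bar> < d1 \<Longrightarrow>
       cmod (f y - f x - of_real (y - x) * u) \<le> \<eta> * \<bar>y - x\<bar>"
    using C1_strictly_differentiable[OF assms(1-4) \<eta>] unfolding u_def by blast
  obtain d2 where d2: "d2 > 0" "\<And>x y. \<bar>x - t0\<bar> < d2 \<Longrightarrow> \<bar>y - t0\<bar> < d2 \<Longrightarrow>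
       cmod (h y - h x - of_real (y - x) * v) \<le> \<eta> * \<bar>y - x\<bar>"
    using C1_strictly_differentiable[OF assms(5-8) \<eta>] unfolding v_def by blast
  show ?thesis
  proof (rule that[of "min d1 d2"])
    show "min d1 d2 > 0" using d1 d2 by simp
    fix s t assume st: "\<bar>s - s0\<bar> < min d1 d2" "\<bar>t - t0\<bar> < min d1 d2" "f s = h t"
    define a b where "a = s - s0" and "b = t - t0"
    define z where "z = of_real a * u - of_real b * v"
    have "cmod z \<le> \<eta> * \<bar>a\<bar> + \<eta> * \<bar>b\<bar>"
    proof -
      have "z = (h t - h t0 - of_real b * v) - (f s - f s0 - of_real a * u)"
        using st(3) eq by (simp add: z_def)
      then have "cmod z \<le> cmod (h t - h t0 - of_real b * v) + cmod (f s - f s0 - of_real a * u)"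
        by (simp only: norm_triangle_ineq4)
      also have "\<dots> \<le> \<eta> * \<bar>b\<bar> + \<eta> * \<bar>a\<bar>"
        using d1(2)[of s0 s] d2(2)[of t0 t] st d1(1) d2(1) unfolding a_def b_def by (intro add_mono) auto
      finally show ?thesis by simp
    qed
    then have z: "cmod z \<le> \<eta> * (\<bar>a\<bar> + \<bar>b\<bar>)" by (simp add: algebra_simps)
    have "\<bar>b\<bar> * X = \<bar>cross2 u z\<bar>" "\<bar>a\<bar> * X = \<bar>cross2 v z\<bar>"
      by (simp_all add: X_def z_def cross2_def algebra_simps flip: abs_mult)
    then have "(\<bar>a\<bar> + \<bar>b\<bar>) * X \<le> (cmod u + cmod v) * cmod z"
      using abs_cross2_le[of u z] abs_cross2_le[of v z] by (simp add: algebra_simps)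
    also have "\<dots> \<le> (cmod u + cmod v) * (\<eta> * (\<bar>a\<bar> + \<bar>b\<bar>))"
      by (intro mult_left_mono z) auto
    also have "\<dots> \<le> (cmod u + cmod v + 1) * (\<eta> * (\<bar>a\<bar> + \<bar>b\<bar>))"
      using \<eta> by (intro mult_right_mono) auto
    also have "\<dots> = X / 2 * (\<bar>a\<bar> + \<bar>b\<bar>)" using P by (simp add: \<eta>_def field_simps)
    finally have "X * (\<bar>a\<bar> + \<bar>b\<bar>) \<le> 0" by (simp add: field_simps)
    then have "\<bar>a\<bar> + \<bar>b\<bar> \<le> 0" using X by (simp add: mult_le_0_iff)
    then show "s = s0 \<and> t = t0" unfolding a_def b_def by linarith
  qed
qed

text \<open>In the frame in which the second branch moves to the right along the real axis, the
  chord from the first branch to the second passes the origin above or below according to the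
  side from which the first branch is left.\<close>

lemma transversal_crossing_chord:
  fixes c :: "real \<Rightarrow> complex"
  assumes d: "\<And>s. (c has_vector_derivative c' s) (at s)" and c': "continuous_on UNIV c'"
    and eq: "c s0 = c t0" and cr: "cross2 (c' s0) (c' t0) \<noteq> 0"
  shows "\<exists>\<delta> \<kappa> :: real. \<delta> > 0 \<and> \<kappa> \<noteq> 0 \<and>
    (\<forall>s t t'. \<bar>s - s0\<bar> < \<delta> \<longrightarrow> \<bar>t - t0\<bar> < \<delta> \<longrightarrow> \<bar>t' - t0\<bar> < \<delta> \<longrightarrow> t < t' \<longrightarrow>
       Re ((c t - c s) / c' t0) < Re ((c t' - c s) / c' t0)) \<and>
    (\<forall>s t. \<bar>s - s0\<bar> < \<delta> \<longrightarrow> \<bar>t - t0\<bar> < \<delta> \<longrightarrow> s \<noteq> s0 \<longrightarrow> Re ((c t - c s) / c' t0) = 0 \<longrightarrow>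
       \<kappa> * (s - s0) * Im ((c t - c s) / c' t0) > 0)"
proof -
  define v where "v = c' t0"
  \<comment> \<open>To first order the chord divided by \<open>v\<close> is
    \<open>(t - t0) + (s - s0) * \<rho>\<close>. Its imaginary slope \<open>\<kappa>\<close> agrees
    with \<open>cross2 (c' s0) (c' t0)\<close> up to a positive factor.\<close>
  define \<rho> where "\<rho> = - c' s0 / v"
  define \<kappa> where "\<kappa> = Im \<rho>"
  have v0: "v \<noteq> 0" using cr by (auto simp: v_def cross2_def)
  have "c' s0 = - \<rho> * v" using v0 by (simp add: \<rho>_def)
  then have "cross2 (c' s0) (c' t0) = Im (cnj (- \<rho> * v) * v)" by (simp add: cross2_def v_def)
  also have "\<dots> = \<kappa> * (cmod v)\<^sup>2"
    by (simp add: \<kappa>_def cmod_power2) (simp add: algebra_simps power2_eq_square)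
  finally have \<kappa>: "\<kappa> \<noteq> 0" using cr by auto
  \<comment> \<open>The bound \<open>1/2\<close> makes the real part of the chord increase with
    \<open>t\<close>; the other one keeps the error in the imaginary part below the leading
    term.\<close>
  define \<eta> where "\<eta> = min (1/2) (\<bar>\<kappa>\<bar> / (4 * (cmod \<rho> + 1)))"
  have R: "cmod \<rho> + 1 > 0" by (smt (verit) norm_ge_zero)
  have \<eta>: "\<eta> > 0" "\<eta> \<le> 1/2"
    using \<kappa> R unfolding \<eta>_def by (simp, intro min.cobounded1)
  have \<eta>': "\<eta> * (2 * cmod \<rho> + 2) < \<bar>\<kappa>\<bar>"
  proof -
    have "\<eta> * (4 * (cmod \<rho> + 1)) \<le> \<bar>\<kappa>\<bar>"
    proof -
      have "\<eta> \<le> \<bar>\<kappa>\<bar> / (4 * (cmod \<rho> + 1))" by (simp only: \<eta>_def min.cobounded2)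
      then show ?thesis using R by (subst (asm) pos_le_divide_eq) auto
    qed
    moreover have "\<bar>\<kappa>\<bar> > 0" using \<kappa> by simp
    ultimately show ?thesis by argo
  qed
  have e: "\<eta> * cmod v > 0" using \<eta> v0 by simp
  have cc: "isCont c' s" for s using c' by (simp add: continuous_on_eq_continuous_at)
  obtain d1 where d1: "d1 > 0" "\<And>x y. \<bar>x - s0\<bar> < d1 \<Longrightarrow> \<bar>y - s0\<bar> < d1 \<Longrightarrow>
       cmod (c y - c x - of_real (y - x) * c' s0) \<le> \<eta> * cmod v * \<bar>y - x\<bar>"
    using C1_strictly_differentiable[OF open_UNIV UNIV_I d cc e, of s0] by blast
  obtain d2 where d2: "d2 > 0" "\<And>x y. \<bar>x - t0\<bar> < d2 \<Longrightarrow> \<bar>y - t0\<bar> < d2 \<Longrightarrow>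
       cmod (c y - c x - of_real (y - x) * v) \<le> \<eta> * cmod v * \<bar>y - x\<bar>"
    using C1_strictly_differentiable[OF open_UNIV UNIV_I d cc e, of t0] unfolding v_def by blast
  have q1: "cmod ((c y - c x) / v + of_real (y - x) * \<rho>) \<le> \<eta> * \<bar>y - x\<bar>"
    if "\<bar>x - s0\<bar> < d1" "\<bar>y - s0\<bar> < d1" for x y
  proof -
    have "(c y - c x) / v + of_real (y - x) * \<rho> = (c y - c x - of_real (y - x) * c' s0) / v"
      using v0 by (simp add: \<rho>_def field_simps)
    then show ?thesis using d1(2)[OF that] v0 by (simp add: norm_divide divide_le_eq mult_ac)
  qed
  have q2: "cmod ((c y - c x) / v - of_real (y - x)) \<le> \<eta> * \<bar>y - x\<bar>"
    if "\<bar>x - t0\<bar> < d2" "\<bar>y - t0\<bar> < d2" for x y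
  proof -
    have "(c y - c x) / v - of_real (y - x) = (c y - c x - of_real (y - x) * v) / v"
      using v0 by (simp add: field_simps)
    then show ?thesis using d2(2)[OF that] v0 by (simp add: norm_divide divide_le_eq mult_ac)
  qed
  show ?thesis
  proof (rule exI[of _ "min d1 d2"], rule exI[of _ \<kappa>], intro conjI allI impI)
    show "min d1 d2 > 0" "\<kappa> \<noteq> 0" using d1 d2 \<kappa> by auto
  next
    fix s t t' assume a: "\<bar>s - s0\<bar> < min d1 d2" "\<bar>t - t0\<bar> < min d1 d2" "\<bar>t' - t0\<bar> < min d1 d2" "t < t'"
    let ?z = "(c t' - c t) / v - of_real (t' - t)"
    have "\<bar>Re ?z\<bar> \<le> \<eta> * (t' - t)"
      using q2[of t t'] a abs_Re_le_cmod[of ?z] by linarith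
    also have "\<dots> \<le> 1/2 * (t' - t)" using \<eta> a by (intro mult_right_mono) auto
    finally have "\<bar>Re ((c t' - c t) / v) - (t' - t)\<bar> \<le> 1/2 * (t' - t)"
      unfolding minus_complex.simps(1) Re_complex_of_real .
    moreover have "R > 0" if "\<bar>R - r\<bar> \<le> 1/2 * r" "r > 0" for R r :: real using that by linarith
    ultimately have "Re ((c t' - c t) / v) > 0" using a(4) by (metis diff_gt_0_iff_gt)
    moreover have "(c t' - c s) / v = (c t - c s) / v + (c t' - c t) / v"
      by (simp add: field_simps diff_divide_distrib)
    ultimately show "Re ((c t - c s) / c' t0) < Re ((c t' - c s) / c' t0)"
      unfolding v_def[symmetric] by simp
  next
    fix s t assume a: "\<bar>s - s0\<bar> < min d1 d2" "\<bar>t - t0\<bar> < min d1 d2" "s \<noteq> s0"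
      "Re ((c t - c s) / c' t0) = 0"
    define H where "H = (c t - c s) / v"
    define x y where "x = s - s0" and "y = t - t0"
    have "H - (of_real y + of_real x * \<rho>) =
        ((c t - c t0) / v - of_real y) - ((c s - c s0) / v + of_real x * \<rho>)"
      unfolding H_def using eq by (simp add: diff_divide_distrib)
    then have "cmod (H - (of_real y + of_real x * \<rho>)) \<le>
        cmod ((c t - c t0) / v - of_real y) + cmod ((c s - c s0) / v + of_real x * \<rho>)"
      by (simp only: norm_triangle_ineq4)
    also have "\<dots> \<le> \<eta> * \<bar>y\<bar> + \<eta> * \<bar>x\<bar>"
      using q1[of s0 s] q2[of t0 t] a d1(1) d2(1) unfolding x_def y_def by (intro add_mono) auto
    finally have est: "cmod (H - (of_real y + of_real x * \<rho>)) \<le> \<eta> * \<bar>y\<bar> + \<eta> * \<bar>x\<bar>" .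
    have "Re H = 0" using a(4) by (simp add: H_def v_def)
    then have "\<bar>y + x * Re \<rho>\<bar> \<le> \<eta> * \<bar>y\<bar> + \<eta> * \<bar>x\<bar>"
      using est abs_Re_le_cmod[of "H - (of_real y + of_real x * \<rho>)"] by simp
    moreover have "\<bar>x * Re \<rho>\<bar> \<le> \<bar>x\<bar> * cmod \<rho>"
      by (simp add: abs_mult abs_Re_le_cmod mult_left_mono)
    moreover have "\<eta> * \<bar>y\<bar> \<le> 1/2 * \<bar>y\<bar>" "\<eta> * \<bar>x\<bar> \<le> 1/2 * \<bar>x\<bar>"
      using \<eta> by (intro mult_right_mono; simp)+
    ultimately have "1/2 * \<bar>y\<bar> \<le> \<bar>x\<bar> * cmod \<rho> + 1/2 * \<bar>x\<bar>" by linarith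
    \<comment> \<open>Where the real part vanishes, the displacement along the second branch is
      bounded by that along the first, so \<open>x * \<kappa>\<close> decides the sign of
      \<open>Im H\<close>.\<close>
    then have y: "\<bar>y\<bar> \<le> \<bar>x\<bar> * (2 * cmod \<rho> + 1)" by (simp add: algebra_simps)
    have "\<bar>Im H - x * \<kappa>\<bar> \<le> \<eta> * (\<bar>y\<bar> + \<bar>x\<bar>)"
      using est abs_Im_le_cmod[of "H - (of_real y + of_real x * \<rho>)"] by (simp add: \<kappa>_def algebra_simps)
    also have "\<dots> \<le> \<eta> * (\<bar>x\<bar> * (2 * cmod \<rho> + 2))"
      using y \<eta> by (intro mult_left_mono) (auto simp: algebra_simps)
    also have "\<dots> = \<bar>x\<bar> * (\<eta> * (2 * cmod \<rho> + 2))" by simp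
    also have "\<dots> < \<bar>x\<bar> * \<bar>\<kappa>\<bar>" using \<eta>' a(3) by (intro mult_strict_left_mono) (auto simp: x_def)
    finally have k: "\<bar>Im H - x * \<kappa>\<bar> < \<bar>x * \<kappa>\<bar>" by (simp add: abs_mult)
    have "q * r > 0" if "\<bar>r - q\<bar> < \<bar>q\<bar>" for q r :: real
      using that by (auto simp: zero_less_mult_iff abs_if split: if_splits)
    then have "(x * \<kappa>) * Im H > 0" using k by blast
    then show "\<kappa> * (s - s0) * Im ((c t - c s) / c' t0) > 0"
      by (simp add: H_def v_def x_def mult_ac)
  qed
qed

section \<open>Curves that are invariant under a glide reflection\<close>

lemma polar_mult:
  assumes "z = of_real (cmod z) * cis a" "w = of_real (cmod w) * cis b"
  shows "z * w = of_real (cmod (z * w)) * cis (a + b)"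
proof -
  have "z * w = (of_real (cmod z) * cis a) * (of_real (cmod w) * cis b)" using assms by simp
  also have "\<dots> = of_real (cmod (z * w)) * cis (a + b)" by (simp add: norm_mult cis_mult[symmetric])
  finally show ?thesis .
qed

lemma polar_scale_iff:
  "r > 0 \<Longrightarrow> z * of_real r = of_real (cmod (z * of_real r)) * cis a \<longleftrightarrow> z = of_real (cmod z) * cis a"
  by (auto simp: norm_mult)

lemma Arg_eqI: "z \<noteq> 0 \<Longrightarrow> z = of_real (cmod z) * cis x \<Longrightarrow> - pi < x \<Longrightarrow> x \<le> pi \<Longrightarrow> Arg z = x"
  by (rule Arg_unique[of "cmod z"]) (auto simp: cis_conv_exp)

lemma abs_Arg_Re_pos: "Re z > 0 \<Longrightarrow> \<bar>Arg z\<bar> < pi / 2"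
  using Arg_Re_pos by blast

lemma continuous_on_Arg_Re_pos:
  "continuous_on S f \<Longrightarrow> (\<And>x. x \<in> S \<Longrightarrow> Re (f x) > 0) \<Longrightarrow> continuous_on S (\<lambda>x. Arg (f x))"
  by (rule continuous_on_Arg') (auto simp: complex_nonpos_Reals_iff dest!: less_imp_neq, fastforce)

text \<open>The plane problem that remains after straightening. Crossings are constrained only for
  parameters less than one period apart, because a chord from \<open>s\<close> is followed no
  further than to \<open>s + 1\<close>.\<close>

locale glide_curve =
  fixes c c' :: "real \<Rightarrow> complex" and l :: real and \<theta> :: "real \<Rightarrow> real"
  assumes deriv: "(c has_vector_derivative c' t) (at t)"
    and cont': "continuous_on UNIV c'"
    and regular: "c' t \<noteq> 0"
    and glide: "c (t + 1) = cnj (c t) + of_real l"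
    and l_pos: "l > 0"
    and transversal: "s < t \<Longrightarrow> t < s + 1 \<Longrightarrow> c s = c t \<Longrightarrow> cross2 (c' s) (c' t) \<noteq> 0"
    and no_triple: "s < t \<Longrightarrow> t < s + 1 \<Longrightarrow> s < t' \<Longrightarrow> t' < s + 1 \<Longrightarrow> c s = c t \<Longrightarrow> c s = c t' \<Longrightarrow> t = t'"
    and cont_angle: "continuous_on UNIV \<theta>"
    and angle: "c' t = of_real (cmod (c' t)) * cis (\<theta> t)"
begin

lemma cont: "continuous_on S c"
  by (intro continuous_at_imp_continuous_on ballI has_vector_derivative_continuous[OF deriv])

lemma cont_c: "continuous_on S f \<Longrightarrow> continuous_on S (\<lambda>x. c (f x))"
  for f :: "'b::topological_space \<Rightarrow> real"
  by (rule continuous_on_compose2[OF cont[of UNIV]]) auto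

text \<open>Dividing the chord by its positive parameter length keeps its argument and removes the zero on
  the diagonal.\<close>

definition secant :: "real \<Rightarrow> real \<Rightarrow> complex" where
  "secant s u = (if u = 0 then c' s else (c (s + u) - c s) / of_real u)"

definition self_crossing :: "real \<Rightarrow> bool" where
  "self_crossing s \<longleftrightarrow> (\<exists>t. s < t \<and> t < s + 1 \<and> c s = c t)"

text \<open>The principal argument of the full-period chord \<open>secant s 1\<close>. The real part
  of this chord is \<open>l > 0\<close>, so the cut of \<open>Arg\<close> is never met.\<close>

definition end_angle :: "real \<Rightarrow> real" where
  "end_angle s = Arg (of_real l - 2 * \<i> * of_real (Im (c s)))"

text \<open>The equation \<open>J s = k\<close> of the overview, as a relation because an argument
  is available only while the chord does not vanish.\<close>

definition turns :: "real \<Rightarrow> int \<Rightarrow> bool" where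
  "turns s k \<longleftrightarrow> angle_lift (secant s) 0 1 (\<theta> s) (end_angle s + 2 * pi * of_int k)"

section \<open>Chords of a glide-invariant curve and their zeros\<close>

lemma deriv_shift: "c' (t + 1) = cnj (c' t)"
proof -
  have "((\<lambda>t. c (t + 1)) has_vector_derivative c' (t + 1)) (at t)"
  proof -
    have "((\<lambda>t. t + 1) has_vector_derivative 1) (at t)" by (auto intro!: derivative_eq_intros)
    from vector_diff_chain_at[OF this deriv[of "t + 1"]] show ?thesis by (simp add: o_def)
  qed
  moreover have "((\<lambda>t. c (t + 1)) has_vector_derivative cnj (c' t)) (at t)"
    unfolding glide by (auto intro!: derivative_eq_intros has_vector_derivative_cnj deriv)
  ultimately show ?thesis by (rule vector_derivative_unique_at)
qed

text \<open>On the diagonal both ends of the chord move, so the joint limit comes from strict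
  differentiability.\<close>

lemma continuous_secant: "continuous_on S (\<lambda>(s, u). secant s u)"
proof (intro continuous_at_imp_continuous_on ballI)
  fix q :: "real \<times> real"
  obtain s0 u0 where q: "q = (s0, u0)" by (cases q)
  show "isCont (\<lambda>(s, u). secant s u) q"
  proof (cases "u0 = 0")
    case False
    have "continuous_on {p :: real \<times> real. snd p \<noteq> 0} (\<lambda>p. (c (fst p + snd p) - c (fst p)) / of_real (snd p))"
      by (intro continuous_intros cont_c) auto
    then have "continuous_on {p. snd p \<noteq> 0} (\<lambda>(s, u). secant s u)"
      by (rule continuous_on_eq) (auto simp: secant_def)
    moreover have "open {p :: real \<times> real. snd p \<noteq> 0}"
      by (intro open_Collect_neq continuous_intros)
    ultimately show ?thesis using False q by (auto simp: continuous_on_eq_continuous_at)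
  next
    case True
    have cc: "isCont c' s0" using cont' by (simp add: continuous_on_eq_continuous_at)
    show ?thesis unfolding continuous_at_eps_delta
    proof (intro allI impI)
      fix e :: real assume e: "e > 0"
      obtain d1 where d1: "d1 > 0" "\<And>x y. \<bar>x - s0\<bar> < d1 \<Longrightarrow> \<bar>y - s0\<bar> < d1 \<Longrightarrow>
          cmod (c y - c x - of_real (y - x) * c' s0) \<le> e / 2 * \<bar>y - x\<bar>"
        using C1_strictly_differentiable[OF open_UNIV UNIV_I deriv cc, of "e / 2"] e by auto
      obtain d2 where d2: "d2 > 0" "\<And>s. dist s s0 < d2 \<Longrightarrow> dist (c' s) (c' s0) < e"
        using cc e unfolding continuous_at_eps_delta by blast
      show "\<exists>d>0. \<forall>x'. dist x' q < d \<longrightarrow>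
          dist (case x' of (s, u) \<Rightarrow> secant s u) (case q of (s, u) \<Rightarrow> secant s u) < e"
      \<comment> \<open>Half of \<open>d1\<close> is needed because both \<open>s\<close> and
        \<open>s + u\<close> must stay within \<open>d1\<close> of \<open>s0\<close>.\<close>
      proof (intro exI[of _ "min d2 (d1 / 2)"] conjI allI impI)
        show "min d2 (d1 / 2) > 0" using d1 d2 by simp
        fix x' assume x': "dist x' q < min d2 (d1 / 2)"
        obtain s u where su: "x' = (s, u)" by (cases x')
        have s: "dist s s0 < min d2 (d1 / 2)" using dist_fst_le[of x' q] x' by (simp add: su q)
        have u: "\<bar>u\<bar> < d1 / 2" using dist_snd_le[of x' q] x' True by (simp add: su q)
        have "dist (secant s u) (c' s0) < e"
        proof (cases "u = 0")
          case True
          then show ?thesis using d2(2)[of s] s by (simp add: secant_def)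
        next
          case False
          have "cmod (c (s + u) - c s - of_real (s + u - s) * c' s0) \<le> e / 2 * \<bar>s + u - s\<bar>"
          proof (rule d1(2))
            have "\<bar>s - s0\<bar> < d1 / 2" using s by (simp add: dist_real_def)
            with u d1(1) show "\<bar>s - s0\<bar> < d1" "\<bar>s + u - s0\<bar> < d1" by linarith+
          qed
          then have *: "cmod (c (s + u) - c s - of_real u * c' s0) \<le> e / 2 * \<bar>u\<bar>" by simp
          have "secant s u - c' s0 = (c (s + u) - c s - of_real u * c' s0) / of_real u"
            using False by (simp add: secant_def field_simps)
          then have "cmod (secant s u - c' s0) \<le> e / 2"
            using * False by (simp add: norm_divide divide_le_eq)
          then show ?thesis using e by (simp add: dist_norm)
        qed
        then show "dist (case x' of (s, u) \<Rightarrow> secant s u) (case q of (s, u) \<Rightarrow> secant s u) < e"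
          using True by (simp add: su q secant_def)
      qed
    qed
  qed
qed

lemma secant_0: "secant s 0 = c' s"
  by (simp add: secant_def)

lemma secant_1: "secant s 1 = of_real l - 2 * \<i> * of_real (Im (c s))"
  by (simp add: secant_def glide complex_eq_iff)

text \<open>The ends are safe: at \<open>u = 0\<close> the value is the nonzero velocity, and at
  \<open>u = 1\<close> the glide has moved the real part by \<open>l\<close>.\<close>

lemma secant_zero_iff:
  assumes "0 \<le> u" "u \<le> 1"
  shows "secant s u = 0 \<longleftrightarrow> 0 < u \<and> u < 1 \<and> c s = c (s + u)"
proof -
  have "Re (secant s 1) > 0" using l_pos by (simp add: secant_1)
  then have "secant s 1 \<noteq> 0" by auto
  then show ?thesis
    using assms regular[of s] by (cases "u = 0 \<or> u = 1") (auto simp: secant_0, auto simp: secant_def)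
qed

lemma self_crossing_iff: "self_crossing s \<longleftrightarrow> (\<exists>u\<in>{0..1}. secant s u = 0)"
proof
  assume "self_crossing s"
  then obtain t where "s < t" "t < s + 1" "c s = c t" by (auto simp: self_crossing_def)
  then show "\<exists>u\<in>{0..1}. secant s u = 0" by (intro bexI[of _ "t - s"]) (auto simp: secant_zero_iff)
next
  assume "\<exists>u\<in>{0..1}. secant s u = 0"
  then obtain u where "u \<in> {0..1}" "secant s u = 0" by blast
  then have "0 < u" "u < 1" "c s = c (s + u)" by (auto simp: secant_zero_iff)
  then show "self_crossing s" unfolding self_crossing_def by (intro exI[of _ "s + u"]) auto
qed

lemma end_angle_polar: "secant s 1 = of_real (cmod (secant s 1)) * cis (end_angle s)"
  using polar_Arg[of "secant s 1"] secant_zero_iff[of 1 s] unfolding end_angle_def secant_1 by simp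

lemma continuous_end_angle: "continuous_on S end_angle"
  unfolding end_angle_def
  by (intro continuous_on_Arg_Re_pos continuous_intros cont_c) (use l_pos in auto)

lemma turns_unique:
  assumes "turns s k" "turns s k'" "\<not> self_crossing s"
  shows "k = k'"
  using angle_lift_unique[of "secant s" 0 1 "\<theta> s"] assms
  unfolding turns_def self_crossing_iff by fastforce

lemma secant_shift: "secant (s + 1) u = cnj (secant s u)"
proof -
  have "c (s + 1 + u) = cnj (c (s + u)) + of_real l" using glide[of "s + u"] by (simp add: add_ac)
  then show ?thesis by (simp add: secant_def deriv_shift glide)
qed

lemma self_crossing_shift: "self_crossing (s + 1) \<longleftrightarrow> self_crossing s"
  unfolding self_crossing_iff secant_shift by simp

lemma end_angle_shift: "end_angle (s + 1) = - end_angle s"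
proof -
  have "of_real l - 2 * \<i> * of_real (Im (c (s + 1))) = cnj (secant s 1)"
    by (simp add: secant_1 glide complex_eq_iff)
  then have "end_angle (s + 1) = Arg (cnj (secant s 1))" unfolding end_angle_def by simp
  also have "\<dots> = - Arg (secant s 1)"
    using l_pos unfolding Arg_cnj secant_1 by (auto simp: complex_is_Real_iff Arg_eq_0)
  finally show ?thesis by (simp add: end_angle_def secant_1)
qed

text \<open>Compactness of \<open>K\<close> and the tube lemma give one neighbourhood of
  \<open>s0\<close> that works for all \<open>u\<close>.\<close>

lemma secant_nonzero_near:
  assumes "compact K" "\<And>u. u \<in> K \<Longrightarrow> secant s0 u \<noteq> 0"
  obtains \<epsilon> where "\<epsilon> > 0" "\<And>s u. \<bar>s - s0\<bar> < \<epsilon> \<Longrightarrow> u \<in> K \<Longrightarrow> secant s u \<noteq> 0"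
proof (cases "K = {}")
  case True
  then show ?thesis using that[of 1] by auto
next
  case False
  let ?U = "{q \<in> K \<times> UNIV. secant (snd q) (fst q) \<noteq> 0}"
  have "continuous_on (K \<times> UNIV) (\<lambda>q. secant (snd q) (fst q))"
  proof -
    have "continuous_on (K \<times> UNIV) (\<lambda>q. (\<lambda>(s, u). secant s u) (snd q, fst q))"
      by (rule continuous_on_compose2[OF continuous_secant[of UNIV]]) (auto intro!: continuous_intros)
    then show ?thesis by simp
  qed
  then have "openin (top_of_set (K \<times> UNIV)) ?U"
    using continuous_openin_preimage_gen[of "K \<times> UNIV" "\<lambda>q. secant (snd q) (fst q)" "- {0}"]
    by (simp add: vimage_def Int_def open_Compl)
  moreover have "(\<lambda>x. (x, s0)) ` K \<subseteq> ?U" using assms by auto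
  ultimately obtain V where V: "openin (top_of_set UNIV) V" "s0 \<in> V" "K \<times> V \<subseteq> ?U"
    using tube_lemma[of K s0 ?U UNIV] assms(1) False by blast
  then obtain \<epsilon> where "\<epsilon> > 0" "ball s0 \<epsilon> \<subseteq> V" by (auto elim: openE)
  with V(3) show ?thesis by (intro that[of \<epsilon>]) (auto simp: dist_real_def subset_iff)
qed

section \<open>Local constancy and jumps of the number of turns\<close>

lemma turns_locally_constant:
  assumes "\<not> self_crossing s0"
  obtains \<epsilon> k where "\<epsilon> > 0" "\<And>s. \<bar>s - s0\<bar> < \<epsilon> \<Longrightarrow> \<not> self_crossing s \<and> turns s k"
proof -
  obtain \<epsilon> where \<epsilon>: "\<epsilon> > 0" "\<And>s u. \<bar>s - s0\<bar> < \<epsilon> \<Longrightarrow> u \<in> {0..1} \<Longrightarrow> secant s u \<noteq> 0"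
    using secant_nonzero_near[of "{0..1}" s0] assms unfolding self_crossing_iff by auto
  have "\<exists>k::int. \<forall>s\<in>ball s0 \<epsilon>. angle_lift (secant s) 0 1 (\<theta> s) (end_angle s + 2 * pi * of_int k)"
  proof (rule angle_lift_family[OF continuous_secant])
    show "convex (ball s0 \<epsilon>)" by simp
    show "continuous_on (ball s0 \<epsilon>) \<theta>" using cont_angle continuous_on_subset by blast
    show "secant s u \<noteq> 0" if "s \<in> ball s0 \<epsilon>" "u \<in> {0..1}" for s u
      using \<epsilon>(2)[of s u] that by (auto simp: dist_real_def)
    show "secant s 0 = of_real (cmod (secant s 0)) * cis (\<theta> s)" for s
      using angle by (simp add: secant_0)
  qed (use end_angle_polar continuous_end_angle in auto)
  then obtain k :: int where "\<And>s. s \<in> ball s0 \<epsilon> \<Longrightarrow>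
      angle_lift (secant s) 0 1 (\<theta> s) (end_angle s + 2 * pi * of_int k)" by blast
  then show ?thesis using \<epsilon>
    by (intro that[of \<epsilon> k]) (auto simp: turns_def self_crossing_iff dist_real_def abs_minus_commute)
qed


text \<open>Only a short interval \<open>[a, b]\<close> around the crossing is sensitive to
  \<open>s\<close>; before and after it the argument continues through \<open>s0\<close> with fixed
  integers. On \<open>[a, b]\<close> the chord changes from one half-plane to the opposite one,
  clockwise or counterclockwise depending on the side of \<open>s0\<close>, and the two ways differ
  by a full turn.\<close>

lemma turns_jump:
  assumes "self_crossing s0"
  obtains \<epsilon> k k' where "\<epsilon> > 0" "odd (k - k')"
    "\<And>s. s0 - \<epsilon> < s \<Longrightarrow> s < s0 \<Longrightarrow> \<not> self_crossing s \<and> turns s k"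
    "\<And>s. s0 < s \<Longrightarrow> s < s0 + \<epsilon> \<Longrightarrow> \<not> self_crossing s \<and> turns s k'"
proof -
  obtain t0 where t0: "s0 < t0" "t0 < s0 + 1" "c s0 = c t0"
    using assms by (auto simp: self_crossing_def)
  define u0 where "u0 = t0 - s0"
  have u0: "0 < u0" "u0 < 1" and t0_eq: "t0 = s0 + u0" using t0 by (auto simp: u0_def)
  define v where "v = c' t0"
  have v0: "v \<noteq> 0" using regular by (simp add: v_def)
  obtain \<delta> \<kappa> :: real where \<delta>: "\<delta> > 0" and \<kappa>: "\<kappa> \<noteq> 0"
    and mono: "\<And>s t t'. \<bar>s - s0\<bar> < \<delta> \<Longrightarrow> \<bar>t - t0\<bar> < \<delta> \<Longrightarrow> \<bar>t' - t0\<bar> < \<delta> \<Longrightarrow> t < t' \<Longrightarrow>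
       Re ((c t - c s) / v) < Re ((c t' - c s) / v)"
    and side: "\<And>s t. \<bar>s - s0\<bar> < \<delta> \<Longrightarrow> \<bar>t - t0\<bar> < \<delta> \<Longrightarrow> s \<noteq> s0 \<Longrightarrow>
       Re ((c t - c s) / v) = 0 \<Longrightarrow> \<kappa> * (s - s0) * Im ((c t - c s) / v) > 0"
    using transversal_crossing_chord[OF deriv cont' t0(3) transversal[OF t0]] unfolding v_def by blast
  \<comment> \<open>Half of \<open>\<delta>\<close> goes to \<open>u - u0\<close> and half to
    \<open>s - s0\<close>, so that \<open>s + u\<close> stays in range of the crossing. The other
    bounds keep \<open>a\<close> and \<open>b\<close> inside \<open>(0, 1)\<close>.\<close>
  define r where "r = min (\<delta> / 2) (min (u0 / 2) ((1 - u0) / 2))"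
  have r: "r > 0" "r \<le> \<delta> / 2" "r < u0" "r < 1 - u0" using \<delta> u0 by (auto simp: r_def min_def)
  define H where "H s u = (c (s + u) - c s) / v" for s u
  have sec: "secant s u = H s u * (v * of_real (1 / u))" if "u > 0" for s u
    using that v0 by (simp add: secant_def H_def field_simps)
  define a b where "a = u0 - r" and "b = u0 + r"
  have ab: "0 < a" "a < u0" "u0 < b" "b < 1" using r by (auto simp: a_def b_def)
  have contH: "isCont (\<lambda>s. H s u) s" for s u
    unfolding H_def using v0 cont_c[of UNIV "\<lambda>s. s + u"] cont[of UNIV]
    by (intro continuous_intros) (auto simp: continuous_on_eq_continuous_at intro!: continuous_intros)
  have H0: "Re (H s0 u0) = 0" using t0 by (simp add: H_def t0_eq)
  have "Re (H s0 a) < 0" "Re (H s0 b) > 0"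
    using mono[of s0 "s0 + a" t0] mono[of s0 t0 "s0 + b"] H0 \<delta> r ab
    by (auto simp: H_def t0_eq a_def b_def)
  moreover have "((\<lambda>s. Re (H s u)) \<longlongrightarrow> Re (H s0 u)) (nhds s0)" for u
    using continuous_Re[OF contH[of s0 u]]
      tendsto_at_iff_tendsto_nhds[of "\<lambda>s. Re (H s u)" s0] by (simp add: isCont_def)
  ultimately have "eventually (\<lambda>s. Re (H s a) < 0 \<and> Re (H s b) > 0) (nhds s0)"
    by (intro eventually_conj) (auto dest: order_tendstoD)
  then obtain e2 where e2: "e2 > 0" "\<And>s. \<bar>s - s0\<bar> < e2 \<Longrightarrow> Re (H s a) < 0 \<and> Re (H s b) > 0"
    unfolding eventually_nhds_metric dist_real_def by blast
  \<comment> \<open>Without triple points \<open>u0\<close> is the only zero of the chord from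
    \<open>s0\<close>, so the outer intervals contain none.\<close>
  have only: "u = u0" if "secant s0 u = 0" "u \<in> {0..1}" for u
    using no_triple[of s0 "s0 + u" t0] that t0 by (auto simp: secant_zero_iff t0_eq)
  obtain e1 where e1: "e1 > 0" "\<And>s u. \<bar>s - s0\<bar> < e1 \<Longrightarrow> u \<in> {0..a} \<Longrightarrow> secant s u \<noteq> 0"
    using secant_nonzero_near[of "{0..a}" s0] only ab by (metis atLeastAtMost_iff compact_Icc
        less_le_not_le order.trans order_less_imp_le)
  obtain e3 where e3: "e3 > 0" "\<And>s u. \<bar>s - s0\<bar> < e3 \<Longrightarrow> u \<in> {b..1} \<Longrightarrow> secant s u \<noteq> 0"
    using secant_nonzero_near[of "{b..1}" s0] only ab by (metis atLeastAtMost_iff compact_Icc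
        less_le_not_le order.trans order_less_imp_le)
  define \<epsilon> where "\<epsilon> = min (min e1 e2) (min e3 (\<delta> / 2))"
  have \<epsilon>: "\<epsilon> > 0" using e1 e2 e3 \<delta> by (simp add: \<epsilon>_def)
  define S where "S = ball s0 \<epsilon>"
  have S: "\<bar>s - s0\<bar> < \<epsilon>" if "s \<in> S" for s using that by (auto simp: S_def dist_real_def)
  define \<nu> where "\<nu> = Arg v"
  have v_polar: "v = of_real (cmod v) * cis \<nu>" using v0 polar_Arg unfolding \<nu>_def by blast
  have scale: "secant s u = of_real (cmod (secant s u)) * cis (x + \<nu>)"
    if "u > 0" "H s u = of_real (cmod (H s u)) * cis x" for s u x
  proof -
    have "H s u * v = of_real (cmod (H s u * v)) * cis (x + \<nu>)" by (rule polar_mult[OF that(2) v_polar])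
    then show ?thesis unfolding sec[OF that(1)] mult.assoc[symmetric]
      using that(1) by (subst polar_scale_iff) auto
  qed
  \<comment> \<open>\<open>H s a\<close> lies in the left half-plane, which contains the cut of
    \<open>Arg\<close>; hence the detour over \<open>- H s a\<close>.\<close>
  define lo hi where "lo s = Arg (- H s a) + pi + \<nu>" and "hi s = Arg (H s b) + \<nu>" for s
  have lo: "secant s a = of_real (cmod (secant s a)) * cis (lo s)" if "s \<in> S" for s
    unfolding lo_def
  proof (rule scale)
    have "- H s a \<noteq> 0" using e2(2)[of s] S[OF that] by (auto simp: \<epsilon>_def)
    from polar_mult[OF polar_Arg[OF this], of "- 1" pi]
    show "H s a = of_real (cmod (H s a)) * cis (Arg (- H s a) + pi)" by simp
  qed (use ab in auto)
  have hi: "secant s b = of_real (cmod (secant s b)) * cis (hi s)" if "s \<in> S" for s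
    unfolding hi_def
  proof (rule scale)
    have "H s b \<noteq> 0" using e2(2)[of s] S[OF that] by (auto simp: \<epsilon>_def)
    then show "H s b = of_real (cmod (H s b)) * cis (Arg (H s b))" by (rule polar_Arg)
  qed (use ab in auto)
  have contHS: "continuous_on S (\<lambda>s. H s u)" for u
    by (intro continuous_at_imp_continuous_on ballI contH)
  have cont_lo: "continuous_on S lo"
    unfolding lo_def by (intro continuous_intros continuous_on_Arg_Re_pos contHS)
      (use e2(2) S in \<open>auto simp: \<epsilon>_def\<close>)
  have cont_hi: "continuous_on S hi"
    unfolding hi_def by (intro continuous_intros continuous_on_Arg_Re_pos contHS)
      (use e2(2) S in \<open>auto simp: \<epsilon>_def\<close>)
  have "\<exists>k::int. \<forall>s\<in>S. angle_lift (secant s) 0 a (\<theta> s) (lo s + 2 * pi * of_int k)"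
  proof (rule angle_lift_family[OF continuous_secant])
    show "secant s u \<noteq> 0" if "s \<in> S" "u \<in> {0..a}" for s u
      using e1(2)[of s u] S that by (auto simp: \<epsilon>_def)
    show "secant s 0 = of_real (cmod (secant s 0)) * cis (\<theta> s)" for s
      using angle by (simp add: secant_0)
    show "continuous_on S \<theta>" using cont_angle continuous_on_subset by blast
  qed (use lo cont_lo ab in \<open>auto simp: S_def\<close>)
  then obtain n1 :: int where n1: "\<And>s. s \<in> S \<Longrightarrow>
      angle_lift (secant s) 0 a (\<theta> s) (lo s + 2 * pi * of_int n1)" by blast
  have "\<exists>k::int. \<forall>s\<in>S. angle_lift (secant s) b 1 (hi s) (end_angle s + 2 * pi * of_int k)"
  proof (rule angle_lift_family[OF continuous_secant])
    show "secant s u \<noteq> 0" if "s \<in> S" "u \<in> {b..1}" for s u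
      using e3(2)[of s u] S that by (auto simp: \<epsilon>_def)
  qed (use hi cont_hi ab end_angle_polar continuous_end_angle in \<open>auto simp: S_def\<close>)
  then obtain n3 :: int where n3: "\<And>s. s \<in> S \<Longrightarrow>
      angle_lift (secant s) b 1 (hi s) (end_angle s + 2 * pi * of_int n3)" by blast

  have mid: "(\<forall>u\<in>{a..b}. secant s u \<noteq> 0) \<and>
      angle_lift (secant s) a b (lo s) (hi s + 2 * pi * of_int (if \<kappa> * (s - s0) > 0 then 0 else 1))"
    if s: "s \<in> S" "s \<noteq> s0" for s
  proof -
    \<comment> \<open>\<sigma> is \<open>1\<close> if the chord passes above the origin of the frame
      and \<open>- 1\<close> if it passes below. The slit opposite to \<open>w\<close> is then the
      half-axis on the other side, which \<open>side\<close> shows to be avoided.\<close>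
    define \<sigma> :: real where "\<sigma> = (if \<kappa> * (s - s0) > 0 then 1 else - 1)"
    have \<sigma>: "\<sigma> = 1 \<or> \<sigma> = - 1" "\<sigma> * (\<kappa> * (s - s0)) > 0"
      using s \<kappa> by (auto simp: \<sigma>_def zero_less_mult_iff mult_less_0_iff)
    define w where "w = \<nu> + \<sigma> * (pi / 2)"
    have cisw: "cis (- w) = cis (- \<nu>) * (- \<i> * of_real \<sigma>)"
      using \<sigma>(1) by (auto simp: w_def cis_mult[symmetric] complex_eq_iff cos_add sin_add cos_diff sin_diff)
    have rot: "secant s u * cis (- w) = H s u * (- \<i> * of_real \<sigma>) * of_real (cmod v / u)"
      if "u > 0" for u
    proof -
      have "v * cis (- \<nu>) = of_real (cmod v) * (cis \<nu> * cis (- \<nu>))" using v_polar by (metis mult.assoc)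
      then have "v * cis (- \<nu>) = of_real (cmod v)" by (simp add: cis_mult)
      then show ?thesis unfolding sec[OF that] cisw by (simp add: divide_inverse mult_ac)
    qed
    have slit: "secant s u * cis (- w) \<notin> \<real>\<^sub>\<le>\<^sub>0" if u: "u \<in> {a..b}" for u
    proof
      assume *: "secant s u * cis (- w) \<in> \<real>\<^sub>\<le>\<^sub>0"
      have up: "u > 0" using u ab by auto
      define q where "q = cmod v / u"
      have q: "q > 0" using up v0 by (simp add: q_def)
      have "Im (H s u * (- \<i> * of_real \<sigma>) * of_real q) = 0" "Re (H s u * (- \<i> * of_real \<sigma>) * of_real q) \<le> 0"
        using * unfolding rot[OF up] q_def complex_nonpos_Reals_iff by auto
      then have "Re (H s u) * \<sigma> * q = 0" "Im (H s u) * \<sigma> * q \<le> 0" by (auto simp: algebra_simps)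
      then have z: "Re (H s u) = 0" "\<sigma> * Im (H s u) \<le> 0"
        using q \<sigma>(1) by (auto simp: mult_le_0_iff zero_le_mult_iff mult.commute)
      have "\<bar>s - s0\<bar> < \<delta> / 2" using S[OF s(1)] by (simp add: \<epsilon>_def)
      moreover have "\<bar>u - u0\<bar> \<le> \<delta> / 2" using u r unfolding a_def b_def atLeastAtMost_iff by linarith
      ultimately have "\<bar>s - s0\<bar> < \<delta>" "\<bar>s + u - t0\<bar> < \<delta>" unfolding t0_eq using \<delta> by linarith+
      then have "\<kappa> * (s - s0) * Im (H s u) > 0"
        using side[of s "s + u"] z(1) s(2) by (simp add: H_def)
      moreover have False if "X * I > 0" "\<sigma> * X > 0" "\<sigma> * I \<le> 0" for X I :: real
        using that \<sigma>(1) by (auto simp: zero_less_mult_iff)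
      ultimately show False using z(2) \<sigma>(2) by blast
    qed
    have "continuous_on {a..b} (\<lambda>u. (\<lambda>(s, u). secant s u) (s, u))"
      by (rule continuous_on_compose2[OF continuous_secant[of UNIV]]) (auto intro!: continuous_intros)
    then have "continuous_on {a..b} (secant s)" by simp
    from angle_lift_slit[OF this _ slit] ab
    have L: "angle_lift (secant s) a b (w + Arg (secant s a * cis (- w))) (w + Arg (secant s b * cis (- w)))"
      by auto
    have ea: "- H s a \<noteq> 0" "\<bar>Arg (- H s a)\<bar> < pi / 2" and eb: "H s b \<noteq> 0" "\<bar>Arg (H s b)\<bar> < pi / 2"
      using e2(2)[of s] S[OF s(1)] abs_Arg_Re_pos[of "- H s a"] abs_Arg_Re_pos[of "H s b"]
      by (auto simp: \<epsilon>_def)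
    have isig: "\<i> * of_real \<sigma> = of_real (cmod (\<i> * of_real \<sigma>)) * cis (\<sigma> * (pi / 2))"
             "- \<i> * of_real \<sigma> = of_real (cmod (- \<i> * of_real \<sigma>)) * cis (- \<sigma> * (pi / 2))"
      using \<sigma>(1) by (auto simp: complex_eq_iff)
    have pos: "cmod v / a > 0" "cmod v / b > 0" using v0 ab by auto
    have A: "Arg (secant s a * cis (- w)) = Arg (- H s a) + \<sigma> * (pi / 2)"
    proof -
      have "secant s a * cis (- w) = (- H s a * (\<i> * of_real \<sigma>)) * of_real (cmod v / a)"
        using rot[of a] ab by simp
      then have "Arg (secant s a * cis (- w)) = Arg (- H s a * (\<i> * of_real \<sigma>))"
        using pos(1) by (simp only: Arg_times_of_real2)
      also have "\<dots> = Arg (- H s a) + \<sigma> * (pi / 2)"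
        by (rule Arg_eqI[OF _ polar_mult[OF polar_Arg[OF ea(1)] isig(1)]]) (use ea \<sigma>(1) in auto)
      finally show ?thesis .
    qed
    have B: "Arg (secant s b * cis (- w)) = Arg (H s b) - \<sigma> * (pi / 2)"
    proof -
      have "secant s b * cis (- w) = (H s b * (- \<i> * of_real \<sigma>)) * of_real (cmod v / b)"
        using rot[of b] ab by simp
      then have "Arg (secant s b * cis (- w)) = Arg (H s b * (- \<i> * of_real \<sigma>))"
        using pos(2) by (simp only: Arg_times_of_real2)
      also have "\<dots> = Arg (H s b) + - \<sigma> * (pi / 2)"
        by (rule Arg_eqI[OF _ polar_mult[OF polar_Arg[OF eb(1)] isig(2)]]) (use eb \<sigma>(1) in auto)
      finally show ?thesis by simp
    qed
    \<comment> \<open>The start equals \<open>lo s\<close> for \<open>\<sigma> = 1\<close> and is a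
      full turn lower for \<open>\<sigma> = - 1\<close>: this is the jump.\<close>
    have L': "angle_lift (secant s) a b (\<nu> + \<sigma> * pi + Arg (- H s a)) (hi s)"
      using L[unfolded A B] by (simp add: w_def hi_def algebra_simps)
    have "angle_lift (secant s) a b (lo s) (hi s + 2 * pi * of_int (if \<kappa> * (s - s0) > 0 then 0 else 1))"
    proof (cases "\<kappa> * (s - s0) > 0")
      case True
      then show ?thesis using L' by (simp add: \<sigma>_def lo_def algebra_simps)
    next
      case False
      then show ?thesis using angle_lift_shift[OF L', of 1] by (simp add: \<sigma>_def lo_def algebra_simps)
    qed
    moreover have "secant s u \<noteq> 0" if "u \<in> {a..b}" for u using slit[OF that] by auto
    ultimately show ?thesis by blast
  qed
  define K where "K s = n1 + n3 + (if \<kappa> * (s - s0) > 0 then 0 else 1)" for s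
  have main: "\<not> self_crossing s \<and> turns s (K s)" if s: "s \<in> S" "s \<noteq> s0" for s
  proof
    have "secant s u \<noteq> 0" if "u \<in> {0..1}" for u
    proof (cases "u \<le> a")
      case True
      then show ?thesis using e1(2)[of s u] S[OF s(1)] that by (auto simp: \<epsilon>_def)
    next
      case False
      then show ?thesis using mid[OF s] e3(2)[of s u] S[OF s(1)] that
        by (cases "u \<le> b") (auto simp: \<epsilon>_def)
    qed
    then show "\<not> self_crossing s" by (auto simp: self_crossing_iff)
    define j :: int where "j = (if \<kappa> * (s - s0) > 0 then 0 else 1)"
    have 1: "angle_lift (secant s) a b (lo s + 2 * pi * of_int n1) (hi s + 2 * pi * of_int (j + n1))"
      using angle_lift_shift[of _ _ _ "lo s" _ n1] mid[OF s] unfolding j_def[symmetric]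
      by (fastforce simp: algebra_simps)
    have 2: "angle_lift (secant s) b 1 (hi s + 2 * pi * of_int (j + n1))
       (end_angle s + 2 * pi * of_int n3 + 2 * pi * of_int (j + n1))"
      by (rule angle_lift_shift[OF n3[OF s(1)]])
    have "angle_lift (secant s) 0 1 (\<theta> s) (end_angle s + 2 * pi * of_int n3 + 2 * pi * of_int (j + n1))"
      by (rule angle_lift_join[OF angle_lift_join[OF n1[OF s(1)] 1] 2]) (use ab in auto)
    then show "turns s (K s)" unfolding turns_def K_def j_def[symmetric] by (simp add: algebra_simps)
  qed
  show ?thesis
  \<comment> \<open>\<open>K\<close> depends only on the side of \<open>s0\<close>, so
    \<open>s0 - 1\<close> and \<open>s0 + 1\<close> merely stand for the two sides and need not lie
    in \<open>S\<close>.\<close>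
  proof (rule that[OF \<epsilon>, of "K (s0 - 1)" "K (s0 + 1)"])
    show "odd (K (s0 - 1) - K (s0 + 1))" using \<kappa> by (auto simp: K_def)
    fix s
    show "\<not> self_crossing s \<and> turns s (K (s0 - 1))" if "s0 - \<epsilon> < s" "s < s0"
    proof -
      have "K s = K (s0 - 1)" using that by (auto simp: K_def zero_less_mult_iff)
      then show ?thesis using main[of s] that by (auto simp: S_def dist_real_def)
    qed
    show "\<not> self_crossing s \<and> turns s (K (s0 + 1))" if "s0 < s" "s < s0 + \<epsilon>"
    proof -
      have "K s = K (s0 + 1)" using that by (auto simp: K_def zero_less_mult_iff)
      then show ?thesis using main[of s] that by (auto simp: S_def dist_real_def)
    qed
  qed
qed


section \<open>Counting the jumps over one period\<close>

lemma self_crossing_isolated: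
  obtains \<epsilon> where "\<epsilon> > 0" "\<And>s. \<bar>s - s0\<bar> < \<epsilon> \<Longrightarrow> s \<noteq> s0 \<Longrightarrow> \<not> self_crossing s"
proof (cases "self_crossing s0")
  case True
  then obtain \<epsilon> k k' where \<epsilon>: "\<epsilon> > 0"
    "\<And>s. s0 - \<epsilon> < s \<Longrightarrow> s < s0 \<Longrightarrow> \<not> self_crossing s \<and> turns s k"
    "\<And>s. s0 < s \<Longrightarrow> s < s0 + \<epsilon> \<Longrightarrow> \<not> self_crossing s \<and> turns s k'"
    by (rule turns_jump) blast
  show ?thesis
  proof (rule that[OF \<epsilon>(1)])
    fix s assume "\<bar>s - s0\<bar> < \<epsilon>" "s \<noteq> s0"
    then show "\<not> self_crossing s" using \<epsilon>(2)[of s] \<epsilon>(3)[of s] by (cases "s < s0") auto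
  qed
next
  case False
  then obtain \<epsilon> k where "\<epsilon> > 0" "\<And>s. \<bar>s - s0\<bar> < \<epsilon> \<Longrightarrow> \<not> self_crossing s \<and> turns s k"
    using turns_locally_constant by blast
  then show ?thesis using that by blast
qed

lemma finite_self_crossings: "finite {s. a \<le> s \<and> s \<le> b \<and> self_crossing s}"
proof -
  have "\<not> z islimpt {s. self_crossing s}" for z
  proof -
    obtain \<epsilon> where "\<epsilon> > 0" "\<And>s. \<bar>s - z\<bar> < \<epsilon> \<Longrightarrow> s \<noteq> z \<Longrightarrow> \<not> self_crossing s"
      using self_crossing_isolated[of z] by blast
    then show ?thesis unfolding islimpt_approachable by (force simp: dist_real_def)
  qed
  then have "finite ({a..b} \<inter> {s. self_crossing s})" by (intro finite_not_islimpt_in_compact) auto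
  then show ?thesis by (simp add: Int_def conj_ac)
qed

lemma angle_sum: "\<exists>n::int. \<theta> (s + 1) + \<theta> s = 2 * pi * of_int n"
proof -
  have "c' (s + 1) = cnj (of_real (cmod (c' s)) * cis (\<theta> s))"
    using deriv_shift[of s] angle[of s] by simp
  also have "\<dots> = of_real (cmod (c' (s + 1))) * cis (- \<theta> s)" by (simp add: cis_cnj deriv_shift)
  finally obtain n :: int where "\<theta> (s + 1) = - \<theta> s + 2 * pi * of_int n"
    using cis_cong_polar[OF angle[of "s + 1"]] regular by metis
  then show ?thesis by (intro exI[of _ n]) auto
qed

text \<open>The reflection turns \<open>turns s k\<close> into \<open>turns (s + 1) (m - k)\<close>, so over one period the
  number of turns changes by \<open>m\<close> modulo 2, one unit per self-crossing.\<close>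

theorem winding_parity:
  assumes "(\<theta> 0 + \<theta> 1) / (2 * pi) = of_int m"
  shows "even m \<longleftrightarrow> even (card {s. 0 \<le> s \<and> s < 1 \<and> self_crossing s})"
proof -
  \<comment> \<open>The integer in \<open>angle_sum\<close> varies continuously with
    \<open>s\<close>, so its value \<open>m\<close> at \<open>0\<close> serves everywhere.\<close>
  have shift: "\<theta> (s + 1) = - \<theta> s + 2 * pi * of_int m" for s
  proof -
    have "continuous_on UNIV (\<lambda>s. \<theta> (s + 1) + \<theta> s)"
      by (intro continuous_intros cont_angle continuous_on_compose2[OF cont_angle]) auto
    then obtain n :: int where n: "\<And>s. \<theta> (s + 1) + \<theta> s = 2 * pi * of_int n"
      using continuous_int_multiple_constant[of UNIV "\<lambda>s. \<theta> (s + 1) + \<theta> s"] angle_sum by auto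
    have "\<theta> 0 + \<theta> 1 = 2 * pi * of_int m" using assms by (simp add: field_simps)
    then show ?thesis using n[of s] n[of 0] by simp
  qed
  have flip: "turns (s + 1) (m - k)" if "turns s k" for s k
  proof -
    have "angle_lift (secant (s + 1)) 0 1 (- \<theta> s) (- (end_angle s + 2 * pi * of_int k))"
      using angle_lift_cnj[OF that[unfolded turns_def]] unfolding secant_shift .
    from angle_lift_shift[OF this, of m] show ?thesis
      unfolding turns_def shift end_angle_shift by (simp add: algebra_simps)
  qed
  obtain \<epsilon> where \<epsilon>: "\<epsilon> > 0" "\<And>s. \<bar>s - 0\<bar> < \<epsilon> \<Longrightarrow> s \<noteq> 0 \<Longrightarrow> \<not> self_crossing s"
    using self_crossing_isolated by blast
  \<comment> \<open>The period starts slightly before \<open>0\<close>, because \<open>0\<close> may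
    itself be a self-crossing. The crossings in \<open>[a, a + 1]\<close> are then those in
    \<open>[0, 1)\<close>, and all of them are interior.\<close>
  define a where "a = - min \<epsilon> 1 / 2"
  have a: "- \<epsilon> < a" "- 1 < a" "a < 0" using \<epsilon> by (auto simp: a_def min_def)
  have free: "\<not> self_crossing s" if "a \<le> s" "s < 0" for s using \<epsilon>(2)[of s] that a by auto
  have free': "\<not> self_crossing s" if "a + 1 \<le> s" "s < 1" for s
    using free[of "s - 1"] self_crossing_shift[of "s - 1"] that by auto
  define B where "B = {s. 0 \<le> s \<and> s < 1 \<and> self_crossing s}"
  have B: "s \<in> B \<longleftrightarrow> self_crossing s" if "s \<in> {a..a + 1}" for s
    using free[of s] that a by (auto simp: B_def) (meson not_le)
  have Bsub: "B \<subseteq> {a<..<a + 1}" using a free' by (auto simp: B_def) (meson not_le)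
  have "finite B"
    by (rule finite_subset[OF _ finite_self_crossings[of 0 1]]) (auto simp: B_def)
  define e where "e s \<longleftrightarrow> (\<exists>k. turns s k \<and> even k)" for s
  have e: "e s \<longleftrightarrow> even k" if "turns s k" "\<not> self_crossing s" for s k
    using that turns_unique[OF _ that(1,2)] unfolding e_def by blast
  have "(e a = e (a + 1)) \<longleftrightarrow> even (card B)"
  proof (rule parity_of_jumps[OF \<open>finite B\<close> _ Bsub])
    show "eventually (\<lambda>t. e t = e s) (at s)" if s: "s \<in> {a..a + 1} - B" for s
    proof -
      have "\<not> self_crossing s" using s B[of s] by blast
      then obtain \<epsilon> k where k: "\<epsilon> > 0" "\<And>t. \<bar>t - s\<bar> < \<epsilon> \<Longrightarrow> \<not> self_crossing t \<and> turns t k"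
        using turns_locally_constant by blast
      have "e t = e s" if "\<bar>t - s\<bar> < \<epsilon>" for t
        using e[of t k] e[of s k] k(2)[of t] k(2)[of s] k(1) that by simp
      then show ?thesis unfolding eventually_at dist_real_def using k(1) by blast
    qed
    show "\<exists>v. eventually (\<lambda>t. e t = v) (at_left s) \<and> eventually (\<lambda>t. e t = (\<not> v)) (at_right s)"
      if s: "s \<in> B" for s
    proof -
      have "self_crossing s" using s by (simp add: B_def)
      then obtain \<epsilon> k k' where k: "\<epsilon> > 0" "odd (k - k')"
        "\<And>t. s - \<epsilon> < t \<Longrightarrow> t < s \<Longrightarrow> \<not> self_crossing t \<and> turns t k"
        "\<And>t. s < t \<Longrightarrow> t < s + \<epsilon> \<Longrightarrow> \<not> self_crossing t \<and> turns t k'"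
        by (rule turns_jump) blast
      have "eventually (\<lambda>t. e t = even k) (at_left s)"
        using eventually_at_left_real[of "s - \<epsilon>" s] k(1)
        by (auto elim!: eventually_mono simp: e[of _ k] k(3))
      moreover have "eventually (\<lambda>t. e t = (\<not> even k)) (at_right s)"
        using eventually_at_right_real[of s "s + \<epsilon>"] k(1,2)
        by (auto elim!: eventually_mono simp: e[of _ k'] k(4))
      ultimately show ?thesis by blast
    qed
  qed simp
  moreover obtain k where k: "turns a k"
    using turns_locally_constant[OF free[of a]] a by (metis abs_zero diff_self order_refl)
  have "e a = even k" "e (a + 1) = even (m - k)"
    using e[OF k free] e[OF flip[OF k] free'] a by auto
  ultimately show ?thesis unfolding B_def by auto
qed

end

section \<open>Orientation\<close>

text \<open>\<open>cross2\<close> is the area form, so a linear map multiplies it by its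
  determinant.\<close>

lemma cross2_linear:
  assumes "linear L"
  shows "cross2 (L v) (L w) = cross2 (L 1) (L \<i>) * cross2 v w"
proof -
  have L: "L z = Re z *\<^sub>R L 1 + Im z *\<^sub>R L \<i>" for z
  proof -
    have "z = Re z *\<^sub>R 1 + Im z *\<^sub>R \<i>" by (simp add: complex_eq_iff)
    then have "L z = L (Re z *\<^sub>R 1 + Im z *\<^sub>R \<i>)" by simp
    then show ?thesis by (simp add: linear_add[OF assms] linear_scale[OF assms])
  qed
  show ?thesis unfolding L[of v] L[of w] by (simp add: cross2_def algebra_simps)
qed

lemma cross2_mult: "cross2 (k * v) (k * w) = (cmod k)\<^sup>2 * cross2 v w"
  unfolding cross2_def cmod_power2 by (simp add: algebra_simps power2_eq_square)

lemma cross2_cnj: "cross2 (cnj v) (cnj w) = - cross2 v w"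
  by (simp add: cross2_def)

lemma cross2_1_i [simp]: "cross2 1 \<i> = 1"
  by (simp add: cross2_def)

lemma field_derivative_positive:
  assumes "(f has_field_derivative k) (at z)" "(f has_derivative D) (at z)"
  shows "cross2 (D 1) (D \<i>) = (cmod k)\<^sup>2"
proof -
  have "D = (*) k" using has_derivative_unique[OF assms(2) assms(1)[unfolded has_field_derivative_def]] .
  then show ?thesis using cross2_mult[of k 1 \<i>] by simp
qed

lemma has_derivative_of_cnj:
  assumes "((\<lambda>z. cnj (f z)) has_field_derivative k) (at z)"
  shows "(f has_derivative (\<lambda>h. cnj (k * h))) (at z)"
  using has_derivative_cnj[OF assms[unfolded has_field_derivative_def]] by simp

lemma cnj_field_derivative_negative:
  assumes "((\<lambda>z. cnj (f z)) has_field_derivative k) (at z)" "(f has_derivative D) (at z)"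
  shows "cross2 (D 1) (D \<i>) = - (cmod k)\<^sup>2"
proof -
  have "D = (\<lambda>h. cnj (k * h))" using has_derivative_unique[OF assms(2) has_derivative_of_cnj[OF assms(1)]] .
  then show ?thesis using cross2_mult[of k 1 \<i>] cross2_cnj[of k "k * \<i>"] by simp
qed

lemma orientation_compose:
  assumes "(f has_derivative D) (at z)" "(h has_derivative E) (at (f z))"
    "((\<lambda>z. h (f z)) has_derivative F) (at z)"
  shows "cross2 (F 1) (F \<i>) = cross2 (E 1) (E \<i>) * cross2 (D 1) (D \<i>)"
proof -
  have "((\<lambda>z. h (f z)) has_derivative (\<lambda>v. E (D v))) (at z)"
    using diff_chain_at[OF assms(1,2)] by (simp add: o_def)
  then have "F = (\<lambda>v. E (D v))" using has_derivative_unique[OF assms(3)] by blast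
  then show ?thesis using cross2_linear[OF has_derivative_linear[OF assms(2)], of "D 1" "D \<i>"] by simp
qed

section \<open>Local isometries of the model planes\<close>

lemma open_model_plane: "open (model_plane g)"
  by (cases g) (auto simp: open_halfspace_Im_gt)

lemma convex_model_plane: "convex (model_plane g)"
  by (cases g) (auto simp: convex_halfspace_Im_gt)

lemma cosh_model_dist:
  assumes "Im z > 0" "Im w > 0"
  shows "cosh (model_dist Hyperbolic z w) = 1 + (cmod (z - w))\<^sup>2 / (2 * Im z * Im w)"
proof -
  have "(cmod (z - w))\<^sup>2 / (2 * Im z * Im w) \<ge> 0" using assms by simp
  then show ?thesis by (simp add: cosh_arcosh_real)
qed

lemma model_dist_eq_0:
  assumes "z \<in> model_plane g" "w \<in> model_plane g" "model_dist g z w = 0"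
  shows "z = w"
proof (cases g)
  case Euclidean
  then show ?thesis using assms by simp
next
  case Hyperbolic
  then have "Im z > 0" "Im w > 0" using assms by auto
  then show ?thesis using cosh_model_dist[of z w] assms(3) Hyperbolic by auto
qed

text \<open>Norms and mutual distances determine all inner products. After division by a nonzero
  reference value the real parts agree and the imaginary parts agree up to sign; the products of
  imaginary parts force one common sign.\<close>

lemma congruent_configurations:
  fixes \<zeta> h :: "'b \<Rightarrow> complex"
  assumes n: "\<And>x. x \<in> A \<Longrightarrow> cmod (h x) = cmod (\<zeta> x)"
    and d: "\<And>x y. x \<in> A \<Longrightarrow> y \<in> A \<Longrightarrow> cmod (h x - h y) = cmod (\<zeta> x - \<zeta> y)"
  shows "\<exists>\<alpha>. cmod \<alpha> = 1 \<and> ((\<forall>x\<in>A. h x = \<alpha> * \<zeta> x) \<or> (\<forall>x\<in>A. h x = \<alpha> * cnj (\<zeta> x)))"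
proof (cases "\<exists>x\<in>A. \<zeta> x \<noteq> 0")
  case False
  then show ?thesis using n by (intro exI[of _ 1]) auto
next
  case True
  then obtain x1 where x1: "x1 \<in> A" "\<zeta> x1 \<noteq> 0" by blast
  then have h1: "h x1 \<noteq> 0" using n by fastforce
  define \<kappa> \<omega> where "\<kappa> x = h x / h x1" and "\<omega> x = \<zeta> x / \<zeta> x1" for x
  have n': "cmod (\<kappa> x) = cmod (\<omega> x)" if "x \<in> A" for x
    using n that x1 by (simp add: \<kappa>_def \<omega>_def norm_divide)
  have d': "cmod (\<kappa> x - \<kappa> y) = cmod (\<omega> x - \<omega> y)" if "x \<in> A" "y \<in> A" for x y
    using n[OF x1(1)] d[OF that] by (simp add: \<kappa>_def \<omega>_def norm_divide flip: diff_divide_distrib)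
  have one: "\<kappa> x1 = 1" "\<omega> x1 = 1" using x1 h1 by (auto simp: \<kappa>_def \<omega>_def)
  have inner: "Re (\<kappa> x * cnj (\<kappa> y)) = Re (\<omega> x * cnj (\<omega> y))" if "x \<in> A" "y \<in> A" for x y
  proof -
    have *: "2 * Re (a * cnj b) = (cmod a)\<^sup>2 + (cmod b)\<^sup>2 - (cmod (a - b))\<^sup>2" for a b
      unfolding cmod_power2 by (simp add: power2_eq_square algebra_simps)
    show ?thesis using *[of "\<kappa> x" "\<kappa> y"] *[of "\<omega> x" "\<omega> y"] n' d' that by simp
  qed
  have re: "Re (\<kappa> x) = Re (\<omega> x)" if "x \<in> A" for x
    using inner[OF that x1(1)] one by simp
  have im: "Im (\<kappa> x) * Im (\<kappa> y) = Im (\<omega> x) * Im (\<omega> y)" if "x \<in> A" "y \<in> A" for x y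
    using inner[OF that] re that by simp
  have pm: "Im (\<kappa> x) = Im (\<omega> x) \<or> Im (\<kappa> x) = - Im (\<omega> x)" if "x \<in> A" for x
    using im[OF that that] by (simp add: square_eq_iff)
  show ?thesis
  proof (cases "\<exists>x2\<in>A. Im (\<omega> x2) \<noteq> 0 \<and> Im (\<kappa> x2) = Im (\<omega> x2)")
    case True
    then obtain x2 where x2: "x2 \<in> A" "Im (\<omega> x2) \<noteq> 0" "Im (\<kappa> x2) = Im (\<omega> x2)" by blast
    then have "\<kappa> x = \<omega> x" if "x \<in> A" for x
      using im[OF that x2(1)] re[OF that] by (simp add: complex_eq_iff)
    then have "h x = (h x1 / \<zeta> x1) * \<zeta> x" if "x \<in> A" for x
      using that h1 x1 by (fastforce simp: \<kappa>_def \<omega>_def field_simps)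
    moreover have "cmod (h x1 / \<zeta> x1) = 1" using n[OF x1(1)] x1 by (simp add: norm_divide)
    ultimately show ?thesis by blast
  next
    case False
    then have "\<kappa> x = cnj (\<omega> x)" if "x \<in> A" for x
      using pm[OF that] re[OF that] that by (auto simp: complex_eq_iff)
    then have "h x = (h x1 / cnj (\<zeta> x1)) * cnj (\<zeta> x)" if "x \<in> A" for x
      using that h1 x1 by (fastforce simp: \<kappa>_def \<omega>_def field_simps)
    moreover have "cmod (h x1 / cnj (\<zeta> x1)) = 1" using n[OF x1(1)] x1 by (simp add: norm_divide)
    ultimately show ?thesis by blast
  qed
qed

text \<open>The isometry from the half-plane to the Poincare disc that takes \<open>z\<close> to the origin.\<close>

definition cayley :: "complex \<Rightarrow> complex \<Rightarrow> complex" where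
  "cayley z w = (w - z) / (w - cnj z)"

lemma cayley_self [simp]: "cayley z z = 0"
  by (simp add: cayley_def)

lemma cayley_denom: "Im z > 0 \<Longrightarrow> Im w > 0 \<Longrightarrow> w - cnj z \<noteq> 0"
  by (auto simp: complex_eq_iff)

lemma cayley_norm:
  assumes "Im z > 0" "Im w > 0"
  shows "1 - (cmod (cayley z w))\<^sup>2 = 4 * Im z * Im w / (cmod (w - cnj z))\<^sup>2"
proof -
  have n: "(cmod (w - cnj z))\<^sup>2 \<noteq> 0" using cayley_denom[OF assms] by simp
  have "(cmod (w - cnj z))\<^sup>2 - (cmod (w - z))\<^sup>2 = 4 * Im z * Im w"
    unfolding cmod_power2 by (simp add: power2_eq_square algebra_simps)
  moreover have "1 - (cmod (cayley z w))\<^sup>2 = ((cmod (w - cnj z))\<^sup>2 - (cmod (w - z))\<^sup>2) / (cmod (w - cnj z))\<^sup>2"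
    unfolding cayley_def norm_divide power_divide using n by (simp add: diff_divide_distrib[where 'a = real])
  ultimately show ?thesis by simp
qed

text \<open>This makes hyperbolic distances Euclidean: once the norms in the disc are known, the
  distance of two points and that of their images determine each other.\<close>

lemma cayley_dist:
  assumes "Im z > 0" "Im w1 > 0" "Im w2 > 0"
  shows "(cmod (cayley z w1 - cayley z w2))\<^sup>2 =
    (cmod (w1 - w2))\<^sup>2 / (4 * Im w1 * Im w2) * (1 - (cmod (cayley z w1))\<^sup>2) * (1 - (cmod (cayley z w2))\<^sup>2)"
proof -
  note n = cayley_denom[OF assms(1,2)] cayley_denom[OF assms(1,3)]
  have "cayley z w1 - cayley z w2 = (z - cnj z) * (w1 - w2) / ((w1 - cnj z) * (w2 - cnj z))"
    using n by (simp add: cayley_def diff_frac_eq algebra_simps)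
  also have "z - cnj z = of_real (2 * Im z) * \<i>" by (simp add: complex_eq_iff)
  finally have E: "cmod (cayley z w1 - cayley z w2) =
      2 * Im z * cmod (w1 - w2) / (cmod (w1 - cnj z) * cmod (w2 - cnj z))"
    using assms by (simp add: norm_divide norm_mult)
  show ?thesis unfolding cayley_norm[OF assms(1,2)] cayley_norm[OF assms(1,3)] E
    using assms n by (simp add: field_simps power2_eq_square)
qed

lemma cayley_inverse:
  assumes "Im z > 0" "Im w > 0"
  shows "1 - cayley z w \<noteq> 0" "w = (z - cnj z * cayley z w) / (1 - cayley z w)"
proof -
  note n = cayley_denom[OF assms]
  have e: "1 - cayley z w = (z - cnj z) / (w - cnj z)" using n by (simp add: cayley_def field_simps)
  have i: "z - cnj z \<noteq> 0" using assms by (auto simp: complex_eq_iff)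
  then show "1 - cayley z w \<noteq> 0" using n e by simp
  have "z - cnj z * cayley z w = w * (z - cnj z) / (w - cnj z)"
    using n by (simp add: cayley_def field_simps)
  then show "w = (z - cnj z * cayley z w) / (1 - cayley z w)" unfolding e using n i by simp
qed

text \<open>Distances from \<open>z0\<close> fix the norms in the disc; then
  \<open>cayley_dist\<close> turns \<open>f\<close> into a Euclidean congruence of the disc images
  that keeps the origin.\<close>

lemma hyperbolic_isometry_cases:
  assumes H: "\<And>z. z \<in> A \<Longrightarrow> Im z > 0" "\<And>z. z \<in> A \<Longrightarrow> Im (f z) > 0" and "z0 \<in> A"
    and iso: "\<And>z w. z \<in> A \<Longrightarrow> w \<in> A \<Longrightarrow> model_dist Hyperbolic (f z) (f w) = model_dist Hyperbolic z w"
  shows "\<exists>\<alpha>. cmod \<alpha> = 1 \<and> ((\<forall>z\<in>A. cayley (f z0) (f z) = \<alpha> * cayley z0 z) \<or>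
                            (\<forall>z\<in>A. cayley (f z0) (f z) = \<alpha> * cnj (cayley z0 z)))"
proof (rule congruent_configurations)
  have Q: "(cmod (f z - f w))\<^sup>2 / (4 * Im (f z) * Im (f w)) = (cmod (z - w))\<^sup>2 / (4 * Im z * Im w)"
    if "z \<in> A" "w \<in> A" for z w
  proof -
    have "1 + (cmod (f z - f w))\<^sup>2 / (2 * Im (f z) * Im (f w)) = 1 + (cmod (z - w))\<^sup>2 / (2 * Im z * Im w)"
      using iso[OF that] cosh_model_dist H that by metis
    moreover have "x / (4 * a * b) = x / (2 * a * b) / 2" for x a b :: real by simp
    ultimately show ?thesis by simp
  qed
  have z0: "Im z0 > 0" "Im (f z0) > 0" using H \<open>z0 \<in> A\<close> by auto
  show n: "cmod (cayley (f z0) (f z)) = cmod (cayley z0 z)" if "z \<in> A" for z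
  proof -
    \<comment> \<open>Half of \<open>cosh\<close> of the distance from \<open>z0\<close>, minus one
      half. The squared norm \<open>N\<close> in the disc satisfies \<open>N = q * (1 - N)\<close>
      and is determined by \<open>q\<close>.\<close>
    define q where "q = (cmod (z - z0))\<^sup>2 / (4 * Im z * Im z0)"
    have "4 * Im z * Im z0 > 0" using H(1)[OF that] z0 by simp
    then have q: "q \<ge> 0" unfolding q_def by (intro divide_nonneg_pos) auto
    have "(cmod (cayley z0 z))\<^sup>2 = q * (1 - (cmod (cayley z0 z))\<^sup>2)"
      using cayley_dist[OF z0(1) H(1)[OF that] z0(1)] by (simp add: q_def)
    moreover have "(cmod (cayley (f z0) (f z)))\<^sup>2 = q * (1 - (cmod (cayley (f z0) (f z)))\<^sup>2)"
      using cayley_dist[OF z0(2) H(2)[OF that] z0(2)] Q[OF that \<open>z0 \<in> A\<close>] by (simp add: q_def)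
    ultimately have "(1 + q) * (cmod (cayley (f z0) (f z)))\<^sup>2 = (1 + q) * (cmod (cayley z0 z))\<^sup>2"
      by (simp add: algebra_simps)
    then have "(cmod (cayley (f z0) (f z)))\<^sup>2 = (cmod (cayley z0 z))\<^sup>2" using q by simp
    then show ?thesis by simp
  qed
  show "cmod (cayley (f z0) (f z) - cayley (f z0) (f w)) = cmod (cayley z0 z - cayley z0 w)"
    if "z \<in> A" "w \<in> A" for z w
  proof -
    have "(cmod (cayley (f z0) (f z) - cayley (f z0) (f w)))\<^sup>2 = (cmod (cayley z0 z - cayley z0 w))\<^sup>2"
      using cayley_dist[OF z0(1) H(1)[OF that(1)] H(1)[OF that(2)]]
        cayley_dist[OF z0(2) H(2)[OF that(1)] H(2)[OF that(2)]] Q[OF that] n that by simp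
    then show ?thesis by simp
  qed
qed

lemma euclidean_isometry_cases:
  assumes "z0 \<in> A" "\<And>z w. z \<in> A \<Longrightarrow> w \<in> A \<Longrightarrow> dist (f z) (f w) = dist z w"
  shows "\<exists>\<alpha>. cmod \<alpha> = 1 \<and> ((\<forall>z\<in>A. f z - f z0 = \<alpha> * (z - z0)) \<or> (\<forall>z\<in>A. f z - f z0 = \<alpha> * cnj (z - z0)))"
  by (rule congruent_configurations) (use assms in \<open>auto simp: dist_norm\<close>)

text \<open>Solving the congruence for \<open>f z\<close> gives an affine or Moebius expression in
  \<open>z\<close> or in \<open>cnj z\<close>, so smoothness follows from preservation of
  distances.\<close>

lemma isometry_conformal:
  assumes "A \<subseteq> model_plane g" "f ` A \<subseteq> model_plane g"
    and iso: "\<And>z w. z \<in> A \<Longrightarrow> w \<in> A \<Longrightarrow> model_dist g (f z) (f w) = model_dist g z w"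
  shows "f holomorphic_on A \<or> (\<lambda>z. cnj (f z)) holomorphic_on A"
proof (cases "A = {}")
  case False
  then obtain z0 where z0: "z0 \<in> A" by blast
  show ?thesis
  proof (cases g)
    case Euclidean
    then obtain \<alpha> where "(\<forall>z\<in>A. f z - f z0 = \<alpha> * (z - z0)) \<or> (\<forall>z\<in>A. f z - f z0 = \<alpha> * cnj (z - z0))"
      using euclidean_isometry_cases[OF z0, of f] iso by auto
    then show ?thesis
    proof
      assume "\<forall>z\<in>A. f z - f z0 = \<alpha> * (z - z0)"
      then have *: "\<forall>z\<in>A. f z = f z0 + \<alpha> * (z - z0)" by (metis add.commute diff_add_cancel)
      have "(\<lambda>z. f z0 + \<alpha> * (z - z0)) holomorphic_on A" by (intro holomorphic_intros)
      then show ?thesis using * holomorphic_cong[OF refl, of A f] by auto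
    next
      assume **: "\<forall>z\<in>A. f z - f z0 = \<alpha> * cnj (z - z0)"
      have *: "\<forall>z\<in>A. cnj (f z) = cnj (f z0) + cnj \<alpha> * (z - z0)"
      proof
        fix z assume "z \<in> A"
        then have "cnj (f z - f z0) = cnj (\<alpha> * cnj (z - z0))" using ** by simp
        then show "cnj (f z) = cnj (f z0) + cnj \<alpha> * (z - z0)" by (simp add: algebra_simps)
      qed
      have "(\<lambda>z. cnj (f z0) + cnj \<alpha> * (z - z0)) holomorphic_on A" by (intro holomorphic_intros)
      then show ?thesis using * holomorphic_cong[OF refl, of A "\<lambda>z. cnj (f z)"] by auto
    qed
  next
    case Hyperbolic
    have H: "Im z > 0" "Im (f z) > 0" if "z \<in> A" for z using assms(1,2) Hyperbolic that by auto
    define w0 where "w0 = f z0"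
    have w0: "Im w0 > 0" using H z0 by (simp add: w0_def)
    have cay: "cayley z0 holomorphic_on A"
      unfolding cayley_def using cayley_denom H z0 by (intro holomorphic_intros) blast
    obtain \<alpha> where "(\<forall>z\<in>A. cayley w0 (f z) = \<alpha> * cayley z0 z) \<or>
        (\<forall>z\<in>A. cayley w0 (f z) = \<alpha> * cnj (cayley z0 z))"
      using hyperbolic_isometry_cases[of A f, OF H z0] iso Hyperbolic unfolding w0_def by auto
    then show ?thesis
    proof
      assume *: "\<forall>z\<in>A. cayley w0 (f z) = \<alpha> * cayley z0 z"
      have f: "1 - \<alpha> * cayley z0 z \<noteq> 0" "f z = (w0 - cnj w0 * (\<alpha> * cayley z0 z)) / (1 - \<alpha> * cayley z0 z)"
        if "z \<in> A" for z
        using cayley_inverse[OF w0 H(2)[OF that]] * that by auto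
      have "(\<lambda>z. (w0 - cnj w0 * (\<alpha> * cayley z0 z)) / (1 - \<alpha> * cayley z0 z)) holomorphic_on A"
        using f by (intro holomorphic_intros cay) auto
      then show ?thesis using f(2) holomorphic_cong[OF refl, of A f] by auto
    next
      assume *: "\<forall>z\<in>A. cayley w0 (f z) = \<alpha> * cnj (cayley z0 z)"
      have f: "1 - cnj \<alpha> * cayley z0 z \<noteq> 0"
        "cnj (f z) = (cnj w0 - w0 * (cnj \<alpha> * cayley z0 z)) / (1 - cnj \<alpha> * cayley z0 z)"
        if "z \<in> A" for z
      proof -
        have c: "cnj (cayley w0 (f z)) = cnj \<alpha> * cayley z0 z" using * that by simp
        have "cnj (1 - cayley w0 (f z)) \<noteq> 0" using cayley_inverse(1)[OF w0 H(2)[OF that]]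
          by (metis complex_cnj_zero_iff)
        then show "1 - cnj \<alpha> * cayley z0 z \<noteq> 0" by (simp add: c)
        show "cnj (f z) = (cnj w0 - w0 * (cnj \<alpha> * cayley z0 z)) / (1 - cnj \<alpha> * cayley z0 z)"
          by (subst cayley_inverse(2)[OF w0 H(2)[OF that]]) (simp add: c)
      qed
      have "(\<lambda>z. (cnj w0 - w0 * (cnj \<alpha> * cayley z0 z)) / (1 - cnj \<alpha> * cayley z0 z)) holomorphic_on A"
        using f by (intro holomorphic_intros cay) auto
      then show ?thesis using f(2) holomorphic_cong[OF refl, of A "\<lambda>z. cnj (f z)"] by auto
    qed
  qed
qed (simp add: holomorphic_on_def)

section \<open>Deck transformations\<close>

lemma deck_in_model: "deck_transformation g p S \<Longrightarrow> z \<in> model_plane g \<Longrightarrow> S z \<in> model_plane g"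
  unfolding deck_transformation_def homeomorphism_def by blast

lemma deck_inj: "deck_transformation g p S \<Longrightarrow> inj_on S (model_plane g)"
  unfolding deck_transformation_def homeomorphism_def by (metis inj_on_inverseI)

lemma deck_continuous: "deck_transformation g p S \<Longrightarrow> continuous_on (model_plane g) S"
  unfolding deck_transformation_def homeomorphism_def by blast

text \<open>\<open>S\<close> and \<open>T\<close> both lift \<open>p\<close> through
  \<open>p\<close> itself, so unique lifting applies.\<close>

lemma deck_unique:
  assumes "covering_space (model_plane g) p M" "deck_transformation g p S" "deck_transformation g p T"
    "z \<in> model_plane g" "S z = T z" "w \<in> model_plane g"
  shows "S w = T w"
proof (rule covering_space_lift_unique[where ?g1.0 = S and ?g2.0 = T and f = p and a = z and T = "model_plane g", OF assms(1,5)])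
  show "continuous_on (model_plane g) p" "p \<in> model_plane g \<rightarrow> M"
    using assms(1) unfolding covering_space_def by auto
  show "connected (model_plane g)" using convex_model_plane convex_connected by blast
  show "p x = p (S x)" "p x = p (T x)" if "x \<in> model_plane g" for x
    using assms(2,3) that unfolding deck_transformation_def by metis+
  show "continuous_on (model_plane g) S" "continuous_on (model_plane g) T"
    using deck_continuous assms(2,3) by auto
  show "S \<in> model_plane g \<rightarrow> model_plane g" "T \<in> model_plane g \<rightarrow> model_plane g"
    using deck_in_model assms(2,3) by auto
qed (use assms in auto)

lemma universal_coveringD:
  assumes "universal_covering g M p" "z \<in> model_plane g"
  obtains V where "open V" "z \<in> V" "V \<subseteq> model_plane g"
    "\<forall>x\<in>V. \<forall>y\<in>V. dist (p x) (p y) = model_dist g x y"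
  using assms unfolding universal_covering_def by auto

text \<open>\<open>p\<close> preserves distances near \<open>z\<close> and near \<open>S z\<close>,
  and \<open>p (S x) = p x\<close>.\<close>

lemma deck_locally_isometric:
  assumes "universal_covering g M p" "deck_transformation g p S" "z \<in> model_plane g"
  obtains r where "r > 0" "ball z r \<subseteq> model_plane g"
    "\<And>x y. x \<in> ball z r \<Longrightarrow> y \<in> ball z r \<Longrightarrow> model_dist g (S x) (S y) = model_dist g x y"
proof -
  obtain V where V: "open V" "z \<in> V" "V \<subseteq> model_plane g"
    "\<forall>x\<in>V. \<forall>y\<in>V. dist (p x) (p y) = model_dist g x y"
    using universal_coveringD[OF assms(1,3)] .
  have Sz: "S z \<in> model_plane g" using deck_in_model[OF assms(2,3)] .
  obtain W where W: "open W" "S z \<in> W" "W \<subseteq> model_plane g"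
    "\<forall>x\<in>W. \<forall>y\<in>W. dist (p x) (p y) = model_dist g x y"
    using universal_coveringD[OF assms(1) Sz] .
  have "open (model_plane g \<inter> S -` W)"
    using continuous_open_preimage[OF deck_continuous[OF assms(2)] open_model_plane W(1)] .
  then have "open (V \<inter> (model_plane g \<inter> S -` W))" "z \<in> V \<inter> (model_plane g \<inter> S -` W)"
    using V W assms(3) by auto
  then obtain r where r: "r > 0" "ball z r \<subseteq> V \<inter> (model_plane g \<inter> S -` W)" using openE by blast
  show ?thesis
  proof (rule that[of r])
    fix x y assume "x \<in> ball z r" "y \<in> ball z r"
    then have xy: "x \<in> V" "y \<in> V" "S x \<in> W" "S y \<in> W" "x \<in> model_plane g" "y \<in> model_plane g"
      using r(2) by auto
    then have "p (S x) = p x" "p (S y) = p y" using assms(2) by (auto simp: deck_transformation_def)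
    then show "model_dist g (S x) (S y) = model_dist g x y" using V(4) W(4) xy by metis
  qed (use r in auto)
qed

lemma deck_locally_conformal:
  assumes "universal_covering g M p" "deck_transformation g p S" "z \<in> model_plane g"
  obtains r where "r > 0" "ball z r \<subseteq> model_plane g"
    "(\<exists>k. \<forall>w\<in>ball z r. (S has_field_derivative k w) (at w) \<and> k w \<noteq> 0) \<or>
     (\<exists>k. \<forall>w\<in>ball z r. ((\<lambda>z. cnj (S z)) has_field_derivative k w) (at w) \<and> k w \<noteq> 0)"
proof -
  obtain r where r: "r > 0" "ball z r \<subseteq> model_plane g"
    "\<And>x y. x \<in> ball z r \<Longrightarrow> y \<in> ball z r \<Longrightarrow> model_dist g (S x) (S y) = model_dist g x y"
    using deck_locally_isometric[OF assms] by blast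
  have inj: "inj_on S (ball z r)" using deck_inj[OF assms(2)] r(2) inj_on_subset by blast
  then have inj': "inj_on (\<lambda>z. cnj (S z)) (ball z r)" by (auto simp: inj_on_def)
  have "S ` ball z r \<subseteq> model_plane g" using deck_in_model[OF assms(2)] r(2) by auto
  from isometry_conformal[OF r(2) this r(3)]
  have "S holomorphic_on ball z r \<or> (\<lambda>z. cnj (S z)) holomorphic_on ball z r" by blast
  then show ?thesis
  proof
    assume h: "S holomorphic_on ball z r"
    have "\<forall>w\<in>ball z r. (S has_field_derivative deriv S w) (at w) \<and> deriv S w \<noteq> 0"
      using holomorphic_derivI[OF h open_ball] holomorphic_injective_imp_regular[OF h open_ball inj] by simp
    then have "\<exists>k. \<forall>w\<in>ball z r. (S has_field_derivative k w) (at w) \<and> k w \<noteq> 0"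
      by (rule exI[of _ "deriv S"])
    then show ?thesis by (rule that[OF r(1,2) disjI1])
  next
    assume h: "(\<lambda>z. cnj (S z)) holomorphic_on ball z r"
    let ?f = "\<lambda>z. cnj (S z)"
    have "\<forall>w\<in>ball z r. (?f has_field_derivative deriv ?f w) (at w) \<and> deriv ?f w \<noteq> 0"
      using holomorphic_derivI[OF h open_ball] holomorphic_injective_imp_regular[OF h open_ball inj'] by simp
    then have "\<exists>k. \<forall>w\<in>ball z r. (?f has_field_derivative k w) (at w) \<and> k w \<noteq> 0"
      by (rule exI[of _ "deriv ?f"])
    then show ?thesis by (rule that[OF r(1,2) disjI2])
  qed
qed

text \<open>The points with positive and with negative determinant form disjoint open sets that
  cover the connected plane.\<close>

lemma deck_orientation:
  assumes "universal_covering g M p" "deck_transformation g p S"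
  shows "orientation_preserving_on (model_plane g) S \<or> orientation_reversing_on (model_plane g) S"
proof -
  define P N where
    "P = {z \<in> model_plane g. \<exists>D. (S has_derivative D) (at z) \<and> cross2 (D 1) (D \<i>) > 0}" and
    "N = {z \<in> model_plane g. \<exists>D. (S has_derivative D) (at z) \<and> cross2 (D 1) (D \<i>) < 0}"
  have loc: "\<exists>r>0. ball z r \<subseteq> P \<or> ball z r \<subseteq> N" if z: "z \<in> model_plane g" for z
  proof -
    obtain r where r: "r > 0" "ball z r \<subseteq> model_plane g"
      "(\<exists>k. \<forall>w\<in>ball z r. (S has_field_derivative k w) (at w) \<and> k w \<noteq> 0) \<or>
       (\<exists>k. \<forall>w\<in>ball z r. ((\<lambda>z. cnj (S z)) has_field_derivative k w) (at w) \<and> k w \<noteq> 0)"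
      using deck_locally_conformal[OF assms z] by blast
    from r(3) show ?thesis
    proof
      assume "\<exists>k. \<forall>w\<in>ball z r. (S has_field_derivative k w) (at w) \<and> k w \<noteq> 0"
      then obtain k where k: "\<And>w. w \<in> ball z r \<Longrightarrow> (S has_field_derivative k w) (at w) \<and> k w \<noteq> 0" by blast
      have "w \<in> P" if "w \<in> ball z r" for w
      proof -
        have D: "(S has_derivative (*) (k w)) (at w)" using k[OF that] by (simp add: has_field_derivative_def)
        have "cross2 (k w * 1) (k w * \<i>) > 0"
          using field_derivative_positive[OF conjunct1[OF k[OF that]] D] k[OF that] by simp
        with D show ?thesis using that r(2) unfolding P_def by blast
      qed
      then show ?thesis using r(1) by blast
    next
      assume "\<exists>k. \<forall>w\<in>ball z r. ((\<lambda>z. cnj (S z)) has_field_derivative k w) (at w) \<and> k w \<noteq> 0"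
      then obtain k where k: "\<And>w. w \<in> ball z r \<Longrightarrow> ((\<lambda>z. cnj (S z)) has_field_derivative k w) (at w) \<and> k w \<noteq> 0"
        by blast
      have "w \<in> N" if "w \<in> ball z r" for w
      proof -
        note D = has_derivative_of_cnj[OF conjunct1[OF k[OF that]]]
        have "cross2 (cnj (k w * 1)) (cnj (k w * \<i>)) < 0"
          using cnj_field_derivative_negative[OF conjunct1[OF k[OF that]] D] k[OF that] by simp
        then show ?thesis using D that r(2) unfolding N_def by blast
      qed
      then show ?thesis using r(1) by blast
    qed
  qed
  have disj: "P \<inter> N = {}"
  proof -
    have False if "(S has_derivative D) (at z)" "cross2 (D 1) (D \<i>) > 0"
      "(S has_derivative E) (at z)" "cross2 (E 1) (E \<i>) < 0" for z D E
      using has_derivative_unique[OF that(1,3)] that(2,4) by simp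
    then show ?thesis unfolding P_def N_def by blast
  qed
  have "open P" "open N"
    unfolding open_contains_ball using loc disj
    by (metis (no_types, lifting) P_def N_def centre_in_ball disjoint_iff mem_Collect_eq subsetD)+
  moreover have "model_plane g \<subseteq> P \<union> N" using loc by (meson UnI1 UnI2 centre_in_ball subset_iff)
  moreover have "connected (model_plane g)" using convex_model_plane convex_connected by blast
  ultimately have "model_plane g \<inter> P = {} \<or> model_plane g \<inter> N = {}"
    using disj unfolding connected_def by (metis inf.commute inf_bot_right inf_left_commute)
  then have "model_plane g \<subseteq> N \<or> model_plane g \<subseteq> P" using \<open>model_plane g \<subseteq> P \<union> N\<close> by blast
  then show ?thesis
    unfolding orientation_preserving_on_def orientation_reversing_on_def P_def N_def by blast
qed

lemma deck_antiholomorphic: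
  assumes "universal_covering g M p" "deck_transformation g p S"
    and rev: "orientation_reversing_on (model_plane g) S"
  shows "(\<lambda>z. cnj (S z)) holomorphic_on model_plane g"
proof (rule holomorphic_onI)
  fix z assume z: "z \<in> model_plane g"
  obtain r where r: "r > 0" "ball z r \<subseteq> model_plane g"
    "(\<exists>k. \<forall>w\<in>ball z r. (S has_field_derivative k w) (at w) \<and> k w \<noteq> 0) \<or>
     (\<exists>k. \<forall>w\<in>ball z r. ((\<lambda>z. cnj (S z)) has_field_derivative k w) (at w) \<and> k w \<noteq> 0)"
    using deck_locally_conformal[OF assms(1,2) z] by blast
  obtain D where D: "(S has_derivative D) (at z)" "cross2 (D 1) (D \<i>) < 0"
    using rev z unfolding orientation_reversing_on_def by blast
  have "z \<in> ball z r" using r(1) by simp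
  moreover have "\<not> (S has_field_derivative k) (at z)" for k
    using field_derivative_positive[OF _ D(1)] D(2) by (metis not_less zero_le_power2)
  ultimately obtain k where "((\<lambda>z. cnj (S z)) has_field_derivative k) (at z)" using r(3) by blast
  then show "(\<lambda>z. cnj (S z)) field_differentiable at z within model_plane g"
    using field_differentiable_at_within field_differentiable_def by blast
qed

text \<open>A fixed point would make \<open>T\<close> the identity by unique lifting, but the
  identity preserves orientation.\<close>

lemma deck_reversing_no_fixed_point:
  assumes "universal_covering g M p" "deck_transformation g p T"
    "orientation_reversing_on (model_plane g) T" "z \<in> model_plane g"
  shows "T z \<noteq> z"
proof
  assume "T z = z"
  have "deck_transformation g p (\<lambda>z. z)"
    unfolding deck_transformation_def by (auto simp: homeomorphism_def intro!: exI[of _ "\<lambda>z. z"])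
  then have id: "T w = w" if "w \<in> model_plane g" for w
    using deck_unique[OF _ assms(2) _ assms(4) _ that] assms(1) \<open>T z = z\<close>
    unfolding universal_covering_def by blast
  have "((\<lambda>w. w) has_field_derivative 1) (at z)" by simp
  then have "(T has_field_derivative 1) (at z)"
    using has_field_derivative_transform_within_open[OF _ open_model_plane assms(4)] id by metis
  moreover obtain D where "(T has_derivative D) (at z)" "cross2 (D 1) (D \<i>) < 0"
    using assms(3,4) unfolding orientation_reversing_on_def by blast
  ultimately show False using field_derivative_positive by fastforce
qed

section \<open>Straightening a glide reflection\<close>

lemma model_isometry_in: "model_isometry g f \<Longrightarrow> z \<in> model_plane g \<Longrightarrow> f z \<in> model_plane g"
  unfolding model_isometry_def by (meson bij_betwE)

text \<open>A conformal coordinate in which the glide reflection is \<open>w \<mapsto> cnj w + l\<close>, the axis is the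
  real line and translations along the axis are translations. For the euclidean plane it is an
  isometry onto the plane, for the hyperbolic plane a map onto a horizontal strip.\<close>

locale straightening =
  fixes g :: geometry and T \<Phi> :: "complex \<Rightarrow> complex" and l :: real and R :: "complex set"
  assumes holo: "\<Phi> holomorphic_on model_plane g"
    and bij: "bij_betw \<Phi> (model_plane g) R"
    and real_in: "of_real x \<in> R"
    and shift_in: "w \<in> R \<Longrightarrow> w + of_real x \<in> R"
    and shift_dist: "z \<in> model_plane g \<Longrightarrow> w \<in> model_plane g \<Longrightarrow> z' \<in> model_plane g \<Longrightarrow> w' \<in> model_plane g \<Longrightarrow>
      \<Phi> z' = \<Phi> z + of_real s \<Longrightarrow> \<Phi> w' = \<Phi> w + of_real s \<Longrightarrow> model_dist g z' w' = model_dist g z w"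
    and axis_dist: "z \<in> model_plane g \<Longrightarrow> w \<in> model_plane g \<Longrightarrow> \<Phi> z = of_real x \<Longrightarrow> \<Phi> w = of_real y \<Longrightarrow>
      model_dist g z w = \<bar>x - y\<bar>"
    and glide: "z \<in> model_plane g \<Longrightarrow> T z \<in> model_plane g"
      "z \<in> model_plane g \<Longrightarrow> \<Phi> (T z) = cnj (\<Phi> z) + of_real l"
    and l_pos: "l > 0"
    and axis: "(\<And>s. a s \<in> model_plane g) \<Longrightarrow> (\<And>s t. model_dist g (a s) (a t) = \<bar>s - t\<bar>) \<Longrightarrow> k > 0 \<Longrightarrow>
      (\<And>s. T (a s) = a (s + k)) \<Longrightarrow> \<exists>x. \<forall>s. \<Phi> (a s) = of_real (x + s)"
    and reflection: "z \<in> model_plane g \<Longrightarrow> w \<in> model_plane g \<Longrightarrow>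
      (\<And>x a b. a \<in> model_plane g \<Longrightarrow> b \<in> model_plane g \<Longrightarrow> \<Phi> a = of_real x \<Longrightarrow> \<Phi> b = of_real (x + s) \<Longrightarrow>
         model_dist g w b = model_dist g z a) \<Longrightarrow>
      \<Phi> w = \<Phi> z + of_real s \<or> \<Phi> w = cnj (\<Phi> z) + of_real s"
begin

lemma inj: "inj_on \<Phi> (model_plane g)"
  using bij by (rule bij_betw_imp_inj_on)

lemma deriv: "z \<in> model_plane g \<Longrightarrow> (\<Phi> has_field_derivative deriv \<Phi> z) (at z)"
  using holomorphic_derivI[OF holo open_model_plane] .

lemma deriv_nonzero: "z \<in> model_plane g \<Longrightarrow> deriv \<Phi> z \<noteq> 0"
  using holomorphic_injective_imp_regular[OF holo open_model_plane inj] .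

lemma has_vector_derivative_compose:
  assumes "z \<in> model_plane g" "(c has_vector_derivative v) (at t)" "c t = z"
  shows "((\<lambda>t. \<Phi> (c t)) has_vector_derivative v * deriv \<Phi> z) (at t)"
  using field_vector_diff_chain_at[of c v t \<Phi> "deriv \<Phi> z"] assms deriv[of z] by (simp add: o_def)

lemma directed_axis_coordinate:
  assumes "directed_axis g T a"
  obtains x where "\<And>s. \<Phi> (a s) = of_real (x + s)"
proof -
  obtain k where k: "k > 0" "\<And>s. T (a s) = a (s + k)" using assms by (auto simp: directed_axis_def)
  have "\<exists>x. \<forall>s. \<Phi> (a s) = of_real (x + s)"
    by (rule axis[where a = a and k = k]) (use assms k in \<open>auto simp: directed_axis_def\<close>)
  then show ?thesis using that by blast
qed

text \<open>An isometry that shifts the axis either shifts the coordinate or shifts and conjugates it;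
  off the axis, the second would make it orientation reversing near the point.\<close>

lemma translation_coordinate:
  assumes a: "directed_axis g T a" and \<phi>: "translation_group g a \<phi>" and z: "z \<in> model_plane g"
  shows "\<Phi> (\<phi> s z) = \<Phi> z + of_real s"
proof -
  have iso: "\<phi> s w \<in> model_plane g" "w' \<in> model_plane g \<Longrightarrow> model_dist g (\<phi> s w) (\<phi> s w') = model_dist g w w'"
    if "w \<in> model_plane g" for w w'
  proof -
    have mi: "model_isometry g (\<phi> s)" using \<phi> unfolding translation_group_def by blast
    show "\<phi> s w \<in> model_plane g" using model_isometry_in[OF mi that] .
    show "w' \<in> model_plane g \<Longrightarrow> model_dist g (\<phi> s w) (\<phi> s w') = model_dist g w w'"
      using mi that unfolding model_isometry_def by blast
  qed
  have op: "orientation_preserving_on (model_plane g) (\<phi> s)" and sh: "\<phi> s (a t) = a (s + t)" for t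
    using \<phi> unfolding translation_group_def by auto
  obtain x0 where x0: "\<And>s. \<Phi> (a s) = of_real (x0 + s)" using directed_axis_coordinate[OF a] by blast
  have am: "a t \<in> model_plane g" for t using a by (auto simp: directed_axis_def)
  \<comment> \<open>\<open>\<phi> s\<close> preserves distances and shifts the axis, so
    \<open>w\<close> and its image are equally far from corresponding axis points;
    \<open>reflection\<close> then leaves two candidates.\<close>
  have two: "\<Phi> (\<phi> s w) = \<Phi> w + of_real s \<or> \<Phi> (\<phi> s w) = cnj (\<Phi> w) + of_real s" if w: "w \<in> model_plane g" for w
  proof (rule reflection[OF w iso(1)[OF w]])
    fix x a' b assume *: "a' \<in> model_plane g" "b \<in> model_plane g" "\<Phi> a' = of_real x" "\<Phi> b = of_real (x + s)"
    have "a' = a (x - x0)" by (rule inj_onD[OF inj]) (use * x0 am in auto)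
    moreover have "b = a (s + (x - x0))" by (rule inj_onD[OF inj]) (use * x0 am in auto)
    ultimately show "model_dist g (\<phi> s w) b = model_dist g w a'"
      using iso(2)[OF w am[of "x - x0"]] sh[of "x - x0"] by simp
  qed
  show ?thesis
  proof (rule ccontr)
    assume neg: "\<not> ?thesis"
    then have im: "Im (\<Phi> z) \<noteq> 0" using two[OF z] by (auto simp: complex_eq_iff)
    obtain D where D: "(\<phi> s has_derivative D) (at z)" "cross2 (D 1) (D \<i>) > 0"
      using op z unfolding orientation_preserving_on_def by blast
    have "isCont (\<lambda>w. \<Phi> (\<phi> s w)) z"
      by (rule isCont_o2[OF has_derivative_continuous[OF D(1)] DERIV_isCont[OF deriv[OF iso(1)[OF z]]]])
    then have cont: "isCont (\<lambda>w. \<Phi> (\<phi> s w) - (\<Phi> w + of_real s)) z"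
      by (intro continuous_diff continuous_add continuous_const DERIV_isCont[OF deriv[OF z]])
    have conj: "cnj (\<Phi> w + of_real s) = \<Phi> (\<phi> s w)"
      if "\<Phi> (\<phi> s w) - (\<Phi> w + of_real s) \<noteq> 0" "w \<in> model_plane g" for w
      using two[OF that(2)] that(1) by (elim disjE) simp_all
    \<comment> \<open>Failure of the first alternative is an open condition, so the second one holds
      all around \<open>z\<close> and can be differentiated.\<close>
    have "eventually (\<lambda>w. \<Phi> (\<phi> s w) - (\<Phi> w + of_real s) \<noteq> 0) (at z)"
      by (rule tendsto_imp_eventually_ne[OF cont[unfolded isCont_def]]) (use neg in simp)
    moreover have "eventually (\<lambda>w. w \<in> model_plane g) (at z)"
      using z open_model_plane by (rule eventually_at_in_open'[rotated])
    ultimately have ev: "eventually (\<lambda>w. cnj (\<Phi> w + of_real s) = \<Phi> (\<phi> s w)) (at z)"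
      by eventually_elim (rule conj)
    have evz: "cnj (\<Phi> z + of_real s) = \<Phi> (\<phi> s z)" by (rule conj) (use neg z in simp_all)
    let ?k = "deriv \<Phi> z" and ?m = "deriv \<Phi> (\<phi> s z)"
    have "((\<lambda>w. \<Phi> w + of_real s) has_derivative (*) ?k) (at z)"
      using deriv[OF z] unfolding has_field_derivative_def by (auto intro!: derivative_eq_intros)
    then have dc: "((\<lambda>w. cnj (\<Phi> w + of_real s)) has_derivative (\<lambda>h. cnj (?k * h))) (at z)"
      by (rule has_derivative_cnj)
    have "((\<lambda>w. \<Phi> (\<phi> s w)) has_derivative (\<lambda>h. cnj (?k * h))) (at z)"
      by (rule has_derivative_transform_eventually[OF dc ev evz UNIV_I])
    from orientation_compose[OF D(1) deriv[OF iso(1)[OF z], unfolded has_field_derivative_def] this]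
    have "cross2 (cnj (?k * 1)) (cnj (?k * \<i>)) = cross2 (?m * 1) (?m * \<i>) * cross2 (D 1) (D \<i>)" .
    then have "- (cmod ?k)\<^sup>2 = (cmod ?m)\<^sup>2 * cross2 (D 1) (D \<i>)"
      unfolding cross2_cnj cross2_mult by simp
    moreover have "(cmod ?m)\<^sup>2 * cross2 (D 1) (D \<i>) \<ge> 0" using D(2) by simp
    moreover have "(cmod ?k)\<^sup>2 > 0" using deriv_nonzero[OF z] by simp
    ultimately show False by linarith
  qed
qed

text \<open>Differentiate \<open>\<Phi> (\<phi> s z) = \<Phi> z + of_real s\<close> at
  \<open>s = 0\<close>. In particular \<open>X\<close> does not depend on the axis and the group
  behind it.\<close>

lemma generating_field_coordinate:
  assumes "generating_field g T X" "z \<in> model_plane g"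
  shows "X z * deriv \<Phi> z = 1"
proof -
  obtain a \<phi> where a: "directed_axis g T a" "translation_group g a \<phi>"
    and X: "((\<lambda>s. \<phi> s z) has_vector_derivative X z) (at 0)"
    using assms unfolding generating_field_def by blast
  note co = translation_coordinate[OF a assms(2)]
  have "\<phi> 0 z \<in> model_plane g"
    using a(2) assms(2) model_isometry_in unfolding translation_group_def by blast
  \<comment> \<open>That \<open>\<phi> 0\<close> is the identity is not part of
    \<open>translation_group\<close>; the coordinate and injectivity of \<Phi> give it.\<close>
  then have z0: "\<phi> 0 z = z" using co[of 0] inj_onD[OF inj _ _ assms(2)] by simp
  have "((\<lambda>s. \<Phi> (\<phi> s z)) has_vector_derivative X z * deriv \<Phi> z) (at 0)"
    by (rule has_vector_derivative_compose[OF assms(2) X z0])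
  moreover have "((\<lambda>s. \<Phi> (\<phi> s z)) has_vector_derivative 1) (at 0)"
    unfolding co by (auto intro!: derivative_eq_intros)
  ultimately show ?thesis by (rule vector_derivative_unique_at)
qed

text \<open>Pulls the horizontal shifts of \<open>R\<close> back by the inverse of \<Phi>. This is
  half of showing that the union defining the winding number is not empty.\<close>

lemma generating_field_exists: "generating_field g T (\<lambda>z. 1 / deriv \<Phi> z)"
proof -
  obtain \<Psi> where \<Psi>: "\<Psi> holomorphic_on (\<Phi> ` model_plane g)"
    "\<And>z. z \<in> model_plane g \<Longrightarrow> deriv \<Phi> z * deriv \<Psi> (\<Phi> z) = 1"
    "\<And>z. z \<in> model_plane g \<Longrightarrow> \<Psi> (\<Phi> z) = z"
    using holomorphic_has_inverse[OF holo open_model_plane inj] by blast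
  have R: "\<Phi> ` model_plane g = R" using bij by (rule bij_betw_imp_surj_on)
  have oR: "open R" using open_mapping_thm3[OF holo open_model_plane inj] R by simp
  have \<Psi>R: "\<Psi> w \<in> model_plane g" "\<Phi> (\<Psi> w) = w" if "w \<in> R" for w
    using that \<Psi>(3) R by force+
  have d\<Psi>: "(\<Psi> has_field_derivative deriv \<Psi> w) (at w)" if "w \<in> R" for w
    using holomorphic_derivI[OF \<Psi>(1)[unfolded R] oR that] .
  have \<Phi>R: "\<Phi> z \<in> R" if "z \<in> model_plane g" for z using R that by blast
  define a where "a s = \<Psi> (of_real s)" for s
  define \<phi> where "\<phi> s z = \<Psi> (\<Phi> z + of_real s)" for s z
  have a: "a s \<in> model_plane g" "\<Phi> (a s) = of_real s" for s
    using \<Psi>R[OF real_in] by (auto simp: a_def)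
  have \<phi>: "\<phi> s z \<in> model_plane g" "\<Phi> (\<phi> s z) = \<Phi> z + of_real s" if "z \<in> model_plane g" for s z
    using \<Psi>R[OF shift_in[OF \<Phi>R[OF that]]] by (auto simp: \<phi>_def)
  have eqI: "z = w" if "z \<in> model_plane g" "w \<in> model_plane g" "\<Phi> z = \<Phi> w" for z w
    using inj_onD[OF inj that(3,1,2)] .
  have "directed_axis g T a"
    unfolding directed_axis_def
  proof (intro conjI allI exI[of _ l])
    show "range a \<subseteq> model_plane g" using a by auto
    show "model_dist g (a s) (a t) = \<bar>s - t\<bar>" for s t using axis_dist a by blast
    show "T (a s) = a (s + l)" for s by (rule eqI) (use glide a in auto)
  qed (rule l_pos)
  moreover have "translation_group g a \<phi>"
    unfolding translation_group_def
  proof (intro conjI allI ballI)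
    fix s t z
    show "\<phi> s (a t) = a (s + t)" by (rule eqI) (use a \<phi> in auto)
    show "\<phi> (s + t) z = \<phi> s (\<phi> t z)" if "z \<in> model_plane g" 
      by (rule eqI[OF \<phi>(1)[OF that] \<phi>(1)[OF \<phi>(1)[OF that]]])
        (simp add: \<phi>(2)[OF that] \<phi>(2)[OF \<phi>(1)[OF that]])
    show "model_isometry g (\<phi> s)"
      unfolding model_isometry_def
    proof (intro conjI ballI)
      show "bij_betw (\<phi> s) (model_plane g) (model_plane g)"
      proof (rule bij_betw_byWitness[where f' = "\<phi> (- s)"])
        have "\<phi> r (\<phi> (- r) z) = z" if "z \<in> model_plane g" for r z
          by (rule eqI[OF \<phi>(1)[OF \<phi>(1)[OF that]] that])
            (simp add: \<phi>(2)[OF that] \<phi>(2)[OF \<phi>(1)[OF that]])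
        from this[of _ s] this[of _ "- s"]
        show "\<forall>z\<in>model_plane g. \<phi> (- s) (\<phi> s z) = z" "\<forall>z\<in>model_plane g. \<phi> s (\<phi> (- s) z) = z" by auto
      qed (use \<phi>(1) in auto)
      show "model_dist g (\<phi> s z) (\<phi> s w) = model_dist g z w"
        if "z \<in> model_plane g" "w \<in> model_plane g" for z w
        using shift_dist[OF that \<phi>(1)[OF that(1)] \<phi>(1)[OF that(2)]] \<phi>(2) that by blast
    qed
    show "orientation_preserving_on (model_plane g) (\<phi> s)"
      unfolding orientation_preserving_on_def
    proof
      fix z assume z: "z \<in> model_plane g"
      let ?k = "deriv \<Psi> (\<Phi> z + of_real s) * deriv \<Phi> z"
      have "((\<lambda>z. \<Phi> z + of_real s) has_field_derivative deriv \<Phi> z) (at z)"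
        using deriv[OF z] by (auto intro!: derivative_eq_intros)
      from DERIV_chain2[OF d\<Psi>[OF shift_in[OF \<Phi>R[OF z]]] this]
      have d: "(\<phi> s has_field_derivative ?k) (at z)" unfolding \<phi>_def .
      have "deriv \<Psi> (\<Phi> z + of_real s) \<noteq> 0" using \<Psi>(2)[OF \<phi>(1)[OF z, of s]] \<phi>(2)[OF z] by auto
      then have "?k \<noteq> 0" using deriv_nonzero[OF z] by simp
      then have "cross2 (?k * 1) (?k * \<i>) > 0" unfolding cross2_mult by simp
      then show "\<exists>D. (\<phi> s has_derivative D) (at z) \<and> cross2 (D 1) (D \<i>) > 0"
        using d unfolding has_field_derivative_def by blast
    qed
  qed
  moreover have "((\<lambda>s. \<phi> s z) has_vector_derivative 1 / deriv \<Phi> z) (at 0)" if z: "z \<in> model_plane g" for z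
  proof -
    have "((\<lambda>s. \<Phi> z + of_real s) has_vector_derivative 1) (at 0)" by (auto intro!: derivative_eq_intros)
    from field_vector_diff_chain_at[OF this, of \<Psi> "deriv \<Psi> (\<Phi> z)"] d\<Psi>[OF \<Phi>R[OF z]]
    have "((\<lambda>s. \<phi> s z) has_vector_derivative deriv \<Psi> (\<Phi> z)) (at 0)" by (simp add: o_def \<phi>_def)
    moreover have "deriv \<Psi> (\<Phi> z) = 1 / deriv \<Phi> z"
      using \<Psi>(2)[OF z] deriv_nonzero[OF z] by (simp add: field_simps)
    ultimately show ?thesis by simp
  qed
  ultimately show ?thesis unfolding generating_field_def by blast
qed

end

section \<open>Glide reflections of the euclidean plane\<close>

lemma real_line_isometry:
  fixes f :: "real \<Rightarrow> real"
  assumes "\<And>s t. \<bar>f s - f t\<bar> = \<bar>s - t\<bar>" "k > 0" "f k > f 0"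
  shows "f s = f 0 + s"
proof -
  \<comment> \<open>The distances from \<open>f 0\<close> and from \<open>f k\<close> together
    locate \<open>f s\<close> on the line.\<close>
  have "f k = f 0 + k" using assms(1)[of k 0] assms(2,3) by simp
  then show ?thesis using assms(1)[of s 0] assms(1)[of s k] assms(2)
    by (cases "f s \<ge> f 0"; cases "f s \<ge> f 0 + k"; cases "s \<ge> 0"; cases "s \<ge> k") simp_all
qed

text \<open>A square root \<open>\<eta>\<close> of \<open>\<alpha>\<close> spans the direction of
  the axis, since \<open>\<alpha> * cnj \<eta> = \<eta>\<close>. In the frame turned by it, the
  component of \<open>w0\<close> along the axis is nonzero for lack of fixed points, and the
  perpendicular component is absorbed by moving the origin onto the axis.\<close>

lemma euclidean_straightening:
  assumes eq: "\<And>z. T z = w0 + \<alpha> * cnj z" and \<alpha>: "cmod \<alpha> = 1" and free: "\<And>z. T z \<noteq> z"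
  shows "\<exists>\<Phi> l R. straightening Euclidean T \<Phi> l R"
proof -
  define \<eta> where "\<eta> = csqrt \<alpha>"
  have \<eta>: "\<eta> * \<eta> = \<alpha>" by (simp add: \<eta>_def flip: power2_eq_square)
  have "(cmod \<eta>)\<^sup>2 = 1" using \<alpha> \<eta> by (metis norm_mult power2_eq_square)
  then have n: "cmod \<eta> = 1" by (simp add: power2_eq_1_iff) (metis norm_ge_zero not_one_le_zero neg_0_le_iff_le)
  have \<eta>1: "\<eta> * cnj \<eta> = 1" using n by (simp add: complex_norm_square[symmetric])
  define l where "l = Re (cnj \<eta> * w0)"
  have "l \<noteq> 0"
  proof
    assume "l = 0"
    then have i: "cnj \<eta> * w0 = \<i> * of_real (Im (cnj \<eta> * w0))" by (simp add: l_def complex_eq_iff)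
    \<comment> \<open>Half the perpendicular displacement: with no component along the axis,
      \<open>\<eta> * (\<i> * of_real y)\<close> would be fixed.\<close>
    define y where "y = Im (cnj \<eta> * w0) / 2"
    have w0: "w0 = \<eta> * (2 * \<i> * of_real y)"
    proof -
      have "w0 = (\<eta> * cnj \<eta>) * w0" using \<eta>1 by simp
      also have "\<dots> = \<eta> * (cnj \<eta> * w0)" by (simp only: mult.assoc)
      also have "\<dots> = \<eta> * (2 * \<i> * of_real y)" by (subst i) (simp add: y_def)
      finally show ?thesis .
    qed
    have *: "\<alpha> * cnj (\<eta> * (\<i> * of_real y)) = - (\<eta> * cnj \<eta>) * (\<eta> * (\<i> * of_real y))"
      unfolding \<eta>[symmetric] by (simp add: mult_ac)
    then have "T (\<eta> * (\<i> * of_real y)) = \<eta> * (\<i> * of_real y)"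
      unfolding eq w0 * \<eta>1 by (simp add: algebra_simps)
    then show False using free by blast
  qed
  \<comment> \<open>The sign of the square root is chosen so that the glide moves in the positive
    direction.\<close>
  define \<zeta> where "\<zeta> = (if l > 0 then \<eta> else - \<eta>)"
  define m where "m = \<bar>l\<bar>"
  have m: "m > 0" using \<open>l \<noteq> 0\<close> by (simp add: m_def)
  have \<zeta>: "\<zeta> * \<zeta> = \<alpha>" "cmod \<zeta> = 1" "\<zeta> * cnj \<zeta> = 1" "m = Re (cnj \<zeta> * w0)"
    using \<eta> n \<eta>1 by (auto simp: \<zeta>_def m_def l_def)
  define y where "y = Im (cnj \<zeta> * w0) / 2"
  define \<Phi> where "\<Phi> z = cnj \<zeta> * z - \<i> * of_real y" for z
  have d: "cmod (\<Phi> z - \<Phi> w) = cmod (z - w)" for z w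
  proof -
    have "\<Phi> z - \<Phi> w = cnj \<zeta> * (z - w)" by (simp add: \<Phi>_def algebra_simps)
    then show ?thesis using \<zeta>(2) by (simp add: norm_mult)
  qed
  have glide: "\<Phi> (T z) = cnj (\<Phi> z) + of_real m" for z
  proof -
    have *: "cnj \<zeta> * (\<alpha> * cnj z) = (\<zeta> * cnj \<zeta>) * (\<zeta> * cnj z)" unfolding \<zeta>(1)[symmetric] by (simp add: mult_ac)
    have "\<Phi> (T z) = cnj \<zeta> * w0 + \<zeta> * cnj z - \<i> * of_real y"
      unfolding \<Phi>_def eq distrib_left * \<zeta>(3) by simp
    moreover have "cnj \<zeta> * w0 = of_real m + 2 * \<i> * of_real y"
      unfolding \<zeta>(4) y_def by (simp add: complex_eq_iff)
    ultimately show ?thesis by (simp add: \<Phi>_def)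
  qed
  have "straightening Euclidean T \<Phi> m UNIV"
  proof
    show "\<Phi> holomorphic_on model_plane Euclidean"
      unfolding \<Phi>_def by (intro holomorphic_intros)
    show "bij_betw \<Phi> (model_plane Euclidean) UNIV"
      by (rule bij_betw_byWitness[where f' = "\<lambda>w. \<zeta> * (w + \<i> * of_real y)"])
        (use \<zeta>(3) in \<open>auto simp: \<Phi>_def mult.assoc[symmetric] mult.commute[of "cnj \<zeta>"]\<close>)
    show "model_dist Euclidean z' w' = model_dist Euclidean z w"
      if "\<Phi> z' = \<Phi> z + of_real s" "\<Phi> w' = \<Phi> w + of_real s" for z w z' w' s
      using d[of z' w'] d[of z w] that by (simp add: dist_norm)
    show "model_dist Euclidean z w = \<bar>x - y\<bar>" if "\<Phi> z = of_real x" "\<Phi> w = of_real y" for z w x y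
      using d[of z w] that by (simp add: dist_norm flip: of_real_diff)
    show "\<exists>x. \<forall>s. \<Phi> (a s) = of_real (x + s)"
      if iso: "\<And>s t. model_dist Euclidean (a s) (a t) = \<bar>s - t\<bar>" and k: "k > 0" "\<And>s. T (a s) = a (s + k)" for a k
    proof -
      have da: "cmod (\<Phi> (a s) - \<Phi> (a t)) = \<bar>s - t\<bar>" for s t using iso[of s t] by (simp add: d dist_norm)
      have \<Phi>k: "\<Phi> (a (s + k)) = cnj (\<Phi> (a s)) + of_real m" for s using glide[of "a s"] k(2)[of s] by simp
      \<comment> \<open>Two glide steps cancel the reflection and move by \<open>2 * m\<close>,
        hence \<open>k = m\<close>. A single step of length \<open>m\<close> then leaves no room for
        an imaginary part.\<close>
      have "\<Phi> (a (0 + k + k)) - \<Phi> (a 0) = of_real (2 * m)"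
        unfolding \<Phi>k[of "0 + k"] \<Phi>k[of 0] by simp
      then have "\<bar>2 * m\<bar> = \<bar>0 + k + k - 0\<bar>" using da[of "0 + k + k" 0] by (metis norm_of_real)
      then have km: "k = m" using m k(1) by simp
      have re: "\<Phi> (a s) = of_real (Re (\<Phi> (a s)))" for s
      proof -
        have "(cmod (\<Phi> (a (s + k)) - \<Phi> (a s)))\<^sup>2 = m\<^sup>2" using da[of "s + k" s] km by simp
        then have "(2 * Im (\<Phi> (a s)))\<^sup>2 = 0"
          unfolding \<Phi>k[of s] cmod_power2 by (simp add: power2_eq_square)
        then show ?thesis by (simp add: complex_eq_iff)
      qed
      have iso: "\<bar>Re (\<Phi> (a s)) - Re (\<Phi> (a t))\<bar> = \<bar>s - t\<bar>" for s t
        using da[of s t] re by (metis norm_of_real of_real_diff)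
      have "Re (\<Phi> (a k)) > Re (\<Phi> (a 0))" using \<Phi>k[of 0] m by simp
      then have H: "Re (\<Phi> (a s)) = Re (\<Phi> (a 0)) + s" for s
        by (rule real_line_isometry[where f = "\<lambda>s. Re (\<Phi> (a s))", OF iso k(1)])
      have "\<Phi> (a s) = of_real (Re (\<Phi> (a 0)) + s)" for s using re[of s] unfolding H[of s] .
      then show ?thesis by blast
    qed
    show "\<Phi> w = \<Phi> z + of_real s \<or> \<Phi> w = cnj (\<Phi> z) + of_real s"
      if *: "\<And>x a b. a \<in> model_plane Euclidean \<Longrightarrow> b \<in> model_plane Euclidean \<Longrightarrow> \<Phi> a = of_real x \<Longrightarrow>
        \<Phi> b = of_real (x + s) \<Longrightarrow> model_dist Euclidean w b = model_dist Euclidean z a" for z w s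
    proof -
      define u v where "u = \<Phi> w - of_real s" and "v = \<Phi> z"
      have e: "(cmod (u - of_real x))\<^sup>2 = (cmod (v - of_real x))\<^sup>2" for x
      proof -
        have inv: "\<Phi> (\<zeta> * (t + \<i> * of_real y)) = t" for t
          using \<zeta>(3) by (simp add: \<Phi>_def mult.assoc[symmetric] mult.commute[of "cnj \<zeta>"])
        have "cmod (\<Phi> w - of_real (x + s)) = cmod (\<Phi> z - of_real x)"
          using *[OF _ _ inv[of "of_real x"] inv[of "of_real (x + s)"]]
            d[of w "\<zeta> * (of_real (x + s) + \<i> * of_real y)"] d[of z "\<zeta> * (of_real x + \<i> * of_real y)"]
          by (simp only: inv dist_norm model_dist.simps model_plane.simps UNIV_I)
        then show ?thesis by (simp add: u_def v_def algebra_simps)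
      qed
      \<comment> \<open>Distances from the axis points \<open>0\<close> and \<open>1\<close>
        determine the real part; one of them then gives the imaginary part up to sign.\<close>
      have re: "Re u = Re v" using e[of 0] e[of 1] unfolding cmod_power2 by (simp add: power2_eq_square algebra_simps)
      then have "(Im u)\<^sup>2 = (Im v)\<^sup>2" using e[of 0] unfolding cmod_power2 by simp
      then have "u = v \<or> u = cnj v" using re by (auto simp: power2_eq_iff complex_eq_iff)
      then show ?thesis unfolding u_def v_def by (auto simp: algebra_simps)
    qed
  qed (use glide m in auto)
  then show ?thesis by blast
qed

section \<open>Real Moebius transformations and the normal form of a hyperbolic glide
  reflection\<close>

definition real_moebius :: "real \<Rightarrow> real \<Rightarrow> real \<Rightarrow> real \<Rightarrow> complex \<Rightarrow> complex" where
  "real_moebius a b c d z = (of_real a * z + of_real b) / (of_real c * z + of_real d)"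

lemma real_linear_nonzero:
  assumes "Im z \<noteq> 0" "c \<noteq> 0 \<or> d \<noteq> 0"
  shows "of_real c * z + of_real d \<noteq> 0"
proof
  assume "of_real c * z + of_real d = 0"
  then have "Re (of_real c * z + of_real d) = 0" "Im (of_real c * z + of_real d) = 0" by simp_all
  then show False using assms by auto
qed

context
  fixes a b c d :: real
  assumes det: "a * d - b * c > 0"
begin

lemma real_moebius_denom: "Im z \<noteq> 0 \<Longrightarrow> of_real c * z + of_real d \<noteq> 0"
  using det by (intro real_linear_nonzero) auto

lemma Im_real_moebius:
  assumes "Im z \<noteq> 0"
  shows "Im (real_moebius a b c d z) = (a * d - b * c) * Im z / (cmod (of_real c * z + of_real d))\<^sup>2"
  unfolding real_moebius_def Im_divide' cmod_power2
  by (rule arg_cong2[where f = "(/)"]) (simp_all add: algebra_simps)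

lemma real_moebius_upper: "Im z > 0 \<Longrightarrow> Im (real_moebius a b c d z) > 0"
  using det real_moebius_denom[of z] by (simp add: Im_real_moebius)

lemma real_moebius_dist:
  assumes "Im z > 0" "Im w > 0"
  shows "model_dist Hyperbolic (real_moebius a b c d z) (real_moebius a b c d w) = model_dist Hyperbolic z w"
proof -
  define p q where "p = of_real c * z + of_real d" and "q = of_real c * w + of_real d"
  have pq: "p \<noteq> 0" "q \<noteq> 0" using real_moebius_denom assms by (auto simp: p_def q_def)
  have "real_moebius a b c d z - real_moebius a b c d w = of_real (a * d - b * c) * (z - w) / (p * q)"
    using pq unfolding real_moebius_def p_def q_def by (simp add: diff_frac_eq algebra_simps)
  then have n: "cmod (real_moebius a b c d z - real_moebius a b c d w) =
      (a * d - b * c) * cmod (z - w) / (cmod p * cmod q)"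
    using det by (simp only: norm_mult norm_divide norm_of_real abs_of_pos)
  have "(cmod (real_moebius a b c d z - real_moebius a b c d w))\<^sup>2 /
      (2 * Im (real_moebius a b c d z) * Im (real_moebius a b c d w)) = (cmod (z - w))\<^sup>2 / (2 * Im z * Im w)"
  proof -
    have "((e * x / (P * Q))\<^sup>2) / (2 * (e * y / P\<^sup>2) * (e * y' / Q\<^sup>2)) = x\<^sup>2 / (2 * y * y')"
      if "e \<noteq> 0" "P \<noteq> 0" "Q \<noteq> 0" for e x y y' P Q :: real
      using that by (simp add: power_mult_distrib power_divide field_simps) (simp add: power2_eq_square)
    then show ?thesis using det pq assms
      unfolding n by (simp add: Im_real_moebius p_def[symmetric] q_def[symmetric])
  qed
  then show ?thesis by simp
qed

lemma real_moebius_inverse: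
  assumes "Im z > 0"
  shows "real_moebius d (- b) (- c) a (real_moebius a b c d z) = z"
proof -
  have n: "of_real c * z + of_real d \<noteq> 0" using real_moebius_denom assms by simp
  have e: "complex_of_real (a * d - b * c) \<noteq> 0" using det by (metis less_irrefl of_real_eq_0_iff)
  have "of_real d * real_moebius a b c d z + of_real (- b) =
      of_real (a * d - b * c) * z / (of_real c * z + of_real d)"
    using n unfolding real_moebius_def by (simp add: field_simps)
  moreover have "of_real (- c) * real_moebius a b c d z + of_real a =
      of_real (a * d - b * c) / (of_real c * z + of_real d)"
    using n unfolding real_moebius_def by (simp add: field_simps)
  ultimately show ?thesis using n e unfolding real_moebius_def[of d] by simp
qed

lemma real_moebius_holomorphic: "real_moebius a b c d holomorphic_on {z. Im z > 0}"
  unfolding real_moebius_def using real_moebius_denom by (intro holomorphic_intros) auto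

end

text \<open>Near \<open>\<i>\<close> the conjugating case of
  \<open>hyperbolic_isometry_cases\<close> must hold because \<open>T\<close> reverses orientation.
  Solved for \<open>T z\<close> it is a Moebius expression in \<open>cnj z\<close>, and the identity
  theorem, applied to the holomorphic function \<open>cnj (T z)\<close>, extends it to the
  half-plane.\<close>

lemma hyperbolic_reversing_form:
  assumes "universal_covering Hyperbolic M p" "deck_transformation Hyperbolic p T"
    and rev: "orientation_reversing_on (model_plane Hyperbolic) T"
  obtains a b c d :: real where "a * d - b * c < 0" "\<And>z. Im z > 0 \<Longrightarrow> T z = real_moebius a b c d (cnj z)"
proof -
  let ?H = "model_plane Hyperbolic"
  have i: "\<i> \<in> ?H" by simp
  obtain r where r: "r > 0" "ball \<i> r \<subseteq> ?H"
    "\<And>x y. x \<in> ball \<i> r \<Longrightarrow> y \<in> ball \<i> r \<Longrightarrow> model_dist Hyperbolic (T x) (T y) = model_dist Hyperbolic x y"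
    using deck_locally_isometric[OF assms(1,2) i] by blast
  define w0 where "w0 = T \<i>"
  have H: "Im z > 0" "Im (T z) > 0" if "z \<in> ball \<i> r" for z
    using r(2) that deck_in_model[OF assms(2)] by force+
  have ib: "\<i> \<in> ball \<i> r" using r(1) by simp
  have w0: "Im w0 > 0" using H[OF ib] by (simp add: w0_def)
  obtain \<alpha> where \<alpha>: "cmod \<alpha> = 1" "(\<forall>z\<in>ball \<i> r. cayley w0 (T z) = \<alpha> * cayley \<i> z) \<or>
      (\<forall>z\<in>ball \<i> r. cayley w0 (T z) = \<alpha> * cnj (cayley \<i> z))"
    using hyperbolic_isometry_cases[of "ball \<i> r" T, OF H ib r(3)] unfolding w0_def by blast
  have anti: "cayley w0 (T z) = \<alpha> * cnj (cayley \<i> z)" if y: "z \<in> ball \<i> r" for z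
  proof (rule ccontr)
    assume bad: "\<not> ?thesis"
    have *: "cayley w0 (T z) = \<alpha> * cayley \<i> z" if "z \<in> ball \<i> r" for z
      using \<alpha>(2) that bad y by blast
    have f: "1 - \<alpha> * cayley \<i> z \<noteq> 0" "T z = (w0 - cnj w0 * (\<alpha> * cayley \<i> z)) / (1 - \<alpha> * cayley \<i> z)"
      if "z \<in> ball \<i> r" for z
      using cayley_inverse[OF w0 H(2)[OF that]] *[OF that] by auto
    have "cayley \<i> holomorphic_on ball \<i> r"
      unfolding cayley_def using cayley_denom[of \<i>] H(1) by (intro holomorphic_intros) auto
    then have "(\<lambda>z. (w0 - cnj w0 * (\<alpha> * cayley \<i> z)) / (1 - \<alpha> * cayley \<i> z)) holomorphic_on ball \<i> r"
      using f(1) by (intro holomorphic_intros) auto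
    then have "T holomorphic_on ball \<i> r"
      using f(2) holomorphic_cong[OF refl, of "ball \<i> r" T] by auto
    then have d: "(T has_field_derivative deriv T \<i>) (at \<i>)" using holomorphic_derivI[OF _ open_ball ib] by blast
    obtain D where "(T has_derivative D) (at \<i>)" "cross2 (D 1) (D \<i>) < 0"
      using rev i unfolding orientation_reversing_on_def by blast
    then show False using field_derivative_positive[OF d] by (metis not_less zero_le_power2)
  qed
  define \<eta> where "\<eta> = csqrt \<alpha>"
  have \<eta>: "\<eta> * \<eta> = \<alpha>" by (simp add: \<eta>_def flip: power2_eq_square)
  then have "(cmod \<eta>)\<^sup>2 = 1" using \<alpha>(1) by (metis norm_mult power2_eq_square)
  then have n2: "(Re \<eta>)\<^sup>2 + (Im \<eta>)\<^sup>2 = 1" by (simp add: cmod_power2)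
  then have \<eta>1: "\<eta> * cnj \<eta> = 1" by (simp add: complex_mult_cnj)
  \<comment> \<open>After clearing denominators, multiplication by \<open>cnj \<eta>\<close> makes
    both sides \<open>2 * \<i>\<close> times a form with real coefficients in \<open>cnj z\<close>;
    these are the coefficients.\<close>
  define a b c d where "a = Im (w0 * cnj \<eta>)" and "b = - Re (w0 * cnj \<eta>)" and "c = - Im \<eta>" and "d = - Re \<eta>"
  have "a * d - b * c = - Im w0 * ((Re \<eta>)\<^sup>2 + (Im \<eta>)\<^sup>2)"
    unfolding a_def b_def c_def d_def by (simp add: algebra_simps power2_eq_square)
  then have det: "a * d - b * c < 0" using w0 n2 by simp
  then have cd: "c \<noteq> 0 \<or> d \<noteq> 0" by auto
  have eq: "T z = real_moebius a b c d (cnj z)" if z: "z \<in> ball \<i> r" for z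
  proof -
    define u where "u = cnj z"
    have ui: "u - \<i> \<noteq> 0" using H(1)[OF z] by (auto simp: u_def complex_eq_iff)
    have den: "of_real c * u + of_real d \<noteq> 0"
      by (rule real_linear_nonzero) (use H(1)[OF z] cd in \<open>auto simp: u_def\<close>)
    have cc: "cnj (cayley \<i> z) = (u + \<i>) / (u - \<i>)" by (simp add: cayley_def u_def)
    have "1 - \<alpha> * ((u + \<i>) / (u - \<i>)) \<noteq> 0"
      "T z = (w0 - cnj w0 * (\<alpha> * ((u + \<i>) / (u - \<i>)))) / (1 - \<alpha> * ((u + \<i>) / (u - \<i>)))"
      using cayley_inverse[OF w0 H(2)[OF z]] unfolding anti[OF z] cc by auto
    then have "T z * (1 - \<alpha> * ((u + \<i>) / (u - \<i>))) = w0 - cnj w0 * (\<alpha> * ((u + \<i>) / (u - \<i>)))"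
      by (simp add: field_simps)
    then have "T z * ((1 - \<alpha> * ((u + \<i>) / (u - \<i>))) * (u - \<i>)) = (w0 - cnj w0 * (\<alpha> * ((u + \<i>) / (u - \<i>)))) * (u - \<i>)"
      by (simp only: mult.assoc[symmetric])
    then have "T z * ((u - \<i>) - \<alpha> * (u + \<i>)) = w0 * (u - \<i>) - cnj w0 * (\<alpha> * (u + \<i>))"
      using ui by (simp add: left_diff_distrib)
    note E = this
    have cm: "cnj \<eta> * (\<alpha> * x) = \<eta> * x" for x
    proof -
      have "cnj \<eta> * (\<alpha> * x) = (\<eta> * cnj \<eta>) * (\<eta> * x)" unfolding \<eta>[symmetric] by (simp add: mult_ac)
      then show ?thesis by (simp add: \<eta>1)
    qed
    have "T z * (cnj \<eta> * (u - \<i>) - \<eta> * (u + \<i>)) = T z * (cnj \<eta> * (u - \<i>) - cnj \<eta> * (\<alpha> * (u + \<i>)))"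
      by (simp only: cm)
    also have "\<dots> = cnj \<eta> * (T z * ((u - \<i>) - \<alpha> * (u + \<i>)))"
      by (simp only: right_diff_distrib[symmetric] mult.left_commute[of _ "cnj \<eta>"])
    also have "\<dots> = cnj \<eta> * (w0 * (u - \<i>)) - cnj w0 * (cnj \<eta> * (\<alpha> * (u + \<i>)))"
      unfolding E by (simp only: right_diff_distrib mult.left_commute[of "cnj \<eta>"])
    also have "\<dots> = w0 * cnj \<eta> * (u - \<i>) - cnj w0 * (\<eta> * (u + \<i>))"
      unfolding cm by (simp only: mult.assoc mult.left_commute[of "cnj \<eta>"])
    finally have "T z * (cnj \<eta> * (u - \<i>) - \<eta> * (u + \<i>)) = w0 * cnj \<eta> * (u - \<i>) - cnj w0 * (\<eta> * (u + \<i>))" .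
    moreover have "cnj \<eta> * (u - \<i>) - \<eta> * (u + \<i>) = 2 * \<i> * (of_real c * u + of_real d)"
      unfolding c_def d_def by (simp add: complex_eq_iff algebra_simps)
    moreover have "w0 * cnj \<eta> * (u - \<i>) - cnj w0 * (\<eta> * (u + \<i>)) = 2 * \<i> * (of_real a * u + of_real b)"
      unfolding a_def b_def by (simp add: complex_eq_iff algebra_simps)
    ultimately have "T z * (2 * \<i> * (of_real c * u + of_real d)) = 2 * \<i> * (of_real a * u + of_real b)"
      by (simp only:)
    then have "(2 * \<i>) * (T z * (of_real c * u + of_real d)) = (2 * \<i>) * (of_real a * u + of_real b)"
      by (simp only: mult.left_commute[of "T z"])
    then have "T z * (of_real c * u + of_real d) = of_real a * u + of_real b"
      by (subst (asm) mult_cancel_left) simp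
    then show ?thesis using den by (simp add: real_moebius_def u_def field_simps)
  qed
  have cT: "cnj (T z) = real_moebius a b c d z" if "Im z > 0" for z
  proof (rule analytic_continuation_open[of "ball \<i> r" ?H "\<lambda>z. cnj (T z)" "real_moebius a b c d"])
    show "real_moebius a b c d holomorphic_on ?H"
      unfolding real_moebius_def using real_linear_nonzero[OF _ cd] by (intro holomorphic_intros) auto
    show "(\<lambda>z. cnj (T z)) holomorphic_on ?H" using deck_antiholomorphic[OF assms] .
    show "connected ?H" using convex_model_plane convex_connected by blast
    show "cnj (T z) = real_moebius a b c d z" if "z \<in> ball \<i> r" for z
      unfolding eq[OF that] by (simp add: real_moebius_def)
    show "open ?H" by (rule open_model_plane)
  qed (use r(1,2) that in auto)
  have "T z = real_moebius a b c d (cnj z)" if "Im z > 0" for z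
  proof -
    have "cnj (cnj (T z)) = cnj (real_moebius a b c d z)" using cT[OF that] by (rule arg_cong)
    then show ?thesis by (simp add: real_moebius_def)
  qed
  with det show ?thesis by (rule that)
qed

text \<open>The two ends of the axis are the fixed points of the reflection on the boundary; they are
  real or infinite because the discriminant of their equation is positive, and \<open>K\<close> moves them to
  \<open>0\<close> and infinity.\<close>

lemma diagonalize_reversing:
  assumes det: "a * d - b * c < 0" and T: "\<And>z. Im z > 0 \<Longrightarrow> T z = real_moebius a b c d (cnj z)"
    and up: "\<And>z. Im z > 0 \<Longrightarrow> Im (T z) > 0"
  obtains A B C D \<mu> :: real where "A * D - B * C > 0"
    "\<And>z. Im z > 0 \<Longrightarrow> real_moebius A B C D (T z) = of_real \<mu> * cnj (real_moebius A B C D z)"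
proof (cases "c = 0")
  case True
  have ad: "a * d < 0" using det True by simp
  then have nz: "d \<noteq> 0" "a \<noteq> d" by (auto simp: mult_less_0_iff)
  \<comment> \<open>One end of the axis is infinity here; \<open>x\<close> is the other one, the
    solution of \<open>a * x + b = d * x\<close>.\<close>
  define x where "x = b / (d - a)"
  have bx: "b - x * d = - a * x" using nz by (simp add: x_def field_simps)
  show ?thesis
  proof (rule that[of 1 1 "- x" 0 "a / d"])
    fix z assume z: "Im z > 0"
    have "T z - of_real x = (of_real a * cnj z + of_real (b - x * d)) / of_real d"
      unfolding T[OF z] real_moebius_def using True nz by (simp add: field_simps)
    also have "\<dots> = of_real (a / d) * cnj (z - of_real x)" unfolding bx by (simp add: field_simps)
    finally show "real_moebius 1 (- x) 0 1 (T z) = of_real (a / d) * cnj (real_moebius 1 (- x) 0 1 z)"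
      by (simp add: real_moebius_def)
  qed simp
next
  case False
  define s where "s = sqrt ((d - a)\<^sup>2 + 4 * b * c)"
  \<comment> \<open>The discriminant is the squared trace minus four times the negative
    determinant.\<close>
  have disc: "(d - a)\<^sup>2 + 4 * b * c > 0"
  proof -
    have "(d - a)\<^sup>2 + 4 * b * c = (a + d)\<^sup>2 - 4 * (a * d - b * c)" by (simp add: power2_eq_square algebra_simps)
    then show ?thesis using det by (smt (verit) zero_le_power2)
  qed
  then have s: "s > 0" "s\<^sup>2 = (d - a)\<^sup>2 + 4 * b * c" by (auto simp: s_def)
  \<comment> \<open>The factor \<open>sgn c\<close> orders the roots as \<open>x < y\<close>, which
    makes the determinant \<open>y - x\<close> of the map
    \<open>z \<mapsto> (z - y) / (z - x)\<close> positive.\<close>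
  define x y where "x = (a - d - s / sgn c) / (2 * c)" and "y = (a - d + s / sgn c) / (2 * c)"
  have sg: "(s / sgn c)\<^sup>2 = s\<^sup>2" using False by (simp add: power_divide sgn_if)
  have root: "c * t\<^sup>2 + (d - a) * t = b" if "t = (a - d + e) / (2 * c)" "e\<^sup>2 = s\<^sup>2" for t e
  proof -
    have "2 * c * t - (a - d) = e" using that(1) False by simp
    then have "(2 * c * t - (a - d))\<^sup>2 = (d - a)\<^sup>2 + 4 * b * c" using that(2) s(2) by simp
    then have "4 * c * (c * t\<^sup>2 + (d - a) * t) = 4 * c * b" by (simp add: power2_eq_square algebra_simps)
    then show ?thesis using False by simp
  qed
  have rx: "c * x\<^sup>2 + (d - a) * x = b" by (rule root[of x "- (s / sgn c)"]) (use sg in \<open>auto simp: x_def\<close>)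
  have ry: "c * y\<^sup>2 + (d - a) * y = b" by (rule root[of y "s / sgn c"]) (use sg in \<open>auto simp: y_def\<close>)
  have "y - x = s / (sgn c * c)" using False by (simp add: x_def y_def field_simps)
  then have xy: "y - x > 0" using s(1) False by (simp add: mult.commute[of "sgn c"] mult_sgn_abs abs_sgn[symmetric])
  have diff: "T z - of_real t = of_real (a - c * t) * (cnj z - of_real t) / (of_real c * cnj z + of_real d)"
    if z: "Im z > 0" and t: "c * t\<^sup>2 + (d - a) * t = b" for z t
  proof -
    have "of_real c * cnj z + of_real d \<noteq> 0"
      by (rule real_linear_nonzero) (use z False in auto)
    then have "T z - of_real t = (of_real (a - c * t) * cnj z + of_real (b - t * d)) / (of_real c * cnj z + of_real d)"
      unfolding T[OF z] real_moebius_def by (simp add: field_simps)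
    moreover have bt: "b - t * d = - (a - c * t) * t" using t by (simp add: power2_eq_square algebra_simps)
    have "of_real (a - c * t) * cnj z + of_real (b - t * d) = of_real (a - c * t) * (cnj z - of_real t)"
      unfolding bt by (simp add: algebra_simps)
    ultimately show ?thesis by (simp only:)
  qed
  show ?thesis
  proof (rule that[of 1 "- x" "- y" 1 "(a - c * y) / (a - c * x)"])
    show "1 * - x - - y * 1 > 0" using xy by simp
    fix z assume z: "Im z > 0"
    have den: "of_real c * cnj z + of_real d \<noteq> 0"
      by (rule real_linear_nonzero) (use z False in auto)
    have Tx: "T z - of_real x \<noteq> 0" using up[OF z] by (auto simp: complex_eq_iff)
    then have ax: "a - c * x \<noteq> 0" using diff[OF z rx] by auto
    have zx: "cnj z - of_real x \<noteq> 0" using z by (auto simp: complex_eq_iff)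
    have "(T z - of_real y) / (T z - of_real x) =
        of_real ((a - c * y) / (a - c * x)) * ((cnj z - of_real y) / (cnj z - of_real x))"
      unfolding diff[OF z rx] diff[OF z ry] using den ax zx by simp
    then show "real_moebius 1 (- y) 1 (- x) (T z) =
        of_real ((a - c * y) / (a - c * x)) * cnj (real_moebius 1 (- y) 1 (- x) z)"
      by (simp add: real_moebius_def)
  qed
qed

text \<open>The factor \<open>\<mu>\<close> is negative because the maps preserve the half-plane,
  and it is not \<open>- 1\<close> because a reflection fixes the points of its axis. If
  \<open>\<mu> > - 1\<close>, composing with \<open>z \<mapsto> - 1 / z\<close> exchanges the ends
  of the axis and inverts the factor.\<close>

lemma normalize_reversing:
  assumes "a * d - b * c < 0" "\<And>z. Im z > 0 \<Longrightarrow> T z = real_moebius a b c d (cnj z)"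
    and up: "\<And>z. Im z > 0 \<Longrightarrow> Im (T z) > 0" and free: "\<And>z. Im z > 0 \<Longrightarrow> T z \<noteq> z"
  obtains A B C D \<rho> :: real where "A * D - B * C > 0" "\<rho> > 1"
    "\<And>z. Im z > 0 \<Longrightarrow> real_moebius A B C D (T z) = - of_real \<rho> * cnj (real_moebius A B C D z)"
proof -
  have "\<exists>A B C D \<mu> :: real. A * D - B * C > 0 \<and>
    (\<forall>z. Im z > 0 \<longrightarrow> real_moebius A B C D (T z) = of_real \<mu> * cnj (real_moebius A B C D z))"
    by (rule diagonalize_reversing[OF assms(1-3)]; blast)
  then obtain A B C D \<mu> :: real where det: "A * D - B * C > 0"
    and K: "\<And>z. Im z > 0 \<Longrightarrow> real_moebius A B C D (T z) = of_real \<mu> * cnj (real_moebius A B C D z)"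
    by blast
  let ?K = "real_moebius A B C D"
  have "Im (?K (T \<i>)) > 0" "Im (?K \<i>) > 0" using real_moebius_upper[OF det] up[of \<i>] by auto
  moreover have "Im (?K (T \<i>)) = - \<mu> * Im (?K \<i>)" using K[of \<i>] by simp
  ultimately have \<mu>: "\<mu> < 0" by (auto simp: zero_less_mult_iff mult_less_0_iff)
  have "\<mu> \<noteq> - 1"
  proof
    assume m: "\<mu> = - 1"
    have det': "D * A - (- B) * (- C) > 0" using det by (simp add: mult.commute)
    define z where "z = real_moebius D (- B) (- C) A \<i>"
    have z: "Im z > 0" using real_moebius_upper[OF det', of \<i>] by (simp add: z_def)
    have Kz: "?K z = \<i>" using real_moebius_inverse[OF det', of \<i>] by (simp add: z_def)
    have "?K (T z) = ?K z" using K[OF z] m Kz by simp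
    then have "T z = z" using real_moebius_inverse[OF det] up[OF z] z by metis
    then show False using free z by blast
  qed
  show ?thesis
  proof (cases "\<mu> < - 1")
    case True
    show ?thesis by (rule that[OF det, of "- \<mu>"]) (use True K in auto)
  next
    case False
    have det': "(- C) * B - (- D) * A > 0" using det by (simp add: algebra_simps)
    have inv: "real_moebius (- C) (- D) A B z = - inverse (?K z)" for z
    proof -
      have "of_real (- C) * z + of_real (- D) = - (of_real C * z + of_real D)" by simp
      then show ?thesis by (simp only: real_moebius_def inverse_divide minus_divide_left)
    qed
    show ?thesis
    proof (rule that[OF det', of "- inverse \<mu>"])
      show "1 < - inverse \<mu>" using False \<mu> \<open>\<mu> \<noteq> - 1\<close> by (simp add: field_simps)
      show "real_moebius (- C) (- D) A B (T z) = - of_real (- inverse \<mu>) * cnj (real_moebius (- C) (- D) A B z)"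
        if "Im z > 0" for z
        unfolding inv K[OF that] by (simp add: inverse_mult_distrib)
    qed
  qed
qed

section \<open>Hyperbolic distance in strip coordinates, and hyperbolic glide reflections\<close>

declare model_dist.simps(2) [simp del]

text \<open>The distance pulled back by \<open>w \<mapsto> \<i> * exp w\<close>. Real parts enter
  only through their difference, so horizontal shifts are isometries; on the real line the formula
  reduces to \<open>cosh (Re w - Re w')\<close>, so the line is parametrised by arc length.\<close>

lemma cosh_strip_dist:
  assumes "\<bar>Im w\<bar> < pi / 2" "\<bar>Im w'\<bar> < pi / 2"
  shows "cosh (model_dist Hyperbolic (\<i> * exp w) (\<i> * exp w')) =
    (cosh (Re w - Re w') - sin (Im w) * sin (Im w')) / (cos (Im w) * cos (Im w'))"
proof -
  define x y x' y' where "x = Re w" and "y = Im w" and "x' = Re w'" and "y' = Im w'"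
  have c: "cos y > 0" "cos y' > 0" using assms by (auto simp: y_def y'_def intro!: cos_gt_zero_pi)
  have im: "Im (\<i> * exp w) = exp x * cos y" "Im (\<i> * exp w') = exp x' * cos y'"
    by (simp_all add: x_def y_def x'_def y'_def Re_exp)
  have n: "(cmod (\<i> * exp w - \<i> * exp w'))\<^sup>2 = (exp x)\<^sup>2 + (exp x')\<^sup>2 - 2 * exp x * exp x' * cos (y - y')"
  proof -
    have "(cmod (\<i> * exp w - \<i> * exp w'))\<^sup>2 =
        (exp x * cos y - exp x' * cos y')\<^sup>2 + (exp x * sin y - exp x' * sin y')\<^sup>2"
      unfolding cmod_power2 by (simp add: Re_exp Im_exp x_def y_def x'_def y'_def power2_commute)
    also have "\<dots> = (exp x)\<^sup>2 * ((sin y)\<^sup>2 + (cos y)\<^sup>2) + (exp x')\<^sup>2 * ((sin y')\<^sup>2 + (cos y')\<^sup>2)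
        - 2 * exp x * exp x' * (cos y * cos y' + sin y * sin y')"
    proof -
      have "(e * a - e' * a')\<^sup>2 + (e * b - e' * b')\<^sup>2 =
          e\<^sup>2 * (b\<^sup>2 + a\<^sup>2) + e'\<^sup>2 * (b'\<^sup>2 + a'\<^sup>2) - 2 * e * e' * (a * a' + b * b')" for e e' a a' b b' :: real
        by (simp add: power2_eq_square algebra_simps)
      then show ?thesis .
    qed
    finally show ?thesis by (simp add: cos_diff)
  qed
  have ch: "cosh (x - x') = ((exp x)\<^sup>2 + (exp x')\<^sup>2) / (2 * exp x * exp x')"
    by (simp add: cosh_field_def exp_diff exp_minus field_simps power2_eq_square)
  have "cosh (model_dist Hyperbolic (\<i> * exp w) (\<i> * exp w')) =
      1 + ((exp x)\<^sup>2 + (exp x')\<^sup>2 - 2 * exp x * exp x' * cos (y - y')) / (2 * (exp x * cos y) * (exp x' * cos y'))"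
    by (subst cosh_model_dist) (use im n c in simp_all)
  also have "\<dots> = 1 + (cosh (x - x') - cos (y - y')) / (cos y * cos y')"
    unfolding ch using c by (simp add: field_simps)
  also have "\<dots> = (cosh (x - x') - sin y * sin y') / (cos y * cos y')"
    using c by (simp add: cos_diff field_simps)
  finally show ?thesis unfolding x_def y_def x'_def y'_def .
qed

lemma model_dist_nonneg: "z \<in> model_plane g \<Longrightarrow> w \<in> model_plane g \<Longrightarrow> model_dist g z w \<ge> 0"
  by (cases g) (auto simp: divide_nonneg_pos model_dist.simps(2))

lemma cosh_real_inj: "cosh x = cosh y \<Longrightarrow> \<bar>x\<bar> = \<bar>y\<bar>" for x y :: real
  by (metis abs_ge_zero arcosh_cosh_real cosh_real_abs)

lemma model_dist_eqI:
  assumes "z \<in> model_plane g" "w \<in> model_plane g" "cosh (model_dist g z w) = cosh r"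
  shows "model_dist g z w = \<bar>r\<bar>"
  using cosh_real_inj[OF assms(3)] model_dist_nonneg[OF assms(1,2)] by simp

text \<open>Multiplying the normalized half-plane coordinate by \<open>- \<i>\<close> leads to the
  right half-plane. There the logarithm turns the factor \<open>\<rho>\<close> into a shift by
  \<open>ln \<rho>\<close>, and the reflection \<open>z \<mapsto> - cnj z\<close> of the upper
  half-plane becomes conjugation.\<close>

lemma hyperbolic_straightening:
  assumes det: "A * D - B * C > 0" and \<rho>: "\<rho> > 1"
    and KT: "\<And>z. Im z > 0 \<Longrightarrow> real_moebius A B C D (T z) = - of_real \<rho> * cnj (real_moebius A B C D z)"
    and up: "\<And>z. Im z > 0 \<Longrightarrow> Im (T z) > 0"
  shows "\<exists>\<Phi> l R. straightening Hyperbolic T \<Phi> l R"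
proof -
  let ?K = "real_moebius A B C D" and ?K' = "real_moebius D (- B) (- C) A"
  have det': "D * A - (- B) * (- C) > 0" using det by (simp add: mult.commute)
  define \<Phi> where "\<Phi> z = Ln (- \<i> * ?K z)" for z
  define l where "l = ln \<rho>"
  have l: "l > 0" using \<rho> by (simp add: l_def)
  have Kup: "Im (?K z) > 0" if "Im z > 0" for z using real_moebius_upper[OF det that] .
  have slit: "- \<i> * ?K z \<notin> \<real>\<^sub>\<le>\<^sub>0" if "Im z > 0" for z
    using Kup[OF that] by (auto simp: complex_nonpos_Reals_iff)
  have nz: "- \<i> * ?K z \<noteq> 0" if "Im z > 0" for z using Kup[OF that] by auto
  have K\<Phi>: "?K z = \<i> * exp (\<Phi> z)" if "Im z > 0" for z
    unfolding \<Phi>_def using nz[OF that] by (subst exp_Ln) auto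
  have im: "\<bar>Im (\<Phi> z)\<bar> < pi / 2" if "Im z > 0" for z
    unfolding \<Phi>_def using Kup[OF that] by (intro Re_Ln_pos_lt_imp) auto
  have dist: "cosh (model_dist Hyperbolic z w) =
    (cosh (Re (\<Phi> z) - Re (\<Phi> w)) - sin (Im (\<Phi> z)) * sin (Im (\<Phi> w))) / (cos (Im (\<Phi> z)) * cos (Im (\<Phi> w)))"
    if "Im z > 0" "Im w > 0" for z w
    using cosh_strip_dist[OF im[OF that(1)] im[OF that(2)]] real_moebius_dist[OF det that]
    unfolding K\<Phi>[OF that(1)] K\<Phi>[OF that(2)] by simp
  have cospos: "cos (Im (\<Phi> z)) > 0" if "Im z > 0" for z
    using im[OF that] by (intro cos_gt_zero_pi) auto
  have glide: "\<Phi> (T z) = cnj (\<Phi> z) + of_real l" if "Im z > 0" for z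
  proof -
    have "\<Phi> (T z) = Ln (of_real \<rho> * cnj (- \<i> * ?K z))" unfolding \<Phi>_def KT[OF that] by (simp add: mult_ac)
    also have "\<dots> = of_real l + Ln (cnj (- \<i> * ?K z))"
      unfolding l_def using \<rho> nz[OF that] by (subst Ln_times_of_real) (auto simp: Ln_of_real)
    also have "Ln (cnj (- \<i> * ?K z)) = cnj (\<Phi> z)" unfolding \<Phi>_def using cnj_Ln[OF slit[OF that]] by simp
    finally show ?thesis by simp
  qed
  define R where "R = {w. \<bar>Im w\<bar> < pi / 2}"
  define \<Psi> where "\<Psi> w = ?K' (\<i> * exp w)" for w
  have \<Psi>: "Im (\<Psi> w) > 0" "\<Phi> (\<Psi> w) = w" if "w \<in> R" for w
  proof -
    have "cos (Im w) > 0" using that by (intro cos_gt_zero_pi) (auto simp: R_def)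
    then have e: "Im (\<i> * exp w) > 0" by (simp add: Re_exp)
    show "Im (\<Psi> w) > 0" unfolding \<Psi>_def by (rule real_moebius_upper[OF det' e])
    have "?K (\<Psi> w) = \<i> * exp w" using real_moebius_inverse[OF det' e] by (simp add: \<Psi>_def)
    then show "\<Phi> (\<Psi> w) = w" using that unfolding \<Phi>_def by (simp add: R_def)
  qed
  have \<Psi>\<Phi>: "\<Psi> (\<Phi> z) = z" if "Im z > 0" for z
    using real_moebius_inverse[OF det that] by (simp add: \<Psi>_def K\<Phi>[OF that, symmetric])
  have real_in: "of_real x \<in> R" for x by (simp add: R_def)
  have "straightening Hyperbolic T \<Phi> l R"
  proof
    have "?K holomorphic_on model_plane Hyperbolic" using real_moebius_holomorphic[OF det] by simp
    then show "\<Phi> holomorphic_on model_plane Hyperbolic"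
      unfolding \<Phi>_def using slit by (intro holomorphic_intros) auto
    show "bij_betw \<Phi> (model_plane Hyperbolic) R"
      by (rule bij_betw_byWitness[where f' = \<Psi>]) (use \<Psi> \<Psi>\<Phi> im in \<open>auto simp: R_def\<close>)
    show "of_real x \<in> R" for x by (rule real_in)
    show "w + of_real x \<in> R" if "w \<in> R" for w x using that by (simp add: R_def)
    show "model_dist Hyperbolic z' w' = model_dist Hyperbolic z w"
      if "z \<in> model_plane Hyperbolic" "w \<in> model_plane Hyperbolic"
        "z' \<in> model_plane Hyperbolic" "w' \<in> model_plane Hyperbolic"
        "\<Phi> z' = \<Phi> z + of_real s" "\<Phi> w' = \<Phi> w + of_real s" for z w z' w' s
    proof -
      have "cosh (model_dist Hyperbolic z' w') = cosh (model_dist Hyperbolic z w)"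
        using dist[of z w] dist[of z' w'] that by simp
      from model_dist_eqI[OF that(3,4) this] show ?thesis using model_dist_nonneg[OF that(1,2)] by simp
    qed
    show axd: "model_dist Hyperbolic z w = \<bar>x - y\<bar>"
      if "z \<in> model_plane Hyperbolic" "w \<in> model_plane Hyperbolic" "\<Phi> z = of_real x" "\<Phi> w = of_real y" for z w x y
    proof -
      have "cosh (model_dist Hyperbolic z w) = cosh (x - y)" using dist[of z w] that by simp
      from model_dist_eqI[OF that(1,2) this] show ?thesis .
    qed
    show "T z \<in> model_plane Hyperbolic" if "z \<in> model_plane Hyperbolic" for z using up that by simp
    show "\<Phi> (T z) = cnj (\<Phi> z) + of_real l" if "z \<in> model_plane Hyperbolic" for z using glide that by simp
    show "l > 0" by (rule l)
    show "\<exists>x. \<forall>s. \<Phi> (a s) = of_real (x + s)"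
      if am: "\<And>s. a s \<in> model_plane Hyperbolic" and iso: "\<And>s t. model_dist Hyperbolic (a s) (a t) = \<bar>s - t\<bar>"
        and k: "k > 0" "\<And>s. T (a s) = a (s + k)" for a k
    proof -
      have a: "Im (a s) > 0" for s using am[of s] by simp
      have \<Phi>k: "\<Phi> (a (s + k)) = cnj (\<Phi> (a s)) + of_real l" for s using glide[OF a[of s]] k(2)[of s] by simp
      \<comment> \<open>One glide step along the axis has length \<open>k\<close> and two have
        length \<open>2 * k\<close>. The double argument formula eliminates \<open>k\<close> from
        the two distances and leaves \<open>q * (1 + Q) * (1 + Q) = 0\<close> with
        \<open>Q = cosh l\<close>, so the height \<open>y\<close> is zero.\<close>
      have im0: "Im (\<Phi> (a s)) = 0" for s
      proof -
        define y where "y = Im (\<Phi> (a s))"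
        define q where "q = (sin y)\<^sup>2"
        have cy: "cos y > 0" using cospos[OF a] by (simp add: y_def)
        have cq: "cos y * cos y = 1 - q" "q = sin y * sin y"
          using sin_cos_squared_add[of y] by (simp_all add: q_def power2_eq_square)
        then have q1: "1 - q > 0" using cy by (metis mult_pos_pos)
        have "cosh k = cosh (model_dist Hyperbolic (a s) (a (s + k)))" using iso[of s "s + k"] by simp
        also have "\<dots> = (cosh l + q) / (1 - q)"
          unfolding dist[OF a a] \<Phi>k by (simp add: y_def[symmetric] cq)
        finally have e1: "cosh k * (1 - q) = cosh l + q" using q1 by simp
        have "cosh (2 * k) = cosh (model_dist Hyperbolic (a s) (a (s + k + k)))"
        proof -
          have "\<bar>s - (s + k + k)\<bar> = 2 * k" using k(1) by simp
          then show ?thesis by (simp only: iso[of s "s + k + k"])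
        qed
        also have "\<dots> = (cosh (2 * l) - q) / (1 - q)"
          unfolding dist[OF a a] \<Phi>k[of "s + k"] \<Phi>k[of s]
          using cosh_minus[of "2 * l"] by (simp add: y_def[symmetric] cq)
        finally have e2: "cosh (2 * k) * (1 - q) = cosh (2 * l) - q" using q1 by simp
        define P Q where "P = cosh k" and "Q = cosh l"
        have "(2 * P\<^sup>2 - 1) * (1 - q) = 2 * Q\<^sup>2 - 1 - q" "P * (1 - q) = Q + q"
          using e1 e2 by (simp_all add: P_def Q_def cosh_double_cosh)
        then have "2 * (Q + q)\<^sup>2 - (1 - q)\<^sup>2 = (2 * Q\<^sup>2 - 1 - q) * (1 - q)"
        proof -
          assume *: "(2 * P\<^sup>2 - 1) * (1 - q) = 2 * Q\<^sup>2 - 1 - q" "P * (1 - q) = Q + q"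
          have "2 * (P * (1 - q))\<^sup>2 - (1 - q)\<^sup>2 = ((2 * P\<^sup>2 - 1) * (1 - q)) * (1 - q)"
            by (simp add: power2_eq_square algebra_simps)
          then show ?thesis unfolding * .
        qed
        then have "q * (1 + Q)\<^sup>2 = 0" by (simp add: power2_eq_square algebra_simps)
        moreover have "1 + Q > 0" using cosh_real_ge_1[of l] by (simp add: Q_def)
        ultimately have "sin y = 0" by (simp add: q_def)
        moreover have "- pi < y" "y < pi" using im[OF a[of s]] pi_gt_zero by (simp_all add: y_def abs_less_iff)
        ultimately have "y = 0" using sin_eq_0_pi by blast
        then show ?thesis by (simp add: y_def)
      qed
      have re: "\<Phi> (a s) = of_real (Re (\<Phi> (a s)))" for s using im0[of s] by (simp add: complex_eq_iff)
      have iso': "\<bar>Re (\<Phi> (a s)) - Re (\<Phi> (a t))\<bar> = \<bar>s - t\<bar>" for s t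
        using axd[OF am am re re, of s t] iso[of s t] by simp
      have "Re (\<Phi> (a k)) > Re (\<Phi> (a 0))" using \<Phi>k[of 0] l by simp
      then have H: "Re (\<Phi> (a s)) = Re (\<Phi> (a 0)) + s" for s
        by (rule real_line_isometry[where f = "\<lambda>s. Re (\<Phi> (a s))", OF iso' k(1)])
      have "\<Phi> (a s) = of_real (Re (\<Phi> (a 0)) + s)" for s using re[of s] unfolding H[of s] .
      then show ?thesis by blast
    qed
    show "\<Phi> w = \<Phi> z + of_real s \<or> \<Phi> w = cnj (\<Phi> z) + of_real s"
      if zw: "z \<in> model_plane Hyperbolic" "w \<in> model_plane Hyperbolic" and
        *: "\<And>x a b. a \<in> model_plane Hyperbolic \<Longrightarrow> b \<in> model_plane Hyperbolic \<Longrightarrow> \<Phi> a = of_real x \<Longrightarrow>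
        \<Phi> b = of_real (x + s) \<Longrightarrow> model_dist Hyperbolic w b = model_dist Hyperbolic z a" for z w s
    proof -
      define p q where "p = cos (Im (\<Phi> w))" and "q = cos (Im (\<Phi> z))"
      define u v where "u = Re (\<Phi> w) - s" and "v = Re (\<Phi> z)"
      have pq: "p > 0" "q > 0" using cospos zw by (auto simp: p_def q_def)
      have e: "cosh (u - x) / p = cosh (v - x) / q" for x
      proof -
        note \<Psi>x = \<Psi>[OF real_in[of x]] and \<Psi>s = \<Psi>[OF real_in[of "x + s"]]
        have "model_dist Hyperbolic w (\<Psi> (of_real (x + s))) = model_dist Hyperbolic z (\<Psi> (of_real x))"
          by (rule *) (use \<Psi>x \<Psi>s in auto)
        then have "cosh (model_dist Hyperbolic w (\<Psi> (of_real (x + s)))) = cosh (model_dist Hyperbolic z (\<Psi> (of_real x)))"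
          by simp
        then show ?thesis using zw unfolding p_def q_def u_def v_def
          by (subst (asm) (1 2) dist) (use \<Psi>x \<Psi>s in \<open>auto simp: diff_diff_eq add.commute\<close>)
      qed
      \<comment> \<open>The test points \<open>x = u\<close> and \<open>x = v\<close> give two
        relations whose product is \<open>cosh (u - v) * cosh (u - v) = 1\<close>.\<close>
      have 1: "1 / p = cosh (u - v) / q" 
      proof -
        have "cosh (v - u) = cosh (u - v)" using cosh_minus[of "u - v"] by simp
        then show ?thesis using e[of u] by simp
      qed
      have 2: "cosh (u - v) / p = 1 / q" using e[of v] by simp
      have c1: "cosh (u - v) \<ge> 1" by (rule cosh_real_ge_1)
      have "q = cosh (u - v) * p" "q * cosh (u - v) = p" using 1 2 pq by (simp_all add: field_simps)
      then have "p * (cosh (u - v) * cosh (u - v)) = p * 1" by (simp add: mult_ac)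
      then have "cosh (u - v) * cosh (u - v) = 1" using pq by simp
      then have "(cosh (u - v))\<^sup>2 = 1" by (simp add: power2_eq_square)
      then have ch: "cosh (u - v) = 1" using c1 by (simp add: power2_eq_1_iff)
      then have "u = v" using cosh_real_inj[of "u - v" 0] by simp
      moreover have "p = q" using 1 ch pq by (simp add: field_simps)
      then have "cos \<bar>Im (\<Phi> w)\<bar> = cos \<bar>Im (\<Phi> z)\<bar>" by (simp add: p_def q_def)
      then have "\<bar>Im (\<Phi> w)\<bar> = \<bar>Im (\<Phi> z)\<bar>"
      proof (rule cos_inj_pi[rotated 4])
        have "\<bar>Im (\<Phi> w)\<bar> < pi / 2" "\<bar>Im (\<Phi> z)\<bar> < pi / 2" using im zw by auto
        then show "\<bar>Im (\<Phi> w)\<bar> \<le> pi" "\<bar>Im (\<Phi> z)\<bar> \<le> pi" using pi_gt_zero by linarith+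
      qed auto
      ultimately show ?thesis unfolding u_def v_def by (auto simp: complex_eq_iff abs_eq_iff)
    qed
  qed
  then show ?thesis by blast
qed

theorem straightening_exists:
  assumes "universal_covering g M p" "deck_transformation g p T" "orientation_reversing_on (model_plane g) T"
  obtains \<Phi> l R where "straightening g T \<Phi> l R"
proof -
  have "\<exists>\<Phi> l R. straightening g T \<Phi> l R"
  proof (cases g)
    case Euclidean
    obtain r where r: "r > 0" "\<And>x y. x \<in> ball 0 r \<Longrightarrow> y \<in> ball 0 r \<Longrightarrow> dist (T x) (T y) = dist x y"
      using deck_locally_isometric[OF assms(1,2), of 0] Euclidean by auto
    have 0: "(0 :: complex) \<in> ball 0 r" using r by simp
    obtain \<alpha> where \<alpha>: "cmod \<alpha> = 1" "(\<forall>z\<in>ball 0 r. T z - T 0 = \<alpha> * (z - 0)) \<or> (\<forall>z\<in>ball 0 r. T z - T 0 = \<alpha> * cnj (z - 0))"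
      using euclidean_isometry_cases[OF 0, of T] r by blast
    have nd: "\<not> (T has_field_derivative k) (at 0)" for k
    proof -
      obtain D where "(T has_derivative D) (at 0)" "cross2 (D 1) (D \<i>) < 0"
        using assms(3) Euclidean unfolding orientation_reversing_on_def by auto
      then show ?thesis using field_derivative_positive by (metis not_less zero_le_power2)
    qed
    have "\<not> (\<forall>z\<in>ball 0 r. T z - T 0 = \<alpha> * (z - 0))"
    proof
      assume *: "\<forall>z\<in>ball 0 r. T z - T 0 = \<alpha> * (z - 0)"
      have "((\<lambda>z. T 0 + \<alpha> * z) has_field_derivative \<alpha>) (at 0)" by (auto intro!: derivative_eq_intros)
      then have "(T has_field_derivative \<alpha>) (at 0)"
        by (rule has_field_derivative_transform_within_open[OF _ open_ball 0]) (use * in \<open>auto simp: algebra_simps\<close>)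
      then show False using nd by blast
    qed
    then have loc: "T z - T 0 = \<alpha> * cnj z" if "z \<in> ball 0 r" for z using \<alpha>(2) that by auto
    \<comment> \<open>The affine form is known near \<open>0\<close> only; since
      \<open>cnj (T z)\<close> is holomorphic, the identity theorem spreads it over the
      plane.\<close>
    have "cnj (T z) = cnj (T 0) + cnj \<alpha> * z" for z
    proof (rule analytic_continuation_open[of "ball 0 r" UNIV "\<lambda>z. cnj (T z)" "\<lambda>z. cnj (T 0) + cnj \<alpha> * z"])
      show "(\<lambda>z. cnj (T z)) holomorphic_on UNIV" using deck_antiholomorphic[OF assms] Euclidean by simp
      show "(\<lambda>z. cnj (T 0) + cnj \<alpha> * z) holomorphic_on UNIV" by (intro holomorphic_intros)
      show "cnj (T z) = cnj (T 0) + cnj \<alpha> * z" if "z \<in> ball 0 r" for z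
      proof -
        have "cnj (T z - T 0) = cnj (\<alpha> * cnj z)" using loc[OF that] by simp
        then show ?thesis by (simp add: algebra_simps)
      qed
    qed (use r in auto)
    then have "cnj (cnj (T z)) = cnj (cnj (T 0) + cnj \<alpha> * z)" for z by (rule arg_cong)
    then have "T z = T 0 + \<alpha> * cnj z" for z
      unfolding complex_cnj_cnj complex_cnj_add complex_cnj_mult .
    moreover have "T z \<noteq> z" for z using deck_reversing_no_fixed_point[OF assms, of z] Euclidean by simp
    ultimately show ?thesis using euclidean_straightening[OF _ \<alpha>(1)] Euclidean by blast
  next
    case Hyperbolic
    note as = assms[unfolded Hyperbolic]
    have up: "Im (T z) > 0" and free: "T z \<noteq> z" if "Im z > 0" for z
      using deck_in_model[OF as(2), of z] deck_reversing_no_fixed_point[OF as, of z] that by auto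
    have "\<exists>a b c d :: real. a * d - b * c < 0 \<and> (\<forall>z. Im z > 0 \<longrightarrow> T z = real_moebius a b c d (cnj z))"
      by (rule hyperbolic_reversing_form[OF as]; blast)
    then obtain a b c d :: real where T: "a * d - b * c < 0" "\<And>z. Im z > 0 \<Longrightarrow> T z = real_moebius a b c d (cnj z)"
      by blast
    have "\<exists>A B C D \<rho> :: real. A * D - B * C > 0 \<and> \<rho> > 1 \<and>
      (\<forall>z. Im z > 0 \<longrightarrow> real_moebius A B C D (T z) = - of_real \<rho> * cnj (real_moebius A B C D z))"
      by (rule normalize_reversing[OF T up free]; blast)
    then show ?thesis using hyperbolic_straightening up Hyperbolic by blast
  qed
  then show ?thesis using that by blast
qed

section \<open>Covering spaces of metric spaces\<close>

text \<open>The library states the lifting theorems for subsets of normed spaces only; the Kuratowski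
  embedding transports them to an arbitrary metric space.\<close>

lemma kuratowski_embedding:
  obtains e :: "'a::metric_space \<Rightarrow> 'a \<Rightarrow>\<^sub>C real" where "\<And>x y. dist (e x) (e y) = dist x y"
proof -
  \<comment> \<open>An arbitrary base point; subtracting the distance from it makes the distance
    functions bounded.\<close>
  define x0 :: 'a where "x0 = undefined"
  define e where "e x = Bcontfun (\<lambda>y. dist x y - dist x0 y)" for x
  have e: "apply_bcontfun (e x) = (\<lambda>y. dist x y - dist x0 y)" for x
  proof -
    have "norm (dist x y - dist x0 y) \<le> dist x x0" for y
      using dist_triangle[of x y x0] dist_triangle[of x0 y x] by (simp add: dist_commute abs_le_iff)
    then have "(\<lambda>y. dist x y - dist x0 y) \<in> bcontfun"
      by (intro bcontfun_normI) (auto intro!: continuous_intros)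
    then show ?thesis unfolding e_def by (rule Bcontfun_inverse)
  qed
  have "dist (e x) (e y) = dist x y" for x y
  proof (rule antisym)
    show "dist (e x) (e y) \<le> dist x y"
    proof (rule dist_bound)
      fix z
      show "dist (apply_bcontfun (e x) z) (apply_bcontfun (e y) z) \<le> dist x y"
        using dist_triangle[of x z y] dist_triangle[of y z x]
        by (simp add: e dist_real_def dist_commute abs_le_iff)
    qed
    show "dist x y \<le> dist (e x) (e y)"
      using dist_bounded[of "e x" y "e y"] by (simp add: e dist_real_def)
  qed
  then show ?thesis using that by blast
qed

lemma isometry_homeomorphism:
  fixes e :: "'a::metric_space \<Rightarrow> 'b::metric_space"
  assumes "\<And>x y. dist (e x) (e y) = dist x y"
  shows "homeomorphism S (e ` S) e (inv_into S e)" "inj e"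
proof -
  show inj: "inj e" using assms by (metis dist_eq_0_iff injI)
  have inv: "inv_into S e (e x) = x" if "x \<in> S" for x
    using that inj by (simp add: inj_on_subset inv_into_f_f)
  show "homeomorphism S (e ` S) e (inv_into S e)"
  proof (rule homeomorphismI)
    show "continuous_on S e" unfolding continuous_on_iff assms by blast
    show "continuous_on (e ` S) (inv_into S e)"
      unfolding continuous_on_iff using inv assms by (auto intro: exI[of _ "_ :: real"])
  qed (auto simp: inv)
qed

lemma covering_space_isometry:
  fixes e :: "'a::metric_space \<Rightarrow> 'b::metric_space"
  assumes cov: "covering_space C p M" and e: "\<And>x y. dist (e x) (e y) = dist x y"
  shows "covering_space C (e \<circ> p) (e ` M)"
proof
  note hom = isometry_homeomorphism(1)[OF e] and inj = isometry_homeomorphism(2)[OF e]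
  show "continuous_on C (e \<circ> p)"
    using covering_space_imp_continuous[OF cov] homeomorphism_cont1[OF hom]
    by (intro continuous_on_compose) auto
  show "(e \<circ> p) ` C = e ` M" using covering_space_imp_surjective[OF cov] by auto
  fix x assume "x \<in> e ` M"
  then obtain m where m: "m \<in> M" "x = e m" by blast
  obtain U v where U: "m \<in> U" "openin (top_of_set M) U" "\<Union>v = C \<inter> p -` U"
    "\<forall>u\<in>v. openin (top_of_set C) u" "pairwise disjnt v" "\<forall>u\<in>v. \<exists>q. homeomorphism u U p q"
    using cov m(1) unfolding covering_space_def by metis
  show "\<exists>T. x \<in> T \<and> openin (top_of_set (e ` M)) T \<and>
      (\<exists>v. \<Union>v = C \<inter> (e \<circ> p) -` T \<and> (\<forall>u\<in>v. openin (top_of_set C) u) \<and> pairwise disjnt v \<and>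
        (\<forall>u\<in>v. \<exists>q. homeomorphism u T (e \<circ> p) q))"
  proof (intro exI conjI)
    show "x \<in> e ` U" using U m by blast
    show "openin (top_of_set (e ` M)) (e ` U)" by (rule homeomorphism_imp_open_map[OF hom U(2)])
    show "\<Union>v = C \<inter> (e \<circ> p) -` (e ` U)" using U(3) inj by (auto simp: inj_eq)
    show "\<forall>u\<in>v. \<exists>q. homeomorphism u (e ` U) (e \<circ> p) q"
      using U(6) homeomorphism_compose[OF _ hom[of U]] by blast
  qed (use U in auto)
qed

text \<open>A closed lift contracts in the simply connected space above, and the contraction is
  projected. Conversely, monodromy compares the lift with the constant lift of the constant
  path.\<close>

lemma closed_lift_iff_null_homotopic:
  fixes p :: "'c::real_normed_vector \<Rightarrow> 'a::metric_space"
  assumes cov: "covering_space C p M" and sc: "simply_connected C"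
    and h: "path h" "path_image h \<subseteq> C"
  shows "pathfinish h = pathstart h \<longleftrightarrow> null_homotopic_loop M (p \<circ> h)"
proof
  note cont = covering_space_imp_continuous[OF cov] and surj = covering_space_imp_surjective[OF cov]
  assume "pathfinish h = pathstart h"
  then have "homotopic_paths C h (linepath (pathstart h) (pathstart h))"
    using sc h unfolding simply_connected_eq_contractible_path by blast
  then have "homotopic_paths M (p \<circ> h) (p \<circ> linepath (pathstart h) (pathstart h))"
    by (rule homotopic_paths_continuous_image[OF _ cont]) (use surj in auto)
  moreover have "p \<circ> linepath (pathstart h) (pathstart h) = (\<lambda>_. pathstart (p \<circ> h))"
    by (auto simp: linepath_def pathstart_def fun_eq_iff simp flip: scaleR_left_distrib)
  ultimately show "null_homotopic_loop M (p \<circ> h)" by (simp add: null_homotopic_loop_def)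
next
  assume null: "null_homotopic_loop M (p \<circ> h)"
  obtain e :: "'a \<Rightarrow> 'a \<Rightarrow>\<^sub>C real" where e: "\<And>x y. dist (e x) (e y) = dist x y"
    by (rule kuratowski_embedding) blast
  note cov' = covering_space_isometry[OF cov e]
  have conte: "continuous_on M e" unfolding continuous_on_iff e by blast
  let ?k = "\<lambda>_ :: real. pathstart h"
  have "homotopic_paths (e ` M) (e \<circ> (p \<circ> h)) (e \<circ> (\<lambda>_. pathstart (p \<circ> h)))"
    by (rule homotopic_paths_continuous_image[OF null[unfolded null_homotopic_loop_def] conte]) auto
  then have hom: "homotopic_paths (e ` M) ((e \<circ> p) \<circ> h) ((e \<circ> p) \<circ> ?k)"
    by (simp add: o_def pathstart_def)
  have st: "pathstart h \<in> C" using h(2) by (auto simp: path_image_def pathstart_def)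
  have "pathfinish h = pathfinish ?k"
  proof (rule covering_space_monodromy[OF cov' _ _ _ _ hom h])
    show "path ((e \<circ> p) \<circ> h)" "path_image ((e \<circ> p) \<circ> h) \<subseteq> e ` M"
      "path ((e \<circ> p) \<circ> ?k)" "path_image ((e \<circ> p) \<circ> ?k) \<subseteq> e ` M"
      using homotopic_paths_imp_path[OF hom] homotopic_paths_imp_subset[OF hom] by auto
    show "path ?k" by (simp add: path_def)
    show "path_image ?k \<subseteq> C" using st by (auto simp: path_image_def)
    show "pathstart h = pathstart ?k" by (simp add: pathstart_def)
  qed auto
  then show "pathfinish h = pathstart h" by (simp add: pathfinish_def)
qed

lemma simply_connected_model_plane: "simply_connected (model_plane g)"
  using convex_model_plane convex_imp_simply_connected by blast

text \<open>Lifting \<open>p\<close> through itself gives maps with \<open>S z = w\<close> and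
  \<open>S' w = z\<close>. Their compositions fix a point, so they are the identity by unique
  lifting.\<close>

lemma deck_transitive:
  fixes p :: "complex \<Rightarrow> 'a::metric_space"
  assumes cov: "covering_space (model_plane g) p M"
    and zw: "z \<in> model_plane g" "w \<in> model_plane g" "p z = p w"
  obtains S where "deck_transformation g p S" "S z = w"
proof -
  let ?C = "model_plane g"
  note cont = covering_space_imp_continuous[OF cov] and surj = covering_space_imp_surjective[OF cov]
  obtain e :: "'a \<Rightarrow> 'a \<Rightarrow>\<^sub>C real" where e: "\<And>x y. dist (e x) (e y) = dist x y"
    by (rule kuratowski_embedding) blast
  note cov' = covering_space_isometry[OF cov e]
  have cont': "continuous_on ?C (e \<circ> p)" and into: "e \<circ> p \<in> ?C \<rightarrow> e ` M"
    using covering_space_imp_continuous[OF cov'] surj by auto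
  have inj: "inj e" using isometry_homeomorphism(2)[OF e] .
  have lpc: "locally path_connected ?C" using convex_model_plane convex_imp_locally_path_connected by blast
  have lift: "\<exists>S. continuous_on ?C S \<and> S \<in> ?C \<rightarrow> ?C \<and> S a = b \<and> (\<forall>y\<in>?C. p (S y) = p y)"
    if ab: "a \<in> ?C" "b \<in> ?C" "p a = p b" for a b
  proof -
    have "(e \<circ> p) a = (e \<circ> p) b" using ab by simp
    then obtain S where "continuous_on ?C S" "S \<in> ?C \<rightarrow> ?C" "S a = b"
      "\<And>y. y \<in> ?C \<Longrightarrow> (e \<circ> p) (S y) = (e \<circ> p) y"
      using covering_space_lift_strong[OF cov' ab(2,1) simply_connected_model_plane lpc cont' into] by metis
    then show ?thesis using inj by (auto simp: inj_eq)
  qed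
  obtain S where S: "continuous_on ?C S" "S \<in> ?C \<rightarrow> ?C" "S z = w" "\<forall>y\<in>?C. p (S y) = p y"
    using lift[OF zw] by blast
  obtain S' where S': "continuous_on ?C S'" "S' \<in> ?C \<rightarrow> ?C" "S' w = z" "\<forall>y\<in>?C. p (S' y) = p y"
    using lift[OF zw(2,1)] zw(3) by metis
  have inverse: "A (B y) = y"
    if "continuous_on ?C A" "A \<in> ?C \<rightarrow> ?C" "\<forall>y\<in>?C. p (A y) = p y"
      "continuous_on ?C B" "B \<in> ?C \<rightarrow> ?C" "\<forall>y\<in>?C. p (B y) = p y" "a \<in> ?C" "A (B a) = a" "y \<in> ?C" for A B a y
  proof (rule covering_space_lift_unique[where f = p and ?g1.0 = "\<lambda>y. A (B y)" and ?g2.0 = "\<lambda>y. y" and T = ?C and a = a, OF cov])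
    show "continuous_on ?C (\<lambda>y. A (B y))"
      using that(1,4,5) by (intro continuous_on_compose2[OF that(1,4)]) auto
    show "connected ?C" using convex_model_plane convex_connected by blast
    have "B x \<in> ?C" if "x \<in> ?C" for x using \<open>B \<in> ?C \<rightarrow> ?C\<close> that by auto
    then show "(\<lambda>y. A (B y)) \<in> ?C \<rightarrow> ?C" "\<And>x. x \<in> ?C \<Longrightarrow> p x = p (A (B x))"
      using that by auto
  qed (use that cont surj in auto)
  have "homeomorphism ?C ?C S S'"
  proof (rule homeomorphismI)
    show "S' (S y) = y" if "y \<in> ?C" for y
      by (rule inverse[OF S'(1,2,4) S(1,2,4) zw(1)]) (use S S' that in auto)
    show "S (S' y) = y" if "y \<in> ?C" for y
      by (rule inverse[OF S(1,2,4) S'(1,2,4) zw(2)]) (use S S' that in auto)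
  qed (use S S' in auto)
  then have "deck_transformation g p S" using S(4) unfolding deck_transformation_def by blast
  then show ?thesis using S(3) that by blast
qed

section \<open>Generic curves and their covers\<close>

lemma circle_cover_eq_iff: "circle_cover s = circle_cover t \<longleftrightarrow> (\<exists>k::int. s = t + of_int k)"
proof -
  have "circle_cover s = circle_cover t \<longleftrightarrow> sin (2 * pi * s) = sin (2 * pi * t) \<and> cos (2 * pi * s) = cos (2 * pi * t)"
    by (auto simp: circle_cover_def complex_eq_iff)
  also have "\<dots> \<longleftrightarrow> (\<exists>k::int. 2 * pi * s = 2 * pi * t + 2 * pi * of_int k)"
    by (rule sin_cos_eq_iff)
  also have "\<dots> \<longleftrightarrow> (\<exists>k::int. s = t + of_int k)"
    by (simp flip: distrib_left)
  finally show ?thesis .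
qed

lemma circle_cover_inj:
  assumes "circle_cover s = circle_cover t" "\<bar>s - t\<bar> < 1"
  shows "s = t"
proof -
  obtain k :: int where k: "s = t + of_int k" using assms(1) circle_cover_eq_iff by blast
  then have "\<bar>of_int k :: real\<bar> < 1" using assms(2) by simp
  then have "k = 0" by linarith
  then show ?thesis using k by simp
qed

lemma circle_cover_add_int: "circle_cover (t + of_int k) = circle_cover t"
  using circle_cover_eq_iff by blast

lemma circle_cover_in_sphere: "circle_cover t \<in> sphere 0 1"
  by (simp add: circle_cover_def)

lemma continuous_circle_cover: "continuous_on S circle_cover"
  unfolding circle_cover_def by (intro continuous_intros)

lemma circle_cover_surj:
  assumes "x \<in> sphere 0 1"
  obtains s where "0 \<le> s" "s < 1" "circle_cover s = x"
proof -
  have "x = cis (Arg x)" using assms by (subst cis_Arg) (auto simp: sgn_eq)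
  define r where "r = Arg x / (2 * pi)"
  have "circle_cover r = x" using \<open>x = cis (Arg x)\<close> by (simp add: circle_cover_def r_def)
  moreover have "circle_cover (frac r) = circle_cover r"
    unfolding circle_cover_eq_iff frac_def by (intro exI[of _ "- \<lfloor>r\<rfloor>"]) simp
  ultimately show ?thesis using that[OF frac_ge_0 frac_lt_1, of r] by simp
qed

locale covered_curve =
  fixes g :: geometry and M :: "'a::metric_space set" and p :: "complex \<Rightarrow> 'a" and \<gamma> :: "complex \<Rightarrow> 'a"
  assumes covering: "universal_covering g M p"
    and regular: "regular_closed_curve g M \<gamma>"
    and generic: "generic_curve g M \<gamma>"
begin

lemma covering_space: "covering_space (model_plane g) p M"
  using covering by (simp add: universal_covering_def)

text \<open>\<open>p\<close> is injective where it preserves distances, and its local inverse is a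
  chart. This gives access to the conditions on \<open>\<gamma>\<close>, which are all stated in
  charts.\<close>

lemma local_chart:
  assumes "z \<in> model_plane g"
  obtains V where "open V" "z \<in> V" "V \<subseteq> model_plane g" "isometric_chart g M (p ` V) (inv_into V p)"
    "\<And>x. x \<in> V \<Longrightarrow> inv_into V p (p x) = x"
proof -
  obtain V where V: "open V" "z \<in> V" "V \<subseteq> model_plane g"
    "\<forall>x\<in>V. \<forall>y\<in>V. dist (p x) (p y) = model_dist g x y"
    using universal_coveringD[OF covering assms] .
  have inj: "inj_on p V"
  proof (rule inj_onI)
    fix x y assume *: "x \<in> V" "y \<in> V" "p x = p y"
    then have "model_dist g x y = 0" using V(4) by (metis dist_self)
    then show "x = y" using model_dist_eq_0 * V(3) by blast
  qed
  have inv: "inv_into V p (p x) = x" if "x \<in> V" for x using inv_into_f_f[OF inj that] .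
  have im: "inv_into V p ` p ` V = V" using inv by force
  have "openin (top_of_set M) (p ` V)"
    by (rule covering_space_open_map[OF covering_space open_subset[OF V(3,1)]])
  then have "isometric_chart g M (p ` V) (inv_into V p)"
    unfolding isometric_chart_def im using V inv by auto
  then show ?thesis using that V inv by blast
qed

lemma continuous_curve: "continuous_on UNIV (\<lambda>t. \<gamma> (circle_cover t))"
  using regular circle_cover_in_sphere unfolding regular_closed_curve_def
  by (intro continuous_on_compose2[OF _ continuous_circle_cover]) auto

lemma curve_in: "\<gamma> (circle_cover t) \<in> M"
  using regular circle_cover_in_sphere unfolding regular_closed_curve_def by blast

lemma open_chart_times:
  assumes "isometric_chart g M U f"
  shows "open {t. \<gamma> (circle_cover t) \<in> U}"
proof -
  obtain W where W: "open W" "U = M \<inter> W"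
    using assms unfolding isometric_chart_def openin_open by blast
  have "{t. \<gamma> (circle_cover t) \<in> U} = (\<lambda>t. \<gamma> (circle_cover t)) -` W" using W(2) curve_in by auto
  then show ?thesis using W(1) continuous_curve by (metis open_vimage)
qed

lemma chart_derivative:
  assumes "isometric_chart g M U f"
  obtains D where "\<And>t. \<gamma> (circle_cover t) \<in> U \<Longrightarrow> ((f \<circ> \<gamma> \<circ> circle_cover) has_vector_derivative D t) (at t)"
    "\<And>t. \<gamma> (circle_cover t) \<in> U \<Longrightarrow> isCont D t" "\<And>t. \<gamma> (circle_cover t) \<in> U \<Longrightarrow> D t \<noteq> 0"
proof -
  let ?S = "{t. \<gamma> (circle_cover t) \<in> U}"
  have C1: "(f \<circ> \<gamma> \<circ> circle_cover) C1_differentiable_on ?S"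
    and nz: "\<And>t. \<gamma> (circle_cover t) \<in> U \<Longrightarrow> vector_derivative (f \<circ> \<gamma> \<circ> circle_cover) (at t) \<noteq> 0"
    using regular assms unfolding regular_closed_curve_def by blast+
  obtain D where D: "\<forall>t\<in>?S. ((f \<circ> \<gamma> \<circ> circle_cover) has_vector_derivative D t) (at t)" "continuous_on ?S D"
    using C1 unfolding C1_differentiable_on_def by blast
  show ?thesis
  proof
    fix t assume t: "\<gamma> (circle_cover t) \<in> U"
    show d: "((f \<circ> \<gamma> \<circ> circle_cover) has_vector_derivative D t) (at t)" using D(1) t by simp
    show "isCont D t" using D(2) t open_chart_times[OF assms] by (auto simp: continuous_on_eq_continuous_at)
    show "D t \<noteq> 0" using nz[OF t] vector_derivative_at[OF d] by simp
  qed
qed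

text \<open>The inverse of the covering near a point is a chart, and in it the curve is its cover.\<close>

lemma cover_in_chart:
  assumes c: "cover_of_curve g p \<gamma> c"
  obtains V f D where "open V" "c t \<in> V" "isometric_chart g M (p ` V) f"
    "\<And>s. c s \<in> V \<Longrightarrow> \<gamma> (circle_cover s) \<in> p ` V"
    "\<And>s. c s \<in> V \<Longrightarrow> ((f \<circ> \<gamma> \<circ> circle_cover) has_vector_derivative D s) (at s)"
    "\<And>s. c s \<in> V \<Longrightarrow> (c has_vector_derivative D s) (at s)"
    "\<And>s. c s \<in> V \<Longrightarrow> isCont D s" "\<And>s. c s \<in> V \<Longrightarrow> D s \<noteq> 0"
proof -
  have "c t \<in> model_plane g" using c by (auto simp: cover_of_curve_def)
  then obtain V where V: "open V" "c t \<in> V" "V \<subseteq> model_plane g" "isometric_chart g M (p ` V) (inv_into V p)"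
    "\<And>x. x \<in> V \<Longrightarrow> inv_into V p (p x) = x"
    using local_chart by blast
  let ?f = "inv_into V p \<circ> \<gamma> \<circ> circle_cover"
  obtain D where D: "\<And>t. \<gamma> (circle_cover t) \<in> p ` V \<Longrightarrow> (?f has_vector_derivative D t) (at t)"
    "\<And>t. \<gamma> (circle_cover t) \<in> p ` V \<Longrightarrow> isCont D t" "\<And>t. \<gamma> (circle_cover t) \<in> p ` V \<Longrightarrow> D t \<noteq> 0"
    using chart_derivative[OF V(4)] by blast
  have mem: "\<gamma> (circle_cover s) \<in> p ` V" if "c s \<in> V" for s
    using c that by (metis cover_of_curve_def imageI)
  have eq: "?f s = c s" if "c s \<in> V" for s
    using c V(5)[OF that] by (simp add: cover_of_curve_def)
  have op: "open (c -` V)"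
    using c V(1) unfolding cover_of_curve_def by (metis open_vimage)
  show ?thesis
  proof (rule that[OF V(1,2,4) mem])
    fix s assume s: "c s \<in> V"
    show "(?f has_vector_derivative D s) (at s)" by (rule D(1)[OF mem[OF s]])
    then show "(c has_vector_derivative D s) (at s)"
      by (rule has_vector_derivative_transform_within_open[OF _ op]) (use s eq in auto)
    show "isCont D s" "D s \<noteq> 0" using D(2,3) mem[OF s] by auto
  qed
qed

lemma cover_C1:
  assumes c: "cover_of_curve g p \<gamma> c"
  shows "(c has_vector_derivative vector_derivative c (at t)) (at t)"
    and "continuous_on UNIV (\<lambda>t. vector_derivative c (at t))" and "vector_derivative c (at t) \<noteq> 0"
proof -
  have main: "(c has_vector_derivative vector_derivative c (at t)) (at t) \<and>
     isCont (\<lambda>t. vector_derivative c (at t)) t \<and> vector_derivative c (at t) \<noteq> 0" for t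
  proof -
    obtain V f D where V: "open V" "c t \<in> V" "\<And>s. c s \<in> V \<Longrightarrow> (c has_vector_derivative D s) (at s)"
      "\<And>s. c s \<in> V \<Longrightarrow> isCont D s" "\<And>s. c s \<in> V \<Longrightarrow> D s \<noteq> 0"
      using cover_in_chart[OF c, of t] by metis
    have eq: "vector_derivative c (at s) = D s" if "c s \<in> V" for s using vector_derivative_at[OF V(3)[OF that]] .
    have "open (c -` V)" using c V(1) unfolding cover_of_curve_def by (metis open_vimage)
    then have "eventually (\<lambda>s. s \<in> c -` V) (nhds t)" using V(2) by (intro eventually_nhds_in_open) auto
    then have "eventually (\<lambda>s. vector_derivative c (at s) = D s) (nhds t)"
      by eventually_elim (use eq in auto)
    then have "isCont (\<lambda>t. vector_derivative c (at t)) t = isCont D t" by (rule isCont_cong)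
    then have "isCont (\<lambda>t. vector_derivative c (at t)) t" using V(4)[OF V(2)] by simp
    then show ?thesis using eq V by auto
  qed
  show "(c has_vector_derivative vector_derivative c (at t)) (at t)" "vector_derivative c (at t) \<noteq> 0"
    "continuous_on UNIV (\<lambda>t. vector_derivative c (at t))"
    using main by (auto intro: continuous_at_imp_continuous_on)
qed

lemma cover_transversal:
  assumes c: "cover_of_curve g p \<gamma> c" and "c s = c t" "circle_cover s \<noteq> circle_cover t"
  shows "cross2 (vector_derivative c (at s)) (vector_derivative c (at t)) \<noteq> 0"
proof -
  obtain V f D where V: "c s \<in> V" "isometric_chart g M (p ` V) f"
    "\<And>s. c s \<in> V \<Longrightarrow> \<gamma> (circle_cover s) \<in> p ` V"
    "\<And>s. c s \<in> V \<Longrightarrow> ((f \<circ> \<gamma> \<circ> circle_cover) has_vector_derivative D s) (at s)"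
    "\<And>s. c s \<in> V \<Longrightarrow> (c has_vector_derivative D s) (at s)"
    using cover_in_chart[OF c, of s] by metis
  have t: "c t \<in> V" using V(1) assms(2) by simp
  have "\<gamma> (circle_cover s) = \<gamma> (circle_cover t)" using c assms(2) by (metis cover_of_curve_def)
  then have "cross2 (vector_derivative (f \<circ> \<gamma> \<circ> circle_cover) (at s))
      (vector_derivative (f \<circ> \<gamma> \<circ> circle_cover) (at t)) \<noteq> 0"
    using generic assms(3) V(2) V(3)[OF V(1)] unfolding generic_curve_def by blast
  then show ?thesis
    using V(4,5)[OF V(1)] V(4,5)[OF t] by (metis vector_derivative_at)
qed

text \<open>Pairs of distinct circle points with equal images accumulate nowhere in the parameter
  plane: not where the images differ, not on the diagonal by local injectivity, and not at a
  crossing by transversality. Finiteness matters because a sum over an infinite set is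
  \<open>0\<close> by convention.\<close>

lemma finite_double_points: "finite (double_points \<gamma>)"
proof -
  define Z where "Z = {q. circle_cover (fst q) \<noteq> circle_cover (snd q) \<and>
    \<gamma> (circle_cover (fst q)) = \<gamma> (circle_cover (snd q))}"
  have "\<not> q islimpt Z" for q
  proof -
    obtain s0 t0 where q: "q = (s0, t0)" by (cases q)
    have "\<exists>\<delta>>0. \<forall>s t. \<bar>s - s0\<bar> < \<delta> \<longrightarrow> \<bar>t - t0\<bar> < \<delta> \<longrightarrow> (s, t) \<in> Z \<longrightarrow> s = s0 \<and> t = t0"
    proof (cases "\<gamma> (circle_cover s0) = \<gamma> (circle_cover t0)")
      case False
      have "open {q. \<gamma> (circle_cover (fst q)) \<noteq> \<gamma> (circle_cover (snd q))}"
        by (intro open_Collect_neq continuous_on_compose2[OF continuous_curve] continuous_intros) auto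
      moreover have "(s0, t0) \<in> {q. \<gamma> (circle_cover (fst q)) \<noteq> \<gamma> (circle_cover (snd q))}" using False by simp
      ultimately obtain e where e: "e > 0"
        "ball (s0, t0) e \<subseteq> {q. \<gamma> (circle_cover (fst q)) \<noteq> \<gamma> (circle_cover (snd q))}"
        using openE by blast
      show ?thesis
      proof (intro exI[of _ "e / 2"] conjI allI impI)
        show "e / 2 > 0" using e by simp
        fix s t assume st: "\<bar>s - s0\<bar> < e / 2" "\<bar>t - t0\<bar> < e / 2" "(s, t) \<in> Z"
        have "dist (s0, t0) (s, t) \<le> dist s0 s + dist t0 t"
          by (simp add: dist_Pair_Pair sqrt_sum_squares_le_sum)
        then have "(s, t) \<in> ball (s0, t0) e" using st(1,2) unfolding mem_ball dist_real_def by linarith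
        then have False using e st(3) by (auto simp: Z_def)
        then show "s = s0" "t = t0" by auto
      qed
    next
      case True
      obtain z where z: "z \<in> model_plane g" "p z = \<gamma> (circle_cover s0)"
        using curve_in[of s0] covering_space_imp_surjective[OF covering_space] by (metis imageE)
      obtain V where V: "z \<in> V" "isometric_chart g M (p ` V) (inv_into V p)"
        using local_chart[OF z(1)] by metis
      let ?f = "inv_into V p \<circ> \<gamma> \<circ> circle_cover" and ?S = "{t. \<gamma> (circle_cover t) \<in> p ` V}"
      obtain D where D: "\<And>t. \<gamma> (circle_cover t) \<in> p ` V \<Longrightarrow> (?f has_vector_derivative D t) (at t)"
        "\<And>t. \<gamma> (circle_cover t) \<in> p ` V \<Longrightarrow> isCont D t" "\<And>t. \<gamma> (circle_cover t) \<in> p ` V \<Longrightarrow> D t \<noteq> 0"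
        using chart_derivative[OF V(2)] by blast
      have D1: "\<And>t. t \<in> ?S \<Longrightarrow> (?f has_vector_derivative D t) (at t)" using D(1) by simp
      note op = open_chart_times[OF V(2)]
      have "\<gamma> (circle_cover s0) \<in> p ` V" using V(1) z(2) by (metis imageI)
      then have s0: "s0 \<in> ?S" and t0: "t0 \<in> ?S" using True by simp_all
      show ?thesis
      proof (cases "circle_cover s0 = circle_cover t0")
        case True
        \<comment> \<open>The parameters may lie in different periods; shifting \<open>t\<close> by
          \<open>k\<close> brings both near \<open>s0\<close>.\<close>
        then obtain k :: int where k: "t0 = s0 + of_int k" using circle_cover_eq_iff by metis
        obtain \<delta> where \<delta>: "\<delta> > 0"
          "\<And>x y. \<bar>x - s0\<bar> < \<delta> \<Longrightarrow> \<bar>y - s0\<bar> < \<delta> \<Longrightarrow> ?f x = ?f y \<Longrightarrow> x = y"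
          using immersion_locally_injective[of ?S s0 ?f D, OF op s0 D1] D(2)[of s0] D(3)[of s0] s0 by blast
        show ?thesis
        proof (intro exI[of _ \<delta>] conjI allI impI \<delta>(1))
          fix s t assume st: "\<bar>s - s0\<bar> < \<delta>" "\<bar>t - t0\<bar> < \<delta>" "(s, t) \<in> Z"
          have t: "circle_cover (t - of_int k) = circle_cover t"
            using circle_cover_add_int[of "t - of_int k" k] by simp
          then have "?f s = ?f (t - of_int k)" using st(3) by (simp add: Z_def)
          then have "s = t - of_int k" using \<delta>(2)[of s "t - of_int k"] st k by simp
          then have False using t st(3) by (simp add: Z_def)
          then show "s = s0" "t = t0" by auto
        qed
      next
        case False
        have "cross2 (D s0) (D t0) \<noteq> 0"
        proof -
          have "cross2 (vector_derivative ?f (at s0)) (vector_derivative ?f (at t0)) \<noteq> 0"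
            using generic False True V(2) s0 unfolding generic_curve_def by blast
          then show ?thesis using vector_derivative_at[OF D1[OF s0]] vector_derivative_at[OF D1[OF t0]] by simp
        qed
        moreover have "?f s0 = ?f t0" using True by simp
        ultimately obtain \<delta> where \<delta>: "\<delta> > 0"
          "\<And>s t. \<bar>s - s0\<bar> < \<delta> \<Longrightarrow> \<bar>t - t0\<bar> < \<delta> \<Longrightarrow> ?f s = ?f t \<Longrightarrow> s = s0 \<and> t = t0"
          using transversal_intersection_isolated[of ?S s0 ?f D ?S t0 ?f D, OF op s0 D1 _ op t0 D1]
            D(2)[of s0] D(2)[of t0] s0 t0 by blast
        then show ?thesis by (intro exI[of _ \<delta>]) (auto simp: Z_def)
      qed
    qed
    then obtain \<delta> where \<delta>: "\<delta> > 0" "\<And>s t. \<bar>s - s0\<bar> < \<delta> \<Longrightarrow> \<bar>t - t0\<bar> < \<delta> \<Longrightarrow> (s, t) \<in> Z \<Longrightarrow> s = s0 \<and> t = t0"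
      by blast
    show ?thesis unfolding islimpt_approachable
    proof
      assume "\<forall>e>0. \<exists>x'\<in>Z. x' \<noteq> q \<and> dist x' q < e"
      then obtain x where x: "x \<in> Z" "x \<noteq> q" "dist x q < \<delta>" using \<delta>(1) by blast
      have "\<bar>fst x - s0\<bar> < \<delta>" "\<bar>snd x - t0\<bar> < \<delta>"
        using x(3) dist_fst_le[of x q] dist_snd_le[of x q] by (auto simp: q dist_real_def)
      then have "fst x = s0 \<and> snd x = t0" using \<delta>(2)[of "fst x" "snd x"] x(1) by simp
      then show False using x(2) q by (simp add: prod_eq_iff)
    qed
  qed
  then have fin: "finite (({0..1} \<times> {0..1}) \<inter> Z)"
    by (intro finite_not_islimpt_in_compact compact_Times) auto
  have "double_points \<gamma> \<subseteq> (\<lambda>q. \<gamma> (circle_cover (fst q))) ` (({0..1} \<times> {0..1}) \<inter> Z)"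
  proof
    fix d assume "d \<in> double_points \<gamma>"
    then obtain x y where xy: "x \<in> sphere 0 1" "y \<in> sphere 0 1" "x \<noteq> y" "\<gamma> x = d" "\<gamma> y = d"
      by (auto simp: double_points_def)
    obtain s t where "0 \<le> s" "s < 1" "circle_cover s = x" "0 \<le> t" "t < 1" "circle_cover t = y"
      using circle_cover_surj[OF xy(1)] circle_cover_surj[OF xy(2)] by metis
    then have "(s, t) \<in> ({0..1} \<times> {0..1}) \<inter> Z" "d = \<gamma> (circle_cover (fst (s, t)))"
      using xy by (auto simp: Z_def)
    then show "d \<in> (\<lambda>q. \<gamma> (circle_cover (fst q))) ` (({0..1} \<times> {0..1}) \<inter> Z)" by blast
  qed
  then show ?thesis using fin finite_surj by blast
qed

lemma two_preimages:
  assumes "x \<in> sphere 0 1" "y \<in> sphere 0 1" "z \<in> sphere 0 1" "\<gamma> x = d" "\<gamma> y = d" "\<gamma> z = d"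
  shows "x = y \<or> x = z \<or> y = z"
proof (rule ccontr)
  assume ne: "\<not> ?thesis"
  then have "d \<in> double_points \<gamma>" using assms unfolding double_points_def by blast
  then have 2: "card {x \<in> sphere 0 1. \<gamma> x = d} = 2" using generic unfolding generic_curve_def by blast
  \<comment> \<open>An infinite set would have cardinality \<open>0\<close>, so the value
    \<open>2\<close> also yields finiteness.\<close>
  then have "finite {x \<in> sphere 0 1. \<gamma> x = d}" by (metis card.infinite zero_neq_numeral)
  moreover have "{x, y, z} \<subseteq> {x \<in> sphere 0 1. \<gamma> x = d}" using assms by auto
  ultimately have "card {x, y, z} \<le> 2" using card_mono 2 by metis
  then show False using ne by simp
qed

text \<open>The right-hand side does not mention \<open>c\<close>: whether a pair of parameters
  closes up is the same for all covers.\<close>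

lemma cover_closed_iff:
  assumes c: "cover_of_curve g p \<gamma> c"
  shows "c s = c t \<longleftrightarrow> null_homotopic_loop M (curve_arc \<gamma> s t)"
proof -
  define h where "h u = c (s + u * (t - s))" for u
  have cont: "continuous_on UNIV c" and im: "range c \<subseteq> model_plane g"
    and p: "\<And>t. p (c t) = \<gamma> (circle_cover t)"
    using c by (auto simp: cover_of_curve_def)
  have "path h" unfolding path_def h_def
    by (intro continuous_on_compose2[OF cont] continuous_intros) auto
  moreover have "path_image h \<subseteq> model_plane g" using im by (auto simp: path_image_def h_def)
  moreover have "p \<circ> h = curve_arc \<gamma> s t" by (simp add: o_def h_def curve_arc_def p)
  ultimately have "pathfinish h = pathstart h \<longleftrightarrow> null_homotopic_loop M (curve_arc \<gamma> s t)"
    using closed_lift_iff_null_homotopic[OF covering_space simply_connected_model_plane] by metis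
  then show ?thesis by (simp add: h_def pathfinish_def pathstart_def eq_commute)
qed

lemma cover_sgn_odd:
  assumes "cover_of_curve g p \<gamma> c" "c s = c t" "circle_cover s \<noteq> circle_cover t"
  shows "odd (cover_sgn c s t)"
  using cover_transversal[OF assms] by (auto simp: cover_sgn_def Let_def)

end

section \<open>The winding number of an orientation reversing curve\<close>

lemma deck_compose:
  assumes "deck_transformation g p S" "deck_transformation g p T"
  shows "deck_transformation g p (\<lambda>z. S (T z))"
proof -
  obtain S' T' where h: "homeomorphism (model_plane g) (model_plane g) S S'"
    "homeomorphism (model_plane g) (model_plane g) T T'"
    using assms unfolding deck_transformation_def by blast
  have "homeomorphism (model_plane g) (model_plane g) (\<lambda>z. S (T z)) (T' \<circ> S')"
    using homeomorphism_compose[OF h(2,1)] by (simp add: comp_def)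
  moreover have "p (S (T z)) = p z" if "z \<in> model_plane g" for z
    using assms deck_in_model[OF assms(2) that] that by (simp add: deck_transformation_def)
  ultimately show ?thesis unfolding deck_transformation_def by blast
qed

lemma even_sum_odd_iff:
  fixes f :: "'b \<Rightarrow> int"
  assumes "finite A" "\<And>a. a \<in> A \<Longrightarrow> odd (f a)"
  shows "even (sum f A) \<longleftrightarrow> even (card A)"
  using assms by (induction A) auto

lemma double_pointI:
  assumes "circle_cover s \<noteq> circle_cover t" "\<gamma> (circle_cover s) = d" "\<gamma> (circle_cover t) = d"
  shows "d \<in> double_points \<gamma>"
  unfolding double_points_def mem_Collect_eq
  by (rule bexI[OF bexI[OF _ circle_cover_in_sphere[of t]] circle_cover_in_sphere[of s]]) (use assms in simp)

lemma double_points_pmI: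
  assumes "d \<in> double_points \<gamma>" "0 \<le> s" "s < t" "t < 1" "\<gamma> (circle_cover s) = d" "\<gamma> (circle_cover t) = d"
    "null_homotopic_loop M (curve_arc \<gamma> s t) \<or> null_homotopic_loop M (curve_arc \<gamma> t (s + 1))"
  shows "d \<in> double_points_pm M \<gamma>"
  unfolding double_points_pm_def mem_Collect_eq
  by (rule conjI[OF assms(1)], rule exI[of _ s], rule exI[of _ t]) (use assms in simp)

lemma mod2_class_cong:
  assumes "even a \<longleftrightarrow> even b"
  shows "mod2_class a = mod2_class b"
proof -
  have mem: "n \<in> mod2_class m \<longleftrightarrow> even (n - m)" for n m
  proof
    assume "even (n - m)"
    then obtain k where "n - m = 2 * k" by (rule evenE)
    then have "n = m + 2 * k" by simp
    then show "n \<in> mod2_class m" unfolding mod2_class_def by blast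
  qed (auto simp: mod2_class_def)
  show ?thesis using assms by (intro set_eqI) (simp add: mem)
qed

context covered_curve
begin

text \<open>Two covers differ by a deck transformation, which conjugates their period transformations.\<close>

lemma period_orientation_reversing:
  assumes c0: "cover_of_curve g p \<gamma> c0" "period_deck g p c0 T0" "orientation_reversing_on (model_plane g) T0"
    and c: "cover_of_curve g p \<gamma> c" "period_deck g p c T"
  shows "orientation_reversing_on (model_plane g) T"
proof (rule ccontr)
  assume not_rev: "\<not> ?thesis"
  have dT0: "deck_transformation g p T0" and dT: "deck_transformation g p T"
    using c0 c by (auto simp: period_deck_def)
  have pres: "orientation_preserving_on (model_plane g) T"
    using deck_orientation[OF covering dT] not_rev by blast
  have mem: "c0 t \<in> model_plane g" "c t \<in> model_plane g" for t
    using c0 c by (auto simp: cover_of_curve_def)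
  have pc: "p (c0 t) = \<gamma> (circle_cover t)" "p (c t) = \<gamma> (circle_cover t)" for t
    using c0 c by (auto simp: cover_of_curve_def)
  obtain S where S: "deck_transformation g p S" "S (c0 0) = c 0"
    using deck_transitive[OF covering_space mem, of 0 0] pc by metis
  \<comment> \<open>Both sides are lifts of the same curve, and they agree at
    \<open>0\<close>.\<close>
  have Sc: "S (c0 t) = c t" for t
  proof (rule covering_space_lift_unique[where f = "\<lambda>t. \<gamma> (circle_cover t)" and ?g1.0 = "\<lambda>t. S (c0 t)" and
        ?g2.0 = c and T = UNIV and a = 0, OF covering_space])
    show "continuous_on UNIV (\<lambda>t. S (c0 t))"
      using c0(1) mem by (intro continuous_on_compose2[OF deck_continuous[OF S(1)]]) (auto simp: cover_of_curve_def)
    show "continuous_on UNIV c" using c(1) by (simp add: cover_of_curve_def)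
    show "(\<lambda>t. S (c0 t)) \<in> UNIV \<rightarrow> model_plane g" using deck_in_model[OF S(1)] mem by auto
    show "\<gamma> (circle_cover t) = p (S (c0 t))" for t
      using S(1) mem pc unfolding deck_transformation_def by metis
  qed (use continuous_curve curve_in mem pc S(2) in auto)
  define z where "z = c0 0"
  have z: "z \<in> model_plane g" using mem by (simp add: z_def)
  have "T (S z) = S (T0 z)"
    using c0(2) c(2) Sc[of 0] Sc[of "0 + 1"] by (simp add: z_def period_deck_def)
  then have comm: "T (S w) = S (T0 w)" if "w \<in> model_plane g" for w
    using deck_unique[OF covering_space deck_compose[OF dT S(1)] deck_compose[OF S(1) dT0] z _ that] by blast
  have Sz: "S z \<in> model_plane g" "T0 z \<in> model_plane g"
    using deck_in_model[OF S(1) z] deck_in_model[OF dT0 z] by auto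
  obtain \<tau> where \<tau>: "(T has_derivative \<tau>) (at (S z))" "cross2 (\<tau> 1) (\<tau> \<i>) > 0"
    using pres Sz(1) unfolding orientation_preserving_on_def by blast
  obtain \<tau>0 where \<tau>0: "(T0 has_derivative \<tau>0) (at z)" "cross2 (\<tau>0 1) (\<tau>0 \<i>) < 0"
    using c0(3) z unfolding orientation_reversing_on_def by blast
  \<comment> \<open>\<open>S\<close> behaves alike at \<open>z\<close> and at \<open>T0 z\<close>,
    so the two sides of \<open>T (S w) = S (T0 w)\<close> would have determinants of opposite sign
    at \<open>z\<close>.\<close>
  obtain \<sigma> \<sigma>' where \<sigma>: "(S has_derivative \<sigma>) (at z)" "(S has_derivative \<sigma>') (at (T0 z))"
    "cross2 (\<sigma> 1) (\<sigma> \<i>) * cross2 (\<sigma>' 1) (\<sigma>' \<i>) > 0"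
    using deck_orientation[OF covering S(1)] z Sz(2)
    unfolding orientation_preserving_on_def orientation_reversing_on_def
    by (metis mult_neg_neg mult_pos_pos)
  have F: "((\<lambda>w. S (T0 w)) has_derivative (\<lambda>v. \<sigma>' (\<tau>0 v))) (at z)"
    using diff_chain_at[OF \<tau>0(1) \<sigma>(2)] by (simp add: o_def)
  then have F': "((\<lambda>w. T (S w)) has_derivative (\<lambda>v. \<sigma>' (\<tau>0 v))) (at z)"
    by (rule has_derivative_transform_within_open[OF _ open_model_plane z]) (use comm in auto)
  have "cross2 (\<sigma>' 1) (\<sigma>' \<i>) * cross2 (\<tau>0 1) (\<tau>0 \<i>) = cross2 (\<tau> 1) (\<tau> \<i>) * cross2 (\<sigma> 1) (\<sigma> \<i>)"
    using orientation_compose[OF \<tau>0(1) \<sigma>(2) F] orientation_compose[OF \<sigma>(1) \<tau>(1) F'] by simp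
  then show False using \<tau>(2) \<tau>0(2) \<sigma>(3)
    by (smt (verit) mult_neg_neg mult_neg_pos mult_pos_neg mult_pos_pos zero_less_mult_iff)
qed

lemma glide_curve_of_cover:
  assumes c: "cover_of_curve g p \<gamma> c" "period_deck g p c T" and st: "straightening g T \<Phi> l R"
    and \<theta>: "continuous_on UNIV \<theta>"
      "\<And>t. \<exists>r>0. vector_derivative c (at t) * deriv \<Phi> (c t) = of_real r * cis (\<theta> t)"
  shows "glide_curve (\<lambda>t. \<Phi> (c t)) (\<lambda>t. vector_derivative c (at t) * deriv \<Phi> (c t)) l \<theta>"
proof -
  interpret straightening g T \<Phi> l R by (rule st)
  have mem: "c t \<in> model_plane g" for t using c by (auto simp: cover_of_curve_def)
  have contc: "continuous_on UNIV c" using c by (simp add: cover_of_curve_def)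
  have eqI: "c s = c t" if "\<Phi> (c s) = \<Phi> (c t)" for s t using inj_onD[OF inj that mem mem] .
  have circle: "\<gamma> (circle_cover s) = \<gamma> (circle_cover t)" if "c s = c t" for s t
    using c(1) that by (metis cover_of_curve_def)
  show ?thesis
  proof
    fix t
    show "((\<lambda>t. \<Phi> (c t)) has_vector_derivative vector_derivative c (at t) * deriv \<Phi> (c t)) (at t)"
      by (rule has_vector_derivative_compose[OF mem cover_C1(1)[OF c(1)] refl])
    show "vector_derivative c (at t) * deriv \<Phi> (c t) \<noteq> 0"
      using cover_C1(3)[OF c(1)] deriv_nonzero[OF mem] by simp
    show "\<Phi> (c (t + 1)) = cnj (\<Phi> (c t)) + of_real l"
      using glide(2)[OF mem[of t]] c(2) by (simp add: period_deck_def)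
    obtain r where "r > 0" "vector_derivative c (at t) * deriv \<Phi> (c t) = of_real r * cis (\<theta> t)"
      using \<theta>(2) by blast
    then show "vector_derivative c (at t) * deriv \<Phi> (c t) =
        of_real (cmod (vector_derivative c (at t) * deriv \<Phi> (c t))) * cis (\<theta> t)"
      by (simp only: norm_mult norm_of_real norm_cis abs_of_pos) simp
  next
    have "continuous_on (model_plane g) (deriv \<Phi>)"
      using holomorphic_deriv[OF holo open_model_plane] by (rule holomorphic_on_imp_continuous_on)
    then show "continuous_on UNIV (\<lambda>t. vector_derivative c (at t) * deriv \<Phi> (c t))"
      by (intro continuous_intros cover_C1(2)[OF c(1)] continuous_on_compose2[OF _ contc]) (use mem in auto)
  next
    fix s t :: real assume st: "s < t" "t < s + 1" "\<Phi> (c s) = \<Phi> (c t)"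
    have "circle_cover s \<noteq> circle_cover t" using circle_cover_inj[of s t] st by auto
    then have "cross2 (vector_derivative c (at s)) (vector_derivative c (at t)) \<noteq> 0"
      using cover_transversal[OF c(1) eqI[OF st(3)]] by blast
    \<comment> \<open>At a crossing both velocities are multiplied by the same nonzero number, so
      transversality survives the change of coordinate.\<close>
    moreover have "deriv \<Phi> (c s) \<noteq> 0" by (rule deriv_nonzero[OF mem])
    ultimately show "cross2 (vector_derivative c (at s) * deriv \<Phi> (c s)) (vector_derivative c (at t) * deriv \<Phi> (c t)) \<noteq> 0"
      unfolding eqI[OF st(3), symmetric] mult.commute[of _ "deriv \<Phi> (c s)"] cross2_mult by simp
  next
    fix s t t' :: real
    assume *: "s < t" "t < s + 1" "s < t'" "t' < s + 1" "\<Phi> (c s) = \<Phi> (c t)" "\<Phi> (c s) = \<Phi> (c t')"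
    have "circle_cover s \<noteq> circle_cover t" "circle_cover s \<noteq> circle_cover t'"
      using circle_cover_inj[of s t] circle_cover_inj[of s t'] * by auto
    then have "circle_cover t = circle_cover t'"
      using two_preimages[OF circle_cover_in_sphere circle_cover_in_sphere circle_cover_in_sphere refl
          circle[OF eqI[OF *(5)], symmetric] circle[OF eqI[OF *(6)], symmetric]] by blast
    then show "t = t'" by (rule circle_cover_inj) (use * in auto)
  qed (use \<theta> l_pos in auto)
qed

text \<open>The real part of \<open>\<Phi> (c t)\<close> grows by \<open>l\<close> in every
  period.\<close>

lemma cover_aperiodic:
  assumes c: "cover_of_curve g p \<gamma> c" "period_deck g p c T" and st: "straightening g T \<Phi> l R"
    and eq: "c (t + of_int k) = c t"
  shows "k = 0"
proof -
  interpret straightening g T \<Phi> l R by (rule st)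
  have mem: "c t \<in> model_plane g" for t using c by (auto simp: cover_of_curve_def)
  have step: "Re (\<Phi> (c (t + 1))) = Re (\<Phi> (c t)) + l" for t
    using glide(2)[OF mem[of t]] c(2) by (simp add: period_deck_def)
  have nat: "Re (\<Phi> (c (t + of_nat n))) = Re (\<Phi> (c t)) + of_nat n * l" for t n
  proof (induction n)
    case (Suc n)
    then show ?case using step[of "t + of_nat n"] by (simp add: algebra_simps)
  qed simp
  show ?thesis
  proof (cases "k \<ge> 0")
    case True
    then have "of_nat (nat k) * l = 0" using nat[of t "nat k"] eq by simp
    then show ?thesis using l_pos True by simp
  next
    case False
    then have "of_nat (nat (- k)) * l = 0" using nat[of "t + of_int k" "nat (- k)"] eq by simp
    then show ?thesis using l_pos False by simp
  qed
qed

text \<open>The two loops at a double point lift to the arcs from \<open>s\<close> to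
  \<open>t\<close> and from \<open>t\<close> to \<open>s + 1\<close>. They cannot both close, since
  that would give \<open>c s = c (s + 1)\<close>; so just one of the two parameters in
  \<open>[0, 1)\<close> starts a closed arc.\<close>

lemma double_points_pm_bij:
  assumes c: "cover_of_curve g p \<gamma> c" and aper: "\<And>t. c (t + 1) \<noteq> c t"
  shows "bij_betw (\<lambda>s. \<gamma> (circle_cover s)) {s. 0 \<le> s \<and> s < 1 \<and> (\<exists>t. s < t \<and> t < s + 1 \<and> c s = c t)}
    (double_points_pm M \<gamma>)"
    (is "bij_betw ?f ?B _")
proof -
  have circle: "?f s = ?f t" if "c s = c t" for s t
    using c(1) that by (metis cover_of_curve_def)
  have two: "circle_cover t = circle_cover t'"
    if "circle_cover s \<noteq> circle_cover t" "circle_cover s \<noteq> circle_cover t'" "?f s = ?f t" "?f s = ?f t'" for s t t'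
    using two_preimages[OF circle_cover_in_sphere circle_cover_in_sphere circle_cover_in_sphere refl
        that(3,4)[symmetric]] that(1,2) by blast
  have less: False if s: "s \<in> ?B" "s' \<in> ?B" "s < s'" "?f s = ?f s'" for s s'
  proof -
    obtain t where t: "s < t" "t < s + 1" "c s = c t" using s(1) by blast
    obtain t' where t': "s' < t'" "t' < s' + 1" "c s' = c t'" using s(2) by blast
    have b: "0 \<le> s" "s' < 1" using s by auto
    have ne: "circle_cover s \<noteq> circle_cover t" "circle_cover s \<noteq> circle_cover s'" "circle_cover s' \<noteq> circle_cover t'"
      using circle_cover_inj[of s t] circle_cover_inj[of s s'] circle_cover_inj[of s' t'] t t' s(3) b by auto
    \<comment> \<open>With only two preimages, \<open>s\<close> and \<open>s'\<close> are partners
      of each other, which forces \<open>t = s'\<close> and \<open>t' = s + 1\<close>.\<close>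
    have "circle_cover t = circle_cover s'" using two[OF ne(1,2) circle[OF t(3)] s(4)] .
    then have ts: "t = s'" by (rule circle_cover_inj) (use t s(3) b in auto)
    have "circle_cover s = circle_cover t'"
      using two[OF ne(2)[symmetric] ne(3) s(4)[symmetric] circle[OF t'(3)]] .
    then have "circle_cover t' = circle_cover (s + 1)" using circle_cover_add_int[of s 1] by simp
    then have "t' = s + 1" by (rule circle_cover_inj) (use t' s(3) b in auto)
    then show False using aper[of s] t(3) t'(3) ts by simp
  qed
  have "inj_on ?f ?B"
  proof (rule inj_onI)
    fix s s' assume *: "s \<in> ?B" "s' \<in> ?B" "?f s = ?f s'"
    show "s = s'" using less[OF *(1,2) _ *(3)] less[OF *(2,1) _ *(3)[symmetric]]
      by (cases s s' rule: linorder_cases) blast+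
  qed
  moreover have "?f ` ?B = double_points_pm M \<gamma>"
  proof (intro equalityI subsetI)
    fix d assume "d \<in> ?f ` ?B"
    then obtain s t where s: "0 \<le> s" "s < 1" "s < t" "t < s + 1" "c s = c t" "d = ?f s" by blast
    have "circle_cover s \<noteq> circle_cover t" using circle_cover_inj[of s t] s by auto
    then have dp: "d \<in> double_points \<gamma>"
      by (rule double_pointI) (use circle[OF s(5)] s(6) in auto)
    have null: "null_homotopic_loop M (curve_arc \<gamma> s t)" using cover_closed_iff[OF c] s(5) by blast
    show "d \<in> double_points_pm M \<gamma>"
    proof (cases "t < 1")
      case True
      show ?thesis by (rule double_points_pmI[OF dp s(1,3) True]) (use null s(6) circle[OF s(5)] in auto)
    next
      case False
      \<comment> \<open>The closed arc runs past \<open>1\<close>. The parameters in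
        \<open>[0, 1)\<close> are now \<open>t - 1 < s\<close>, and the arc from \<open>s\<close> to
        \<open>t\<close> is the second loop in the definition.\<close>
      have "circle_cover (t - 1) = circle_cover t" using circle_cover_add_int[of "t - 1" 1] by simp
      then have e: "?f (t - 1) = d" "?f s = d" using circle[OF s(5)] s(6) by auto
      have "0 \<le> t - 1" "t - 1 < s" using False s by auto
      then show ?thesis by (rule double_points_pmI[OF dp _ _ s(2) e]) (use null in simp)
    qed
  next
    fix d assume "d \<in> double_points_pm M \<gamma>"
    then obtain s t where st: "0 \<le> s" "s < t" "t < 1" "?f s = d" "?f t = d"
      "null_homotopic_loop M (curve_arc \<gamma> s t) \<or> null_homotopic_loop M (curve_arc \<gamma> t (s + 1))"
      unfolding double_points_pm_def by blast
    then consider "c s = c t" | "c t = c (s + 1)" using cover_closed_iff[OF c] by blast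
    then show "d \<in> ?f ` ?B"
    proof cases
      case 1
      then have "s \<in> ?B" using st by auto
      then show ?thesis using st(4) by blast
    next
      case 2
      then have "t \<in> ?B" using st by (auto intro!: exI[of _ "s + 1"])
      then show ?thesis using st(5) by blast
    qed
  qed
  ultimately show ?thesis by (simp add: bij_betw_def)
qed

text \<open>The choice in \<open>curve_sgn\<close> may involve any cover, but by
  \<open>cover_closed_iff\<close> its parameters also close up \<open>c0\<close>. Aperiodicity of
  \<open>c0\<close> makes them different points of the circle, so the crossing is transversal and
  the sign is \<open>1\<close> or \<open>- 1\<close>.\<close>

lemma curve_sgn_odd:
  assumes c0: "cover_of_curve g p \<gamma> c0" and aper: "\<And>t k. c0 (t + of_int k) = c0 t \<Longrightarrow> k = 0"
    and d: "d \<in> double_points_pm M \<gamma>"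
  shows "odd (curve_sgn g M p \<gamma> d)"
proof -
  let ?P = "\<lambda>e. \<exists>c t1 t2. cover_of_curve g p \<gamma> c \<and> t1 < t2 \<and> c t1 = c t2 \<and> p (c t1) = d \<and> e = cover_sgn c t1 t2"
  have pc: "p (c0 t) = \<gamma> (circle_cover t)" for t using c0 by (simp add: cover_of_curve_def)
  obtain s t where st: "s < t" "t < 1" "0 \<le> s" "\<gamma> (circle_cover s) = d" "\<gamma> (circle_cover t) = d"
    "null_homotopic_loop M (curve_arc \<gamma> s t) \<or> null_homotopic_loop M (curve_arc \<gamma> t (s + 1))"
    using d unfolding double_points_pm_def by blast
  then have "c0 s = c0 t \<or> c0 t = c0 (s + 1)" using cover_closed_iff[OF c0] by blast
  then have "\<exists>t1 t2. t1 < t2 \<and> c0 t1 = c0 t2 \<and> p (c0 t1) = d"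
  proof
    assume e: "c0 s = c0 t"
    show ?thesis by (rule exI[of _ s], rule exI[of _ t]) (use e st pc in simp)
  next
    assume e: "c0 t = c0 (s + 1)"
    show ?thesis by (rule exI[of _ t], rule exI[of _ "s + 1"]) (use e st(1-3,5) pc[of t] in simp)
  qed
  then obtain t1 t2 where "t1 < t2" "c0 t1 = c0 t2" "p (c0 t1) = d" by blast
  then have "?P (cover_sgn c0 t1 t2)" using c0 by blast
  then have "?P (SOME e. ?P e)" by (rule someI)
  then obtain c t1 t2 where c: "cover_of_curve g p \<gamma> c" "t1 < t2" "c t1 = c t2"
    and e: "(SOME e. ?P e) = cover_sgn c t1 t2" by blast
  have e0: "c0 t1 = c0 t2" using c(3) cover_closed_iff[OF c(1)] cover_closed_iff[OF c0] by blast
  have "circle_cover t2 \<noteq> circle_cover t1"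
  proof
    assume "circle_cover t2 = circle_cover t1"
    then obtain k :: int where k: "t2 = t1 + of_int k" using circle_cover_eq_iff by blast
    then have "k = 0" using e0 by (intro aper[of t1]) simp
    then show False using k c(2) by simp
  qed
  then have "odd (cover_sgn c t1 t2)" by (intro cover_sgn_odd[OF c(1,3)]) auto
  then show ?thesis using d e by (simp add: curve_sgn_def)
qed

lemma winding_number_parity:
  assumes c: "cover_of_curve g p \<gamma> c" "period_deck g p c T" and st: "straightening g T \<Phi> l R"
    and X: "generating_field g T X" and \<theta>: "angle_function X c \<theta>" "(\<theta> 0 + \<theta> 1) / (2 * pi) = of_int m"
  shows "even m \<longleftrightarrow> even (card (double_points_pm M \<gamma>))"
proof -
  interpret S: straightening g T \<Phi> l R by (rule st)
  have mem: "c t \<in> model_plane g" for t using c by (auto simp: cover_of_curve_def)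
  interpret C: glide_curve "\<lambda>t. \<Phi> (c t)" "\<lambda>t. vector_derivative c (at t) * deriv \<Phi> (c t)" l \<theta>
  proof (rule glide_curve_of_cover[OF c st])
    show "continuous_on UNIV \<theta>" using \<theta> by (simp add: angle_function_def)
    fix t
    obtain r where r: "r > 0" "vector_derivative c (at t) = of_real r * cis (\<theta> t) * X (c t)"
      using \<theta> unfolding angle_function_def by blast
    then have "vector_derivative c (at t) * deriv \<Phi> (c t) = of_real r * cis (\<theta> t) * (X (c t) * deriv \<Phi> (c t))"
      by (simp add: mult_ac)
    then show "\<exists>r>0. vector_derivative c (at t) * deriv \<Phi> (c t) = of_real r * cis (\<theta> t)"
      using r(1) S.generating_field_coordinate[OF X mem] by auto
  qed
  have "C.self_crossing s \<longleftrightarrow> (\<exists>t. s < t \<and> t < s + 1 \<and> c s = c t)" for s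
    unfolding C.self_crossing_def using inj_onD[OF S.inj _ mem mem] by metis
  moreover have "c (t + 1) \<noteq> c t" for t using cover_aperiodic[OF c st, of t 1] by auto
  ultimately show ?thesis
    using C.winding_parity[OF \<theta>(2)] bij_betw_same_card[OF double_points_pm_bij[OF c(1)]] by simp
qed

text \<open>A logarithm of the velocity over the contractible line supplies the angle; with it the
  union defining the winding number is not empty.\<close>

lemma winding_number_exists:
  assumes c: "cover_of_curve g p \<gamma> c" "period_deck g p c T" and st: "straightening g T \<Phi> l R"
  obtains X \<theta> and m :: int where "generating_field g T X" "angle_function X c \<theta>" "(\<theta> 0 + \<theta> 1) / (2 * pi) = of_int m"
proof -
  interpret S: straightening g T \<Phi> l R by (rule st)
  have mem: "c t \<in> model_plane g" for t using c by (auto simp: cover_of_curve_def)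
  let ?v = "\<lambda>t. vector_derivative c (at t) * deriv \<Phi> (c t)"
  have "continuous_on (model_plane g) (deriv \<Phi>)"
    using holomorphic_deriv[OF S.holo open_model_plane] by (rule holomorphic_on_imp_continuous_on)
  then have "continuous_on UNIV ?v"
    using c(1) mem
    by (intro continuous_intros cover_C1(2)[OF c(1)] continuous_on_compose2[of "model_plane g" "deriv \<Phi>" _ c])
       (auto simp: cover_of_curve_def)
  moreover have "?v t \<noteq> 0" for t using cover_C1(3)[OF c(1)] S.deriv_nonzero[OF mem] by simp
  ultimately obtain L where L: "continuous_on UNIV L" "\<And>t. ?v t = exp (L t)"
    using continuous_logarithm_on_contractible[of UNIV ?v] convex_imp_contractible[OF convex_UNIV] by auto
  define \<theta> where "\<theta> t = Im (L t)" for t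
  have \<theta>: "continuous_on UNIV \<theta>" unfolding \<theta>_def by (intro continuous_intros L)
  have polar: "?v t = of_real (exp (Re (L t))) * cis (\<theta> t)" for t
    unfolding L(2) \<theta>_def by (rule exp_eq_polar)
  interpret C: glide_curve "\<lambda>t. \<Phi> (c t)" ?v l \<theta>
  proof (rule glide_curve_of_cover[OF c st \<theta>])
    show "\<exists>r>0. ?v t = of_real r * cis (\<theta> t)" for t
      using polar[of t] exp_gt_zero[of "Re (L t)"] by (intro exI[of _ "exp (Re (L t))"] conjI)
  qed
  obtain m :: int where m: "\<theta> (0 + 1) + \<theta> 0 = 2 * pi * of_int m" using C.angle_sum by blast
  have "angle_function (\<lambda>z. 1 / deriv \<Phi> z) c \<theta>"
    unfolding angle_function_def
  proof (intro conjI \<theta> allI)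
    fix t
    have "vector_derivative c (at t) = of_real (exp (Re (L t))) * cis (\<theta> t) * (1 / deriv \<Phi> (c t))"
      using polar[of t] S.deriv_nonzero[OF mem] by (simp add: field_simps)
    then show "\<exists>r>0. vector_derivative c (at t) = of_real r * cis (\<theta> t) * (1 / deriv \<Phi> (c t))"
      using exp_gt_zero by blast
  qed
  moreover have "(\<theta> 0 + \<theta> 1) / (2 * pi) = of_int m" using m by (simp add: field_simps)
  ultimately show ?thesis using S.generating_field_exists that by blast
qed

end

theorem theorem3:
  fixes g :: geometry and M :: "'a::metric_space set"
    and p :: "complex \<Rightarrow> 'a" and \<gamma> :: "complex \<Rightarrow> 'a"
  assumes "complete_geometric_surface g M"
    and "\<not> orientable_surface g M"
    and "universal_covering g M p"
    and "regular_closed_curve g M \<gamma>"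
    and "generic_curve g M \<gamma>"
    and "orientation_reversing_curve g p \<gamma>"
  shows "winding_number_class g p \<gamma> = mod2_class (\<Sum>d\<in>double_points \<gamma>. curve_sgn g M p \<gamma> d) \<and>
         winding_number_class g p \<gamma> = mod2_class (\<Sum>d\<in>double_points_pm M \<gamma>. curve_sgn g M p \<gamma> d)"
proof -
  interpret covered_curve g M p \<gamma> using assms by unfold_locales
  let ?D = "double_points \<gamma>" and ?E = "double_points_pm M \<gamma>"
  obtain c0 T0 where c0: "cover_of_curve g p \<gamma> c0" "period_deck g p c0 T0"
    and rev: "orientation_reversing_on (model_plane g) T0"
    using assms(6) unfolding orientation_reversing_curve_def by blast
  have straight: "\<exists>\<Phi> l R. straightening g T \<Phi> l R"
    if cT: "cover_of_curve g p \<gamma> c" "period_deck g p c T" for c T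
  proof -
    have "deck_transformation g p T" using cT(2) by (simp add: period_deck_def)
    then show ?thesis
      using straightening_exists[OF covering _ period_orientation_reversing[OF c0 rev cT]] by metis
  qed
  obtain \<Phi> l R where st0: "straightening g T0 \<Phi> l R" using straight[OF c0] by blast
  have "?E \<subseteq> ?D" by (auto simp: double_points_pm_def)
  \<comment> \<open>Off \<open>double_points_pm M \<gamma>\<close> the sign is \<open>0\<close>, and
    the larger sum is finite.\<close>
  have sums: "(\<Sum>d\<in>?D. curve_sgn g M p \<gamma> d) = (\<Sum>d\<in>?E. curve_sgn g M p \<gamma> d)"
    by (rule sum.mono_neutral_right[OF finite_double_points \<open>?E \<subseteq> ?D\<close>]) (auto simp: curve_sgn_def)
  have parity: "even (\<Sum>d\<in>?E. curve_sgn g M p \<gamma> d) \<longleftrightarrow> even (card ?E)"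
    using finite_subset[OF \<open>?E \<subseteq> ?D\<close> finite_double_points] curve_sgn_odd[OF c0(1) cover_aperiodic[OF c0 st0]]
    by (intro even_sum_odd_iff) auto
  have all: "mod2_class m = mod2_class (\<Sum>d\<in>?E. curve_sgn g M p \<gamma> d)"
    if *: "cover_of_curve g p \<gamma> c" "period_deck g p c T" "generating_field g T X" "angle_function X c \<theta>"
      "(\<theta> 0 + \<theta> 1) / (2 * pi) = of_int m" for c T X \<theta> m
  proof -
    obtain \<Phi> l R where "straightening g T \<Phi> l R" using straight[OF *(1,2)] by blast
    from winding_number_parity[OF *(1,2) this *(3-5)] parity
    show ?thesis by (intro mod2_class_cong) simp
  qed
  have ex: "\<exists>m c T X \<theta>. cover_of_curve g p \<gamma> c \<and> period_deck g p c T \<and> generating_field g T X \<and>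
      angle_function X c \<theta> \<and> (\<theta> 0 + \<theta> 1) / (2 * pi) = of_int m"
    using winding_number_exists[OF c0 st0] c0 by metis
  \<comment> \<open>A union over a nonempty family of equal cosets is that coset.\<close>
  have union: "\<Union>{mod2_class m | m. P m} = N" if "\<And>m. P m \<Longrightarrow> mod2_class m = N" "\<exists>m. P m" for P N
    using that by auto
  have "winding_number_class g p \<gamma> = mod2_class (\<Sum>d\<in>?E. curve_sgn g M p \<gamma> d)"
    unfolding winding_number_class_def by (rule union[OF _ ex]) (use all in blast)
  then show ?thesis using sums by simp
qed

end
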